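(* Let $B_\tau=1$, $C_\tau=\tau$, $\bar{B}_\tau=1-\tau$, and let $$\bar{A}_{\tau,\sigma}=\alpha_{(0,0)}-\tfrac12\xi_1P_1(\sigma)+\tfrac12\xi_1P_1(\tau)+\sum_{\substack{i+j\ \text{even}\\ i+j>1}}\alpha_{(i,j)}P_i(\tau)P_j(\sigma),$$ with $\xi_1=\frac{1}{2\sqrt3}$ and real coefficients $\alpha_{(i,j)}$ (with only finitely many nonzero, or such that the series converges uniformly on $[0,1]^2$). Then the csRKN method $(\bar{A}_{\tau,\sigma},\bar{B}_\tau,B_\tau,C_\tau)$ is symmetric and of order at least $2$. If in addition $\alpha_{(0,0)}=\frac16$, it is of order at least $4$. If moreover $$\alpha_{(0,0)}=\tfrac16,\quad \alpha_{(1,1)}=-\tfrac1{10},\quad \alpha_{(2,0)}=\alpha_{(0,2)}=\tfrac{\sqrt5}{60},\quad \alpha_{(i,0)}=0\ \text{for all even } i>2,$$ then it is of order at least $6$.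
   Context: Consider $q''=f(t,q)$, $q(t_0)=q_0$, $q'(t_0)=q'_0$ with $f:\mathbb{R}\times\mathbb{R}^d\to\mathbb{R}^d$ smooth. The csRKN method with coefficients $(\bar{A}_{\tau,\sigma},\bar{B}_\tau,B_\tau,C_\tau)$ and step size $h$ is $$Q_\tau=q_0+hC_\tau q'_0+h^2\int_0^1\bar{A}_{\tau,\sigma}f(t_0+C_\sigma h,Q_\sigma)\,d\sigma,\ \tau\in[0,1],$$ $$q_1=q_0+hq'_0+h^2\int_0^1\bar{B}_\tau f(t_0+C_\tau h,Q_\tau)\,d\tau,\qquad q'_1=q'_0+h\int_0^1 B_\tau f(t_0+C_\tau h,Q_\tau)\,d\tau.$$ The method is of order $p$ if for every such problem with smooth $f$, $q(t_0+h)-q_1=O(h^{p+1})$ and $q'(t_0+h)-q'_1=O(h^{p+1})$ as $h\to0$. A one-step method $\Phi_h$ is symmetric if $\Phi_h=\Phi_{-h}^{-1}$. $P_k$ is the normalized shifted Legendre polynomial: $P_0=1$, $P_k(x)=\frac{\sqrt{2k+1}}{k!}\frac{d^k}{dx^k}[(x^2-x)^k]$, orthonormal on $[0,1]$. *)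

theory Defs
  imports "HOL-Analysis.Analysis"
begin

coinductive smooth_fun :: "('a::real_normed_vector \<Rightarrow> 'b::real_normed_vector) \<Rightarrow> bool" where
  "(\<forall>x. g differentiable (at x)) \<Longrightarrow>
   (\<forall>v. smooth_fun (\<lambda>x. frechet_derivative g (at x) v)) \<Longrightarrow> smooth_fun g"

text \<open>Normalized shifted Legendre polynomial on [0,1] (Rodrigues formula).\<close>
definition shLeg :: "nat \<Rightarrow> real \<Rightarrow> real" where
  "shLeg k x = sqrt (2 * real k + 1) / fact k * (deriv ^^ k) (\<lambda>y. (y^2 - y)^k) x"

definition csRKN_sol ::
  "(real \<Rightarrow> real \<Rightarrow> real) \<Rightarrow> (real \<Rightarrow> real) \<Rightarrow> (real \<Rightarrow> real) \<Rightarrow> (real \<Rightarrow> real)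
   \<Rightarrow> (real \<times> 'a::euclidean_space \<Rightarrow> 'a) \<Rightarrow> real \<Rightarrow> 'a \<Rightarrow> 'a \<Rightarrow> real
   \<Rightarrow> (real \<Rightarrow> 'a) \<Rightarrow> 'a \<Rightarrow> 'a \<Rightarrow> bool" where
  "csRKN_sol Ab Bb B C f t0 q0 p0 h Q q1 p1 \<longleftrightarrow>
     continuous_on {0..1} Q \<and>
     (\<forall>\<tau>\<in>{0..1}. Q \<tau> = q0 + (h * C \<tau>) *\<^sub>R p0 +
        h^2 *\<^sub>R integral {0..1} (\<lambda>\<sigma>. Ab \<tau> \<sigma> *\<^sub>R f (t0 + C \<sigma> * h, Q \<sigma>))) \<and>
     q1 = q0 + h *\<^sub>R p0 + h^2 *\<^sub>R integral {0..1} (\<lambda>\<tau>. Bb \<tau> *\<^sub>R f (t0 + C \<tau> * h, Q \<tau>)) \<and>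
     p1 = p0 + h *\<^sub>R integral {0..1} (\<lambda>\<tau>. B \<tau> *\<^sub>R f (t0 + C \<tau> * h, Q \<tau>))"

definition csRKN_step ::
  "(real \<Rightarrow> real \<Rightarrow> real) \<Rightarrow> (real \<Rightarrow> real) \<Rightarrow> (real \<Rightarrow> real) \<Rightarrow> (real \<Rightarrow> real)
   \<Rightarrow> (real \<times> 'a::euclidean_space \<Rightarrow> 'a) \<Rightarrow> real \<Rightarrow> 'a \<Rightarrow> 'a \<Rightarrow> real \<Rightarrow> 'a \<Rightarrow> 'a \<Rightarrow> bool" where
  "csRKN_step Ab Bb B C f t0 q0 p0 h q1 p1 \<longleftrightarrow> (\<exists>Q. csRKN_sol Ab Bb B C f t0 q0 p0 h Q q1 p1)"

text \<open>Symmetry Phi_h = (Phi_{-h})^{-1}, as relations on (t,q,q').\<close>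
definition csRKN_symmetric ::
  "(real \<Rightarrow> real \<Rightarrow> real) \<Rightarrow> (real \<Rightarrow> real) \<Rightarrow> (real \<Rightarrow> real) \<Rightarrow> (real \<Rightarrow> real)
   \<Rightarrow> 'a::euclidean_space itself \<Rightarrow> bool" where
  "csRKN_symmetric Ab Bb B C (_::'a itself) \<longleftrightarrow>
     (\<forall>f :: real \<times> 'a \<Rightarrow> 'a. smooth_fun f \<longrightarrow>
       (\<forall>t0 q0 p0 h q1 p1. csRKN_step Ab Bb B C f t0 q0 p0 h q1 p1 \<longleftrightarrow>
                           csRKN_step Ab Bb B C f (t0 + h) q1 p1 (-h) q0 p0))"

definition csRKN_order ::
  "(real \<Rightarrow> real \<Rightarrow> real) \<Rightarrow> (real \<Rightarrow> real) \<Rightarrow> (real \<Rightarrow> real) \<Rightarrow> (real \<Rightarrow> real)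
   \<Rightarrow> nat \<Rightarrow> 'a::euclidean_space itself \<Rightarrow> bool" where
  "csRKN_order Ab Bb B C p (_::'a itself) \<longleftrightarrow>
     (\<forall>(f :: real \<times> 'a \<Rightarrow> 'a) t0 q0 p0 (q :: real \<Rightarrow> 'a) v \<delta>.
        smooth_fun f \<and> \<delta> > 0 \<and> q t0 = q0 \<and> v t0 = p0 \<and>
        (\<forall>t\<in>ball t0 \<delta>. (q has_vector_derivative v t) (at t) \<and>
                        (v has_vector_derivative f (t, q t)) (at t)) \<longrightarrow>
        (\<exists>r>0. \<exists>h0>0. \<exists>K. \<forall>h. \<bar>h\<bar> < h0 \<longrightarrow>
           (\<exists>Q q1 p1. csRKN_sol Ab Bb B C f t0 q0 p0 h Q q1 p1 \<and> (\<forall>\<tau>\<in>{0..1}. dist (Q \<tau>) q0 \<le> r)) \<and>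
           (\<forall>Q q1 p1. csRKN_sol Ab Bb B C f t0 q0 p0 h Q q1 p1 \<and> (\<forall>\<tau>\<in>{0..1}. dist (Q \<tau>) q0 \<le> r) \<longrightarrow>
              norm (q (t0 + h) - q1) \<le> K * \<bar>h\<bar> ^ (p + 1) \<and>
              norm (v (t0 + h) - p1) \<le> K * \<bar>h\<bar> ^ (p + 1))))"

end

theory Submission
  imports Defs "HOL-Computational_Algebra.Polynomial"
begin

text \<open>
  Write \<open>y \<tau> = q (t0 + \<tau> h)\<close>, \<open>g s = q'' (t0 + s)\<close> and \<open>E = Q - y\<close>. The exact solution satisfies the stage equation
  with the kernel \<open>max 0 (\<tau> - \<sigma>)\<close>, and the final quadratures are exact, so with the defect
  \<open>D \<tau> \<sigma> = A \<tau> \<sigma> - max 0 (\<tau> - \<sigma>)\<close> one has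
  \<open>E = h\<^sup>2 \<integral> A (f(Q) - f(y)) + h\<^sup>2 \<integral> D \<tau> \<sigma> g(\<sigma> h) d\<sigma>\<close>,
  and the errors of \<open>q\<close> and \<open>q'\<close> are \<open>h\<^sup>2 \<integral> (1 - \<tau>) (f(Q) - f(y))\<close> and \<open>h \<integral> (f(Q) - f(y))\<close>.
  Expanding in powers of \<open>h\<close>, the order is read off from the vanishing of the moments
  \<open>\<integral>\<integral> \<tau>\<^sup>i D \<tau> \<sigma> \<sigma>\<^sup>k\<close> of low degree. The parity of the Legendre polynomials gives
  \<open>D (1 - \<tau>) (1 - \<sigma>) = D \<tau> \<sigma>\<close>, which expresses the symmetry of the method and kills every odd
  moment for free; the remaining ones are fixed by the prescribed coefficients.
\<close>

section \<open>Shifted Legendre polynomials\<close>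

text \<open>The kernel is only given as a limit of finite partial sums, so each identity for it is
  proved for partial sums and passed to the limit. In place of rooted trees, the error expansion
  linearizes \<open>f\<close> along the exact solution, at a cost quadratic in \<open>E\<close>.
  With \<open>E = O(h^2)\<close> this cost is O(h^4), enough for order 4. Order 6 needs O(h^6),
  hence \<open>E = O(h^3)\<close>; this is why \<integral> D(\<tau>, \<sigma>) d\<sigma> must vanish
  for every \<tau> and not just on average, and why a whole column of coefficients \<alpha>(i, 0) is
  prescribed. One contribution of order h^5 is not a moment of \<open>D\<close>: the error fed back
  through the kernel yields an iterated integral of \<open>A\<close> against the first row of
  \<open>D\<close>. Reflection kills that term too. The prescribed numbers are Legendre coefficients
  of the exact kernel \<open>max 0 (\<tau> - \<sigma>)\<close>: 1/6 at (0, 0), -1/10 at (1, 1), sqrt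
  5 / 60 at (2, 0) and (0, 2).\<close>

lemma deriv_iter_poly: "(deriv ^^ k) (poly p) = poly ((pderiv ^^ k) p)" for p :: "real poly"
proof (induction k)
  case (Suc k)
  have "deriv (poly r) = poly (pderiv r)" for r :: "real poly"
    by (rule ext) (rule DERIV_imp_deriv, rule poly_DERIV)
  then show ?case using Suc by simp
qed simp

text \<open>Rodrigues' formula in the polynomial ring, where \<open>[:0, -1, 1:]\<close> is x^2 - x.
  Reflection becomes \<open>pcompose\<close>, and vanishing at the endpoints becomes
  divisibility.\<close>

definition legPoly :: "nat \<Rightarrow> real poly" where
  "legPoly k = smult (sqrt (2 * real k + 1) / fact k) ((pderiv ^^ k) ([:0, -1, 1:] ^ k))"

lemma shLeg_eq_poly: "shLeg k = poly (legPoly k)"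
proof
  fix x
  have "(\<lambda>y::real. (y^2 - y)^k) = poly ([:0, -1, 1:] ^ k)"
    by (auto simp: poly_power power2_eq_square algebra_simps)
  then show "shLeg k x = poly (legPoly k) x"
    by (simp add: shLeg_def legPoly_def deriv_iter_poly)
qed

lemma continuous_on_shLeg [continuous_intros]:
  "continuous_on S g \<Longrightarrow> continuous_on S (\<lambda>x. shLeg k (g x))"
  unfolding shLeg_eq_poly by (intro continuous_intros)

lemma shLeg_0: "shLeg 0 x = 1"
  by (simp add: shLeg_eq_poly legPoly_def)

lemma shLeg_1: "shLeg (Suc 0) x = sqrt 3 * (2 * x - 1)"
  by (simp add: shLeg_eq_poly legPoly_def pderiv_pCons algebra_simps)

lemma shLeg_2: "shLeg 2 x = sqrt 5 * (6 * x^2 - 6 * x + 1)"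
  by (simp add: shLeg_eq_poly legPoly_def pderiv_pCons numeral_2_eq_2 field_simps)

text \<open>Chain rule: each differentiation contributes the factor -1 of the inner map 1 -
  x.\<close>

lemma pderiv_iter_reflect:
  "(pderiv ^^ k) (p \<circ>\<^sub>p [:1, -1:]) = smult ((-1) ^ k) (((pderiv ^^ k) p) \<circ>\<^sub>p [:1, -1:])"
  for p :: "real poly"
  by (induction k) (simp_all add: pderiv_smult pderiv_pcompose pderiv_pCons)

text \<open>x^2 - x is invariant under x -> 1 - x, so the sign comes from the k derivatives
  alone.\<close>

lemma shLeg_reflect: "shLeg k (1 - x) = (-1) ^ k * shLeg k x"
proof -
  define w :: "real poly" where "w = [:0, -1, 1:]"
  have "w \<circ>\<^sub>p [:1, -1:] = w"
    by (simp add: w_def pcompose_pCons)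
  then have "w ^ k \<circ>\<^sub>p [:1, -1:] = w ^ k"
    by (induction k) (simp_all add: pcompose_mult pcompose_1)
  then have "(pderiv ^^ k) (w ^ k) = smult ((-1) ^ k) ((pderiv ^^ k) (w ^ k) \<circ>\<^sub>p [:1, -1:])"
    using pderiv_iter_reflect[of k "w ^ k"] by simp
  from arg_cong[OF this, of "\<lambda>p. poly p x"]
  have *: "poly ((pderiv ^^ k) (w ^ k)) x = (-1) ^ k * poly ((pderiv ^^ k) (w ^ k)) (1 - x)"
    unfolding poly_smult poly_pcompose by simp
  have "(-1) ^ k * ((-1) ^ k * y) = (y::real)" for y
    by (simp flip: mult.assoc power_mult_distrib)
  then have "poly ((pderiv ^^ k) (w ^ k)) (1 - x) = (-1) ^ k * poly ((pderiv ^^ k) (w ^ k)) x"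
    unfolding * by simp
  then show ?thesis
    by (simp add: shLeg_eq_poly legPoly_def flip: w_def)
qed

text \<open>Each derivative lowers the multiplicity of a root by at most one. Truncated subtraction
  makes the claim trivial once m reaches n.\<close>

lemma power_dvd_pderiv_iter:
  assumes "[:- a, 1:] ^ n dvd p"
  shows "[:- a, 1:] ^ (n - m) dvd (pderiv ^^ m) (p :: real poly)"
proof (induction m)
  case (Suc m)
  have *: "[:- a, 1:] ^ (j - 1) dvd pderiv r" if d: "[:- a, 1:] ^ j dvd r" for j and r :: "real poly"
  proof (cases j)
    case (Suc i)
    define l where "l = [:- a, 1:]"
    obtain s where s: "r = l ^ Suc i * s" using d unfolding dvd_def Suc l_def by blast
    have "pderiv l = 1" by (simp add: l_def pderiv_pCons)
    then have "pderiv (l ^ Suc i) = smult (of_nat (Suc i)) (l ^ i)"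
      by (simp only: pderiv_power_Suc mult_1_right)
    then have "pderiv r = l ^ i * (l * pderiv s + smult (of_nat (Suc i)) s)"
      unfolding s pderiv_mult by (simp add: algebra_simps)
    then show ?thesis using Suc by (simp add: l_def)
  qed simp
  have "n - Suc m = n - m - 1" by simp
  then show ?case using *[OF Suc] by (metis funpow.simps(2) o_apply)
qed (use assms in simp)

text \<open>Both endpoints are roots of (x^2 - x)^n of multiplicity n, and fewer than n derivatives
  leave a root. These are the boundary terms of repeated integration by parts.\<close>

lemma legendre_boundary:
  assumes "m < n" "a = 0 \<or> a = 1"
  shows "poly ((pderiv ^^ m) ([:0, -1, 1:] ^ n)) (a::real) = 0"
proof -
  have "[:- a, 1:] dvd ([:0, -1, 1:] :: real poly)"
    using assms(2) by (auto simp: poly_eq_0_iff_dvd[symmetric])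
  then have "[:- a, 1:] ^ n dvd ([:0, -1, 1:] :: real poly) ^ n"
    by (rule dvd_power_same)
  from power_dvd_pderiv_iter[OF this, of m]
  have "[:- a, 1:] dvd (pderiv ^^ m) ([:0, -1, 1:] ^ n)"
    by (rule dvd_trans[rotated]) (use assms(1) in \<open>simp add: dvd_power\<close>)
  then show ?thesis by (simp add: poly_eq_0_iff_dvd)
qed

lemma integral_poly_pderiv:
  "((\<lambda>x. poly (pderiv p) x) has_integral poly p 1 - poly p 0) {0..1::real}"
  by (rule fundamental_theorem_of_calculus)
     (auto intro: has_vector_derivative_at_within has_real_derivative_iff_has_vector_derivative[THEN iffD1] poly_DERIV)

text \<open>Three integrations by parts carried out at once by an explicit antiderivative; the
  process stops because the third derivative of a quadratic is zero.\<close>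

lemma shLeg_orthogonal_low:
  assumes "n > 2"
  shows "integral {0..1} (\<lambda>x. shLeg n x * (a + b * x + c * x^2)) = 0"
proof -
  define u :: "nat \<Rightarrow> real poly" where "u m = (pderiv ^^ m) ([:0, -1, 1:] ^ n)" for m
  have pu: "pderiv (u m) = u (Suc m)" for m by (simp add: u_def)
  have u0: "poly (u m) 0 = 0" "poly (u m) 1 = 0" if "m < n" for m
    using that legendre_boundary by (auto simp: u_def)
  obtain m where n: "n = Suc (Suc (Suc m))"
    using assms by (metis Suc_leI Suc_le_D numeral_2_eq_2 Suc_le_mono)
  define p where "p = [:a, b, c:]"
  \<comment> \<open>The derivative of \<open>G\<close> telescopes to \<open>u n * p\<close> plus
    \<open>u m\<close> times the third derivative of \<open>p\<close>. Every term of
    \<open>G\<close> contains some \<open>u i\<close> with i < n, so \<open>G\<close> vanishes at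
    both endpoints.\<close>
  define G where "G = u (Suc (Suc m)) * p - u (Suc m) * pderiv p + u m * pderiv (pderiv p)"
  have "pderiv (pderiv (pderiv p)) = 0"
    by (simp add: p_def pderiv_pCons)
  then have "pderiv G = u n * p"
    unfolding G_def n by (simp add: pderiv_mult pderiv_add pderiv_diff pu algebra_simps)
  with integral_poly_pderiv[of G]
  have "((\<lambda>x. poly (u n * p) x) has_integral 0) {0..1}"
    by (simp add: G_def u0 n)
  then have *: "((\<lambda>x. sqrt (2 * real n + 1) / fact n * poly (u n * p) x) has_integral
      sqrt (2 * real n + 1) / fact n * 0) {0..1}"
    by (rule has_integral_mult_right)
  have "sqrt (2 * real n + 1) / fact n * poly (u n * p) x = shLeg n x * (a + b * x + c * x^2)" for x
    by (simp add: shLeg_eq_poly legPoly_def u_def p_def power2_eq_square field_simps)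
  then show ?thesis
    using integral_unique[OF *] by simp
qed

lemma integral_quartic:
  "integral {0..1} (\<lambda>x::real. a + b * x + c * x^2 + d * x^3 + e * x^4) = a + b/2 + c/3 + d/4 + e/5"
proof (rule integral_unique)
  have "((\<lambda>x::real. a + b * x + c * x^2 + d * x^3 + e * x^4) has_integral
    (\<lambda>x. a * x + b * x^2 / 2 + c * x^3 / 3 + d * x^4 / 4 + e * x^5 / 5) 1
     - (\<lambda>x. a * x + b * x^2 / 2 + c * x^3 / 3 + d * x^4 / 4 + e * x^5 / 5) 0) {0..1}"
    by (rule fundamental_theorem_of_calculus)
       (auto intro!: derivative_eq_intros simp: has_real_derivative_iff_has_vector_derivative[symmetric] field_simps)
  then show "((\<lambda>x::real. a + b * x + c * x^2 + d * x^3 + e * x^4) has_integral a + b/2 + c/3 + d/4 + e/5) {0..1}"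
    by simp
qed

text \<open>Bounding one index suffices because the kernel is only tested against P_0, P_1, P_2. A
  large other index is covered by orthogonality to quadratics, the rest is a finite table of
  quartics.\<close>

lemma shLeg_orthonormal_low:
  assumes "j \<le> 2"
  shows "integral {0..1} (\<lambda>x. shLeg i x * shLeg j x) = (if i = j then 1 else 0)"
proof -
  have j: "j = 0 \<or> j = 1 \<or> j = 2" using assms by auto
  have *: "\<exists>a b c. shLeg k = (\<lambda>x. a + b * x + c * x^2)" if "k = 0 \<or> k = 1 \<or> k = 2" for k
  proof -
    have "shLeg 0 = (\<lambda>x. 1 + 0 * x + 0 * x^2)" by (auto simp: shLeg_0)
    moreover have "shLeg 1 = (\<lambda>x. - sqrt 3 + (2 * sqrt 3) * x + 0 * x^2)"
      by (auto simp: shLeg_1 algebra_simps)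
    moreover have "shLeg 2 = (\<lambda>x. sqrt 5 + (- 6 * sqrt 5) * x + (6 * sqrt 5) * x^2)"
      by (auto simp: shLeg_2 algebra_simps)
    ultimately show ?thesis using that by metis
  qed
  show ?thesis
  proof (cases "i > 2")
    case True
    obtain a b c where "shLeg j = (\<lambda>x. a + b * x + c * x^2)" using *[OF j] by blast
    then show ?thesis using True j shLeg_orthogonal_low[of i a b c] by auto
  next
    case False
    then have i: "i = 0 \<or> i = 1 \<or> i = 2" by auto
    have s: "sqrt 3 * sqrt 3 = 3" "sqrt 5 * sqrt 5 = 5" "\<And>x. sqrt 3 * (sqrt 3 * x) = 3 * x" "\<And>x. sqrt 5 * (sqrt 5 * x) = 5 * x"
      by (simp_all flip: mult.assoc)
    have eqs: "(\<lambda>x. shLeg 0 x * shLeg 0 x) = (\<lambda>x. 1 + 0 * x + 0 * x^2 + 0 * x^3 + 0 * x^4)"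
      "(\<lambda>x. shLeg 0 x * shLeg 1 x) = (\<lambda>x. - sqrt 3 + (2 * sqrt 3) * x + 0 * x^2 + 0 * x^3 + 0 * x^4)"
      "(\<lambda>x. shLeg 0 x * shLeg 2 x) = (\<lambda>x. sqrt 5 + (- 6 * sqrt 5) * x + (6 * sqrt 5) * x^2 + 0 * x^3 + 0 * x^4)"
      "(\<lambda>x. shLeg 1 x * shLeg 1 x) = (\<lambda>x. 3 + (- 12) * x + 12 * x^2 + 0 * x^3 + 0 * x^4)"
      "(\<lambda>x. shLeg 1 x * shLeg 2 x) = (\<lambda>x. - (sqrt 3 * sqrt 5) + (8 * (sqrt 3 * sqrt 5)) * x
          + (- 18 * (sqrt 3 * sqrt 5)) * x^2 + (12 * (sqrt 3 * sqrt 5)) * x^3 + 0 * x^4)"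
      "(\<lambda>x. shLeg 2 x * shLeg 2 x) = (\<lambda>x. 5 + (- 60) * x + 240 * x^2 + (- 360) * x^3 + 180 * x^4)"
      by (rule ext, simp add: shLeg_0 shLeg_1 shLeg_2 algebra_simps s power2_eq_square power3_eq_cube power4_eq_xxxx)+
    \<comment> \<open>The table \<open>eqs\<close> lists ordered pairs only; exchanging the factors
      reduces j < i to it.\<close>
    have sw: "(\<lambda>x. shLeg i x * shLeg j x) = (\<lambda>x. shLeg j x * shLeg i x)" by (simp add: mult.commute)
    have "integral {0..1} (\<lambda>x. shLeg k x * shLeg l x) = (if k = l then 1 else 0)"
      if "k \<le> l" "k = 0 \<or> k = 1 \<or> k = 2" "l = 0 \<or> l = 1 \<or> l = 2" for k l
      using that by (elim disjE) (simp_all only: eqs integral_quartic, simp_all)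
    from this[of i j] this[of j i] show ?thesis using i j sw by (cases "i \<le> j") auto
  qed
qed

lemma shLeg_has_integral_low:
  assumes "j \<le> 2"
  shows "((\<lambda>x. shLeg i x * shLeg j x) has_integral (if i = j then 1 else 0)) {0..1}"
proof -
  have "(\<lambda>x. shLeg i x * shLeg j x) integrable_on {0..1}"
    by (intro integrable_continuous_real continuous_intros)
  from integrable_integral[OF this] show ?thesis
    by (simp only: shLeg_orthonormal_low[OF assms])
qed

section \<open>Kernels given by Legendre series\<close>

lemma continuous_on_unit_square_comp:
  fixes f g :: "_ \<Rightarrow> real"
  assumes "continuous_on ({0..1} \<times> {0..1}) (\<lambda>(x, y). K x y)"
    and "continuous_on S f" "continuous_on S g" "f ` S \<subseteq> {0..1}" "g ` S \<subseteq> {0..1}"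
  shows "continuous_on S (\<lambda>x. K (f x) (g x))"
  using continuous_on_compose2[OF assms(1) continuous_on_Pair[OF assms(2,3)]] assms(4,5) by auto

text \<open>The two P_1 terms add up to (\<tau> - \<sigma>) / 2, which is also the antisymmetric
  part of \<open>max 0 (\<tau> - \<sigma>)\<close>. This determines the constant \<xi>_1 = 1 / (2 *
  sqrt 3).\<close>

definition partial_kernel :: "(nat \<Rightarrow> nat \<Rightarrow> real) \<Rightarrow> (nat \<times> nat) set \<Rightarrow> real \<Rightarrow> real \<Rightarrow> real" where
  "partial_kernel \<alpha> F \<tau> \<sigma> = \<alpha> 0 0 - (1 / (2 * sqrt 3)) / 2 * shLeg 1 \<sigma> + (1 / (2 * sqrt 3)) / 2 * shLeg 1 \<tau>
         + (\<Sum>(i, j)\<in>F. \<alpha> i j * shLeg i \<tau> * shLeg j \<sigma>)"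

definition tail_indices :: "(nat \<times> nat) set" where
  "tail_indices = {(i, j). even (i + j) \<and> i + j > 1}"

text \<open>Convergence along all finite index sets is unconditional. Finitely many nonzero
  coefficients are included, since the partial sums are then eventually constant.\<close>

locale legendre_kernel =
  fixes \<alpha> :: "nat \<Rightarrow> nat \<Rightarrow> real" and A :: "real \<Rightarrow> real \<Rightarrow> real"
  assumes limit: "uniform_limit ({0..1} \<times> {0..1}) (\<lambda>F (\<tau>, \<sigma>). partial_kernel \<alpha> F \<tau> \<sigma>)
     (\<lambda>(\<tau>, \<sigma>). A \<tau> \<sigma>) (finite_subsets_at_top tail_indices)"
begin

lemma continuous_on_partial_kernel [continuous_intros]:
  "continuous_on S f \<Longrightarrow> continuous_on S g \<Longrightarrow> continuous_on S (\<lambda>x. partial_kernel \<alpha> F (f x) (g x))"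
  unfolding partial_kernel_def split_def by (intro continuous_intros)

lemma continuous_A: "continuous_on ({0..1} \<times> {0..1}) (\<lambda>(\<tau>, \<sigma>). A \<tau> \<sigma>)"
proof (rule uniform_limit_theorem[OF _ limit])
  show "\<forall>\<^sub>F F in finite_subsets_at_top tail_indices. continuous_on ({0..1} \<times> {0..1}) (\<lambda>(\<tau>, \<sigma>). partial_kernel \<alpha> F \<tau> \<sigma>)"
    unfolding split_def by (intro always_eventually allI continuous_intros)
qed simp

lemmas continuous_A_comp = continuous_on_unit_square_comp[OF continuous_A]

lemma pointwise_limit:
  assumes "\<tau> \<in> {0..1}" "\<sigma> \<in> {0..1}"
  shows "((\<lambda>F. partial_kernel \<alpha> F \<tau> \<sigma>) \<longlongrightarrow> A \<tau> \<sigma>) (finite_subsets_at_top tail_indices)"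
  using tendsto_uniform_limitI[OF limit, of "(\<tau>, \<sigma>)"] assms by simp

text \<open>If i + j is even, i and j have the same parity, so reflecting \<tau> in P_i(\<tau>)
  P_j(\<sigma>) has the same effect as reflecting \<sigma>. Only the linear part (\<tau> - \<sigma>)
  / 2 distinguishes the two, and it accounts for 1 - \<sigma> - \<tau>.\<close>

lemma A_reflect:
  assumes "\<tau> \<in> {0..1}" "\<sigma> \<in> {0..1}"
  shows "A (1 - \<tau>) \<sigma> = A \<tau> (1 - \<sigma>) + 1 - \<sigma> - \<tau>"
proof (rule tendsto_unique)
  show "((\<lambda>F. partial_kernel \<alpha> F (1 - \<tau>) \<sigma>) \<longlongrightarrow> A (1 - \<tau>) \<sigma>) (finite_subsets_at_top tail_indices)"
    by (rule pointwise_limit) (use assms in auto)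
  have "((\<lambda>F. partial_kernel \<alpha> F \<tau> (1 - \<sigma>) + 1 - \<sigma> - \<tau>) \<longlongrightarrow> A \<tau> (1 - \<sigma>) + 1 - \<sigma> - \<tau>) (finite_subsets_at_top tail_indices)"
    by (intro tendsto_intros pointwise_limit) (use assms in auto)
  moreover have "partial_kernel \<alpha> F (1 - \<tau>) \<sigma> = partial_kernel \<alpha> F \<tau> (1 - \<sigma>) + 1 - \<sigma> - \<tau>" if "F \<subseteq> tail_indices" for F
  proof -
    have "(\<Sum>(i, j)\<in>F. \<alpha> i j * shLeg i (1 - \<tau>) * shLeg j \<sigma>) = (\<Sum>(i, j)\<in>F. \<alpha> i j * shLeg i \<tau> * shLeg j (1 - \<sigma>))"
    proof (intro sum.cong refl, clarify)
      fix i j assume "(i, j) \<in> F"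
      then have "even (i + j)" using that by (auto simp: tail_indices_def)
      then have "even i = even j" by simp
      then show "\<alpha> i j * shLeg i (1 - \<tau>) * shLeg j \<sigma> = \<alpha> i j * shLeg i \<tau> * shLeg j (1 - \<sigma>)"
        unfolding shLeg_reflect by (cases "even i") auto
    qed
    moreover have "(1 / (2 * sqrt 3)) / 2 * shLeg 1 x = x / 2 - 1 / 4" for x
      by (simp add: shLeg_1 field_simps)
    ultimately show ?thesis
      unfolding partial_kernel_def by (simp only:) (simp add: field_simps)
  qed
  ultimately show "((\<lambda>F. partial_kernel \<alpha> F (1 - \<tau>) \<sigma>) \<longlongrightarrow> A \<tau> (1 - \<sigma>) + 1 - \<sigma> - \<tau>) (finite_subsets_at_top tail_indices)"
    by (subst tendsto_cong) (auto intro: eventually_finite_subsets_at_top_weakI)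
qed simp

text \<open>Orthonormality in \<sigma> keeps column j of the coefficients; the constant and linear
  terms of the kernel belong to columns 0 and 1.\<close>

lemma partial_kernel_moment:
  assumes "j \<le> 2" "finite F"
  shows "((\<lambda>\<sigma>. partial_kernel \<alpha> F \<tau> \<sigma> * shLeg j \<sigma>) has_integral
    (if j = 0 then \<alpha> 0 0 + (1 / (2 * sqrt 3)) / 2 * shLeg 1 \<tau> else 0) - (if j = 1 then (1 / (2 * sqrt 3)) / 2 else 0)
     + (\<Sum>(i, k)\<in>F. if k = j then \<alpha> i k * shLeg i \<tau> else 0)) {0..1}"
proof -
  have "((\<lambda>\<sigma>. (\<alpha> 0 0 + (1 / (2 * sqrt 3)) / 2 * shLeg 1 \<tau>) * (shLeg 0 \<sigma> * shLeg j \<sigma>)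
      - (1 / (2 * sqrt 3)) / 2 * (shLeg 1 \<sigma> * shLeg j \<sigma>)
      + (\<Sum>x\<in>F. (\<alpha> (fst x) (snd x) * shLeg (fst x) \<tau>) * (shLeg (snd x) \<sigma> * shLeg j \<sigma>))) has_integral
    (\<alpha> 0 0 + (1 / (2 * sqrt 3)) / 2 * shLeg 1 \<tau>) * (if 0 = j then 1 else 0)
      - (1 / (2 * sqrt 3)) / 2 * (if 1 = j then 1 else 0)
      + (\<Sum>x\<in>F. (\<alpha> (fst x) (snd x) * shLeg (fst x) \<tau>) * (if snd x = j then 1 else 0))) {0..1}"
    by (intro has_integral_add has_integral_diff has_integral_mult_right has_integral_sum shLeg_has_integral_low assms)
  moreover have "(\<alpha> 0 0 + (1 / (2 * sqrt 3)) / 2 * shLeg 1 \<tau>) * (shLeg 0 \<sigma> * shLeg j \<sigma>)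
      - (1 / (2 * sqrt 3)) / 2 * (shLeg 1 \<sigma> * shLeg j \<sigma>)
      + (\<Sum>x\<in>F. (\<alpha> (fst x) (snd x) * shLeg (fst x) \<tau>) * (shLeg (snd x) \<sigma> * shLeg j \<sigma>))
      = partial_kernel \<alpha> F \<tau> \<sigma> * shLeg j \<sigma>" for \<sigma>
    by (simp add: partial_kernel_def split_def shLeg_0 sum_distrib_right sum_distrib_left algebra_simps)
  moreover have "(\<alpha> 0 0 + (1 / (2 * sqrt 3)) / 2 * shLeg 1 \<tau>) * (if 0 = j then 1 else 0)
      - (1 / (2 * sqrt 3)) / 2 * (if 1 = j then 1 else 0)
      + (\<Sum>x\<in>F. (\<alpha> (fst x) (snd x) * shLeg (fst x) \<tau>) * (if snd x = j then 1 else 0))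
     = (if j = 0 then \<alpha> 0 0 + (1 / (2 * sqrt 3)) / 2 * shLeg 1 \<tau> else 0) - (if j = 1 then (1 / (2 * sqrt 3)) / 2 else 0)
     + (\<Sum>(i, k)\<in>F. if k = j then \<alpha> i k * shLeg i \<tau> else 0)"
    by (auto simp: split_def intro!: sum.cong)
  ultimately show ?thesis by simp
qed

lemma uniform_limit_moment:
  "uniform_limit {0..1} (\<lambda>F \<tau>. integral {0..1} (\<lambda>\<sigma>. partial_kernel \<alpha> F \<tau> \<sigma> * shLeg j \<sigma>))
    (\<lambda>\<tau>. integral {0..1} (\<lambda>\<sigma>. A \<tau> \<sigma> * shLeg j \<sigma>)) (finite_subsets_at_top tail_indices)"
proof (rule uniform_limitI)
  fix e :: real assume e: "e > 0"
  have "compact (shLeg j ` {0..1})"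
    by (intro compact_continuous_image continuous_intros) auto
  then have "bounded (shLeg j ` {0..1})" by (rule compact_imp_bounded)
  then obtain C where C: "C > 0" "\<And>x. x \<in> {0..1} \<Longrightarrow> \<bar>shLeg j x\<bar> \<le> C"
    by (auto simp: bounded_pos)
  have "\<forall>\<^sub>F F in finite_subsets_at_top tail_indices. \<forall>x\<in>{0..1} \<times> {0..1}.
      dist (case x of (\<tau>, \<sigma>) \<Rightarrow> partial_kernel \<alpha> F \<tau> \<sigma>) (case x of (\<tau>, \<sigma>) \<Rightarrow> A \<tau> \<sigma>) < e / (2 * C)"
    \<comment> \<open>The factor 2 keeps the final inequality strict: the integral is bounded by e /
      2.\<close>
    using limit e C(1) by (auto simp: uniform_limit_iff)
  then show "\<forall>\<^sub>F F in finite_subsets_at_top tail_indices. \<forall>\<tau>\<in>{0..1}.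
      dist (integral {0..1} (\<lambda>\<sigma>. partial_kernel \<alpha> F \<tau> \<sigma> * shLeg j \<sigma>)) (integral {0..1} (\<lambda>\<sigma>. A \<tau> \<sigma> * shLeg j \<sigma>)) < e"
  proof eventually_elim
    case (elim F)
    show ?case
    proof
      fix \<tau> :: real assume t: "\<tau> \<in> {0..1}"
      have iS: "continuous_on {0..1} (\<lambda>\<sigma>. partial_kernel \<alpha> F \<tau> \<sigma> * shLeg j \<sigma>)"
        by (intro continuous_intros)
      have iA: "continuous_on {0..1} (\<lambda>\<sigma>. A \<tau> \<sigma> * shLeg j \<sigma>)"
        by (intro continuous_intros continuous_A_comp) (use t in auto)
      have "norm (integral {0..1} (\<lambda>\<sigma>. partial_kernel \<alpha> F \<tau> \<sigma> * shLeg j \<sigma> - A \<tau> \<sigma> * shLeg j \<sigma>)) \<le> e / (2 * C) * C * (1 - 0)"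
      proof (rule integral_bound)
        show "continuous_on {0..1} (\<lambda>\<sigma>. partial_kernel \<alpha> F \<tau> \<sigma> * shLeg j \<sigma> - A \<tau> \<sigma> * shLeg j \<sigma>)"
          by (intro continuous_on_diff iS iA)
        fix \<sigma> :: real assume s: "\<sigma> \<in> {0..1}"
        have "\<bar>partial_kernel \<alpha> F \<tau> \<sigma> - A \<tau> \<sigma>\<bar> \<le> e / (2 * C)"
          using elim[rule_format, of "(\<tau>, \<sigma>)"] s t by (simp add: dist_real_def)
        then have "\<bar>partial_kernel \<alpha> F \<tau> \<sigma> - A \<tau> \<sigma>\<bar> * \<bar>shLeg j \<sigma>\<bar> \<le> e / (2 * C) * C"
          by (intro mult_mono C(2) s) (use e C(1) in auto)
        then show "norm (partial_kernel \<alpha> F \<tau> \<sigma> * shLeg j \<sigma> - A \<tau> \<sigma> * shLeg j \<sigma>) \<le> e / (2 * C) * C"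
          by (simp add: abs_mult flip: left_diff_distrib)
      qed simp
      also have "e / (2 * C) * C * (1 - 0) < e" using e C(1) by simp
      finally show "dist (integral {0..1} (\<lambda>\<sigma>. partial_kernel \<alpha> F \<tau> \<sigma> * shLeg j \<sigma>)) (integral {0..1} (\<lambda>\<sigma>. A \<tau> \<sigma> * shLeg j \<sigma>)) < e"
        using integral_diff[OF integrable_continuous_real[OF iS] integrable_continuous_real[OF iA]]
        by (simp add: dist_norm)
    qed
  qed
qed

text \<open>Recovers a coefficient of the series from its limit. Parity of i + j excludes (1, 0) and
  (0, 1), where the kernel carries \<plusminus> \<xi>_1 / 2 in place of an \<alpha>.\<close>

lemma A_double_moment:
  assumes "i \<le> 2" "j \<le> 2" "even (i + j)"
  shows "integral {0..1} (\<lambda>\<tau>. integral {0..1} (\<lambda>\<sigma>. A \<tau> \<sigma> * shLeg j \<sigma>) * shLeg i \<tau>) = \<alpha> i j"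
proof -
  define m where "m F = (\<lambda>\<tau>. (if j = 0 then \<alpha> 0 0 + (1 / (2 * sqrt 3)) / 2 * shLeg 1 \<tau> else 0) - (if j = 1 then (1 / (2 * sqrt 3)) / 2 else 0)
     + (\<Sum>(i, k)\<in>F. if k = j then \<alpha> i k * shLeg i \<tau> else 0))" for F
  have If_cont: "continuous_on {0..1} (\<lambda>x. if b then f x else 0)"
    if "continuous_on {0..1} f" for b and f :: "real \<Rightarrow> real"
    using that by (cases b) auto
  have cm: "continuous_on {0..1} (m F)" for F
    unfolding m_def split_def by (intro If_cont continuous_intros)
  have "\<forall>\<^sub>F F in finite_subsets_at_top tail_indices. \<forall>\<tau>\<in>{0..1}.
      integral {0..1} (\<lambda>\<sigma>. partial_kernel \<alpha> F \<tau> \<sigma> * shLeg j \<sigma>) = m F \<tau>"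
    unfolding m_def
    by (intro eventually_finite_subsets_at_top_weakI ballI integral_unique partial_kernel_moment assms)
  from uniform_limit_cong[THEN iffD1, OF this refl uniform_limit_moment]
  have um: "uniform_limit {0..1} m (\<lambda>\<tau>. integral {0..1} (\<lambda>\<sigma>. A \<tau> \<sigma> * shLeg j \<sigma>)) (finite_subsets_at_top tail_indices)" .
  have "compact (shLeg i ` {0..1})"
    by (intro compact_continuous_image continuous_intros) auto
  then have bi: "bounded (shLeg i ` {0..1})" by (rule compact_imp_bounded)
  have "continuous_on {0..1} (\<lambda>\<tau>. integral {0..1} (\<lambda>\<sigma>. A \<tau> \<sigma> * shLeg j \<sigma>))"
    by (rule uniform_limit_theorem[OF _ um]) (use cm in \<open>auto\<close>)
  then have "bounded ((\<lambda>\<tau>. integral {0..1} (\<lambda>\<sigma>. A \<tau> \<sigma> * shLeg j \<sigma>)) ` {0..1})"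
    by (intro compact_imp_bounded compact_continuous_image) auto
  with um bi have ul: "uniform_limit {0..1} (\<lambda>F \<tau>. m F \<tau> * shLeg i \<tau>)
      (\<lambda>\<tau>. integral {0..1} (\<lambda>\<sigma>. A \<tau> \<sigma> * shLeg j \<sigma>) * shLeg i \<tau>) (finite_subsets_at_top tail_indices)"
    by (intro uniform_lim_mult uniform_limit_const)
  have cmi: "continuous_on {0..1} (\<lambda>\<tau>. m F \<tau> * shLeg i \<tau>)" for F
    by (intro continuous_on_mult cm continuous_on_shLeg continuous_on_id)
  obtain J L where J: "\<And>F. ((\<lambda>\<tau>. m F \<tau> * shLeg i \<tau>) has_integral J F) {0..1}"
    and L: "((\<lambda>\<tau>. integral {0..1} (\<lambda>\<sigma>. A \<tau> \<sigma> * shLeg j \<sigma>) * shLeg i \<tau>) has_integral L) {0..1}"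
    and JL: "(J \<longlongrightarrow> L) (finite_subsets_at_top tail_indices)"
    by (rule uniform_limit_integral[OF ul cmi finite_subsets_at_top_neq_bot]) (rule that)
  \<comment> \<open>The integral is constant as soon as \<open>F\<close> contains (i, j). The
    \<open>if\<close> exempts (0, 0), which is outside \<open>tail_indices\<close> and whose
    coefficient is the constant term of the kernel.\<close>
  have "J F = \<alpha> i j" if F: "finite F" "F \<subseteq> tail_indices" "if (i, j) \<in> tail_indices then (i, j) \<in> F else True" for F
  proof -
    define c where "c = (1 / (2 * sqrt 3)) / (2::real)"
    have H: "((\<lambda>\<tau>. (if j = 0 then \<alpha> 0 0 else 0) * (shLeg 0 \<tau> * shLeg i \<tau>) + (if j = 0 then c else 0) * (shLeg 1 \<tau> * shLeg i \<tau>)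
        - (if j = 1 then c else 0) * (shLeg 0 \<tau> * shLeg i \<tau>)
        + (\<Sum>x\<in>F. (if snd x = j then \<alpha> (fst x) (snd x) else 0) * (shLeg (fst x) \<tau> * shLeg i \<tau>)))
      has_integral (if j = 0 then \<alpha> 0 0 else 0) * (if 0 = i then 1 else 0) + (if j = 0 then c else 0) * (if 1 = i then 1 else 0)
        - (if j = 1 then c else 0) * (if 0 = i then 1 else 0)
        + (\<Sum>x\<in>F. (if snd x = j then \<alpha> (fst x) (snd x) else 0) * (if fst x = i then 1 else 0))) {0..1}"
      by (intro has_integral_add has_integral_diff has_integral_mult_right has_integral_sum shLeg_has_integral_low assms(1) F(1))
    have E: "(if j = 0 then \<alpha> 0 0 else 0) * (shLeg 0 \<tau> * shLeg i \<tau>) + (if j = 0 then c else 0) * (shLeg 1 \<tau> * shLeg i \<tau>)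
        - (if j = 1 then c else 0) * (shLeg 0 \<tau> * shLeg i \<tau>)
        + (\<Sum>x\<in>F. (if snd x = j then \<alpha> (fst x) (snd x) else 0) * (shLeg (fst x) \<tau> * shLeg i \<tau>)) = m F \<tau> * shLeg i \<tau>" for \<tau>
    proof -
      have "(\<Sum>x\<in>F. (if snd x = j then \<alpha> (fst x) (snd x) else 0) * (shLeg (fst x) \<tau> * shLeg i \<tau>))
         = (\<Sum>(i, k)\<in>F. if k = j then \<alpha> i k * shLeg i \<tau> else 0) * shLeg i \<tau>"
        unfolding sum_distrib_right split_def by (intro sum.cong) auto
      then show ?thesis
        unfolding m_def c_def shLeg_0 by (simp add: algebra_simps)
    qed
    have "J F = (if j = 0 then \<alpha> 0 0 else 0) * (if 0 = i then 1 else 0) + (if j = 0 then c else 0) * (if 1 = i then 1 else 0)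
        - (if j = 1 then c else 0) * (if 0 = i then 1 else 0)
        + (\<Sum>x\<in>F. (if snd x = j then \<alpha> (fst x) (snd x) else 0) * (if fst x = i then 1 else 0))"
      by (rule has_integral_unique[OF J H[unfolded E]])
    also have "(\<Sum>x\<in>F. (if snd x = j then \<alpha> (fst x) (snd x) else 0) * (if fst x = i then 1 else 0))
       = (\<Sum>x\<in>F. if x = (i, j) then \<alpha> i j else 0)"
      by (intro sum.cong) auto
    also have "\<dots> = (if (i, j) \<in> tail_indices then \<alpha> i j else 0)"
      using F by (auto simp: sum.delta split: if_splits)
    finally have JF: "J F = (if j = 0 then \<alpha> 0 0 else 0) * (if 0 = i then 1 else 0) + (if j = 0 then c else 0) * (if 1 = i then 1 else 0)
        - (if j = 1 then c else 0) * (if 0 = i then 1 else 0) + (if (i, j) \<in> tail_indices then \<alpha> i j else 0)" .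
    show ?thesis
    proof (cases "(i, j) \<in> tail_indices")
      case False
      then have "\<not> 1 < i + j" using assms(3) by (simp add: tail_indices_def)
      then have "i + j = 0" using assms(3) by presburger
      with JF False show ?thesis by simp
    next
      case True
      then have "\<not> (i = 0 \<and> j = 0)" "\<not> (i = 1 \<and> j = 0)" "\<not> (i = 0 \<and> j = 1)" by (auto simp: tail_indices_def)
      with JF True show ?thesis by auto
    qed
  qed
  moreover have "\<forall>\<^sub>F F in finite_subsets_at_top tail_indices. finite F \<and> F \<subseteq> tail_indices \<and> (if (i, j) \<in> tail_indices then (i, j) \<in> F else True)"
    unfolding eventually_finite_subsets_at_top
    by (rule exI[of _ "if (i, j) \<in> tail_indices then {(i, j)} else {}"]) auto
  ultimately have "\<forall>\<^sub>F F in finite_subsets_at_top tail_indices. J F = \<alpha> i j"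
    by (elim eventually_mono) auto
  then have "(J \<longlongrightarrow> \<alpha> i j) (finite_subsets_at_top tail_indices)"
    by (rule tendsto_eventually)
  then have "L = \<alpha> i j" using tendsto_unique[OF _ JL] by simp
  then show ?thesis using L by (simp add: integral_unique)
qed

text \<open>The column of coefficients \<alpha>(0, 0) = 1/6, \<xi>_1 / 2, sqrt 5 / 60, followed by
  zeros, is the Legendre expansion of \<tau>^2 / 2.\<close>

lemma A_row_integral:
  assumes "\<alpha> 0 0 = 1/6" "\<alpha> 2 0 = sqrt 5 / 60" "\<And>i. even i \<Longrightarrow> i > 2 \<Longrightarrow> \<alpha> i 0 = 0" "\<tau> \<in> {0..1}"
  shows "integral {0..1} (A \<tau>) = \<tau>^2 / 2"
proof (rule tendsto_unique)
  have "((\<lambda>F. integral {0..1} (\<lambda>\<sigma>. partial_kernel \<alpha> F \<tau> \<sigma> * shLeg 0 \<sigma>)) \<longlongrightarrow>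
     integral {0..1} (\<lambda>\<sigma>. A \<tau> \<sigma> * shLeg 0 \<sigma>)) (finite_subsets_at_top tail_indices)"
    by (rule tendsto_uniform_limitI[OF uniform_limit_moment assms(4)])
  then show "((\<lambda>F. integral {0..1} (\<lambda>\<sigma>. partial_kernel \<alpha> F \<tau> \<sigma> * shLeg 0 \<sigma>)) \<longlongrightarrow> integral {0..1} (A \<tau>)) (finite_subsets_at_top tail_indices)"
    by (simp add: shLeg_0)
  have "integral {0..1} (\<lambda>\<sigma>. partial_kernel \<alpha> F \<tau> \<sigma> * shLeg 0 \<sigma>) = \<tau>^2 / 2"
    if F: "finite F" "F \<subseteq> tail_indices" "(2, 0) \<in> F" for F
  proof -
    \<comment> \<open>In column 0 parity admits only even i \<ge> 2, and the hypothesis removes all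
      of them except i = 2.\<close>
    have "(\<Sum>(i, k)\<in>F. if k = 0 then \<alpha> i k * shLeg i \<tau> else 0) = (\<Sum>x\<in>F. if x = (2, 0) then \<alpha> 2 0 * shLeg 2 \<tau> else 0)"
    proof (intro sum.cong refl, clarify)
      fix i k assume "(i, k) \<in> F"
      then have "even (i + k)" "i + k > 1" using F by (auto simp: tail_indices_def)
      then have "k = 0 \<Longrightarrow> i = 2 \<or> i > 2 \<and> even i" by (auto elim: evenE)
      then show "(if k = 0 then \<alpha> i k * shLeg i \<tau> else 0) = (if (i, k) = (2, 0) then \<alpha> 2 0 * shLeg 2 \<tau> else 0)"
        using assms(3)[of i] by auto
    qed
    also have "\<dots> = \<alpha> 2 0 * shLeg 2 \<tau>"
      using F by (simp add: sum.delta)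
    finally have s: "(\<Sum>(i, k)\<in>F. if k = 0 then \<alpha> i k * shLeg i \<tau> else 0) = \<alpha> 2 0 * shLeg 2 \<tau>" .
    have "\<alpha> 2 0 * shLeg 2 \<tau> = (6 * \<tau>^2 - 6 * \<tau> + 1) / 12" "(1 / (2 * sqrt 3)) / 2 * shLeg 1 \<tau> = \<tau> / 2 - 1 / 4"
      by (simp_all add: shLeg_1 shLeg_2 assms(2) flip: mult.assoc)
    then show ?thesis
      using integral_unique[OF partial_kernel_moment[OF _ F(1), of 0 \<tau>]] s assms(1) by simp
  qed
  moreover have "\<forall>\<^sub>F F in finite_subsets_at_top tail_indices. finite F \<and> F \<subseteq> tail_indices \<and> (2, 0) \<in> F"
    unfolding eventually_finite_subsets_at_top
    by (rule exI[of _ "{(2, 0)}"]) (auto simp: tail_indices_def)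
  ultimately have "\<forall>\<^sub>F F in finite_subsets_at_top tail_indices. integral {0..1} (\<lambda>\<sigma>. partial_kernel \<alpha> F \<tau> \<sigma> * shLeg 0 \<sigma>) = \<tau>^2 / 2"
    by (elim eventually_mono) auto
  then show "((\<lambda>F. integral {0..1} (\<lambda>\<sigma>. partial_kernel \<alpha> F \<tau> \<sigma> * shLeg 0 \<sigma>)) \<longlongrightarrow> \<tau>^2 / 2) (finite_subsets_at_top tail_indices)"
    by (rule tendsto_eventually)
qed simp

end

section \<open>Smooth functions and Taylor expansion along a solution\<close>

lemma smooth_fun_differentiable: "smooth_fun g \<Longrightarrow> g differentiable (at x)"
  by (subst (asm) smooth_fun.simps) simp

lemma smooth_fun_frechet: "smooth_fun g \<Longrightarrow> smooth_fun (\<lambda>x. frechet_derivative g (at x) v)"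
  by (subst (asm) smooth_fun.simps) simp

lemma smooth_fun_has_derivative:
  "smooth_fun g \<Longrightarrow> (g has_derivative frechet_derivative g (at x)) (at x)"
  using smooth_fun_differentiable frechet_derivative_works by blast

lemma smooth_fun_continuous_on: "smooth_fun g \<Longrightarrow> continuous_on S g"
  by (intro continuous_at_imp_continuous_on ballI differentiable_imp_continuous_within smooth_fun_differentiable)

text \<open>\<open>smooth_fun\<close> provides derivatives in fixed directions, so the derivative in
  the space variable is handled through the finitely many basis directions.\<close>

definition space_deriv :: "(real \<times> 'a::euclidean_space \<Rightarrow> 'b::real_normed_vector) \<Rightarrow> 'a \<Rightarrow> real \<times> 'a \<Rightarrow> 'b" where
  "space_deriv F e z = frechet_derivative F (at z) (0, e)"

lemma smooth_space_deriv: "smooth_fun F \<Longrightarrow> smooth_fun (space_deriv F e)"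
  unfolding space_deriv_def[abs_def] by (rule smooth_fun_frechet)

lemma frechet_Basis_sum:
  assumes "smooth_fun F"
  shows "frechet_derivative F (at z) (a, e)
    = a *\<^sub>R frechet_derivative F (at z) (1, 0) + (\<Sum>b\<in>Basis. (e \<bullet> b) *\<^sub>R space_deriv F b z)"
proof -
  have lin: "linear (frechet_derivative F (at z))"
    using smooth_fun_differentiable[OF assms] by (rule linear_frechet_derivative)
  have "(a, e) = a *\<^sub>R (1, 0) + (\<Sum>b\<in>Basis. (e \<bullet> b) *\<^sub>R (0, b))"
    by (rule prod_eqI) (simp_all add: fst_sum snd_sum euclidean_representation)
  then have "frechet_derivative F (at z) (a, e)
     = frechet_derivative F (at z) (a *\<^sub>R (1, 0) + (\<Sum>b\<in>Basis. (e \<bullet> b) *\<^sub>R (0, b)))" by simp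
  also have "\<dots> = a *\<^sub>R frechet_derivative F (at z) (1, 0) + (\<Sum>b\<in>Basis. (e \<bullet> b) *\<^sub>R space_deriv F b z)"
    by (simp only: linear_add[OF lin] linear_sum[OF lin] linear_cmul[OF lin] space_deriv_def)
  finally show ?thesis .
qed

lemma space_has_derivative:
  assumes "smooth_fun F"
  shows "((\<lambda>x. F (t, x)) has_derivative (\<lambda>e. \<Sum>b\<in>Basis. (e \<bullet> b) *\<^sub>R space_deriv F b (t, x))) (at x within S)"
proof -
  have "((\<lambda>x. F (t, x)) has_derivative (\<lambda>e. frechet_derivative F (at (t, x)) (0, e))) (at x within S)"
    by (rule has_derivative_compose[OF _ smooth_fun_has_derivative[OF assms]])
       (intro derivative_intros)
  moreover have "frechet_derivative F (at (t, x)) (0, e) = (\<Sum>b\<in>Basis. (e \<bullet> b) *\<^sub>R space_deriv F b (t, x))" for e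
    using frechet_Basis_sum[OF assms, of "(t, x)" 0 e] by simp
  ultimately show ?thesis by simp
qed

lemma norm_Basis_sum_le:
  fixes e :: "'a::euclidean_space"
  assumes "\<And>b. b \<in> Basis \<Longrightarrow> norm (w b) \<le> M b"
  shows "norm (\<Sum>b\<in>Basis. (e \<bullet> b) *\<^sub>R w b) \<le> (\<Sum>b\<in>Basis. M b) * norm e"
proof -
  have "norm (\<Sum>b\<in>Basis. (e \<bullet> b) *\<^sub>R w b) \<le> (\<Sum>b\<in>Basis. norm e * M b)"
    by (intro sum_norm_le) (auto intro!: mult_mono assms Basis_le_norm)
  then show ?thesis by (simp add: sum_distrib_left mult.commute)
qed

lemma compact_bound:
  assumes "compact S" "continuous_on S g"
  obtains M where "M \<ge> 0" "\<And>z. z \<in> S \<Longrightarrow> norm (g z) \<le> M"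
proof -
  have "bounded (g ` S)"
    using assms by (intro compact_imp_bounded compact_continuous_image)
  then show ?thesis using that by (auto simp: bounded_pos intro: less_imp_le)
qed

text \<open>Mean value inequality in \<open>x\<close> at frozen \<open>t\<close>: convexity is
  required of the space domain, while compactness of the product bounds the partial derivatives
  uniformly.\<close>

lemma smooth_lipschitz:
  fixes F :: "real \<times> 'a::euclidean_space \<Rightarrow> 'b::real_normed_vector"
  assumes F: "smooth_fun F" and "compact T" "compact S" "convex S"
  shows "\<exists>L\<ge>0. \<forall>t\<in>T. \<forall>x\<in>S. \<forall>y\<in>S. norm (F (t, x) - F (t, y)) \<le> L * norm (x - y)"
proof -
  have "\<exists>M\<ge>0. \<forall>z\<in>T \<times> S. norm (space_deriv F b z) \<le> M" for b
    using compact_bound[OF compact_Times[OF assms(2,3)] smooth_fun_continuous_on[OF smooth_space_deriv[OF F]]]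
    by metis
  then obtain M where M: "\<And>b. M b \<ge> 0" "\<And>b z. z \<in> T \<times> S \<Longrightarrow> norm (space_deriv F b z) \<le> M b"
    by metis
  have "norm (F (t, x) - F (t, y)) \<le> (\<Sum>b\<in>Basis. M b) * norm (x - y)" if "t \<in> T" "x \<in> S" "y \<in> S" for t x y
  proof (rule differentiable_bound[OF assms(4) space_has_derivative[OF F] _ that(2,3)])
    fix z assume "z \<in> S"
    then show "onorm (\<lambda>e. \<Sum>b\<in>Basis. (e \<bullet> b) *\<^sub>R space_deriv F b (t, z)) \<le> (\<Sum>b\<in>Basis. M b)"
      using that M by (intro onorm_bound sum_nonneg norm_Basis_sum_le) auto
  qed
  then show ?thesis using M(1) by (intro exI[of _ "\<Sum>b\<in>Basis. M b"]) (auto intro: sum_nonneg)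
qed

text \<open>Subtracting the linearization at \<open>y\<close> leaves a function whose derivative on
  the segment is a difference of partial derivatives, hence at most a multiple of norm (x - y). The
  mean value inequality supplies the second factor.\<close>

lemma smooth_quadratic_remainder:
  fixes F :: "real \<times> 'a::euclidean_space \<Rightarrow> 'b::real_normed_vector"
  assumes F: "smooth_fun F" and "compact T" "compact S" "convex S"
  shows "\<exists>L\<ge>0. \<forall>t\<in>T. \<forall>x\<in>S. \<forall>y\<in>S.
    norm (F (t, x) - F (t, y) - (\<Sum>b\<in>Basis. ((x - y) \<bullet> b) *\<^sub>R space_deriv F b (t, y))) \<le> L * norm (x - y) ^ 2"
proof -
  obtain M where M: "\<And>b. M b \<ge> 0"
    "\<And>b t x y. \<lbrakk>t \<in> T; x \<in> S; y \<in> S\<rbrakk> \<Longrightarrow> norm (space_deriv F b (t, x) - space_deriv F b (t, y)) \<le> M b * norm (x - y)"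
    using smooth_lipschitz[OF smooth_space_deriv[OF F] assms(2-4)] by metis
  let ?L = "\<Sum>b\<in>Basis. M b"
  have "norm (F (t, x) - F (t, y) - (\<Sum>b\<in>Basis. ((x - y) \<bullet> b) *\<^sub>R space_deriv F b (t, y))) \<le> ?L * norm (x - y) ^ 2"
    if txy: "t \<in> T" "x \<in> S" "y \<in> S" for t x y
  proof -
    \<comment> \<open>The coefficients are frozen at \<open>y\<close>, so the subtracted part is
      linear in \<open>z\<close> and \<phi> x - \<phi> y is the remainder itself.\<close>
    define \<phi> where "\<phi> z = F (t, z) - (\<Sum>b\<in>Basis. (z \<bullet> b) *\<^sub>R space_deriv F b (t, y))" for z
    have "norm (\<phi> x - \<phi> y) \<le> (?L * norm (x - y)) * norm (x - y)"
    proof (rule differentiable_bound)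
      show "convex (closed_segment y x)" "x \<in> closed_segment y x" "y \<in> closed_segment y x" by auto
      fix z assume z: "z \<in> closed_segment y x"
      then have zS: "z \<in> S" using txy(2,3) assms(4) closed_segment_subset by blast
      show "(\<phi> has_derivative (\<lambda>e. \<Sum>b\<in>Basis. (e \<bullet> b) *\<^sub>R (space_deriv F b (t, z) - space_deriv F b (t, y)))) (at z within closed_segment y x)"
        unfolding \<phi>_def scaleR_diff_right sum_subtractf
        by (intro has_derivative_diff space_has_derivative F has_derivative_sum
          has_derivative_scaleR_left has_derivative_inner_left has_derivative_ident)
      have "norm (z - y) \<le> norm (x - y)" using segment_bound(1)[OF z] .
      then have "norm (space_deriv F b (t, z) - space_deriv F b (t, y)) \<le> M b * norm (x - y)" for b
        using M(2)[OF txy(1) zS txy(3), of b] M(1)[of b] by (meson mult_left_mono order_trans)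
      then show "onorm (\<lambda>e. \<Sum>b\<in>Basis. (e \<bullet> b) *\<^sub>R (space_deriv F b (t, z) - space_deriv F b (t, y))) \<le> ?L * norm (x - y)"
        unfolding sum_distrib_right using M(1)
        by (intro onorm_bound sum_nonneg norm_Basis_sum_le) auto
    qed
    moreover have "\<phi> x - \<phi> y = F (t, x) - F (t, y) - (\<Sum>b\<in>Basis. ((x - y) \<bullet> b) *\<^sub>R space_deriv F b (t, y))"
      by (simp add: \<phi>_def inner_diff_left scaleR_diff_left sum_subtractf)
    ultimately show ?thesis by (simp add: power2_eq_square mult.assoc)
  qed
  then show ?thesis using M(1) by (intro exI[of _ ?L]) (auto intro: sum_nonneg)
qed

section \<open>Regularity and Taylor expansion along a solution on a ball\<close>

lemma has_vector_derivative_imp_continuous_on: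
  assumes "\<forall>t\<in>S. (\<phi> has_vector_derivative \<phi>' t) (at t)"
  shows "continuous_on S \<phi>"
  by (intro continuous_at_imp_continuous_on ballI)
     (rule has_vector_derivative_continuous[OF bspec[OF assms]])

text \<open>A solution is given on a ball only, so its regularity is a local notion, unlike
  \<open>smooth_fun\<close>. Derivatives are two-sided at the points of \<open>S\<close>, which is
  an open ball in the application.\<close>

primrec Ck :: "nat \<Rightarrow> real set \<Rightarrow> (real \<Rightarrow> 'b::real_normed_vector) \<Rightarrow> bool" where
  "Ck 0 S \<phi> = continuous_on S \<phi>"
| "Ck (Suc k) S \<phi> = (\<exists>\<phi>'. (\<forall>t\<in>S. (\<phi> has_vector_derivative \<phi>' t) (at t)) \<and> Ck k S \<phi>')"

lemma Ck_SucI: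
  "(\<And>t. t \<in> S \<Longrightarrow> (\<phi> has_vector_derivative \<phi>' t) (at t)) \<Longrightarrow> Ck k S \<phi>' \<Longrightarrow> Ck (Suc k) S \<phi>"
  by auto

lemma Ck_Suc_imp: "Ck (Suc k) S \<phi> \<Longrightarrow> Ck k S \<phi>"
proof (induction k arbitrary: \<phi>)
  case 0
  then obtain \<phi>' where "\<forall>t\<in>S. (\<phi> has_vector_derivative \<phi>' t) (at t)"
    unfolding Ck.simps by blast
  then show ?case
    unfolding Ck.simps by (rule has_vector_derivative_imp_continuous_on)
next
  case (Suc k)
  from Suc.prems obtain \<phi>' where "\<forall>t\<in>S. (\<phi> has_vector_derivative \<phi>' t) (at t)" "Ck (Suc k) S \<phi>'"
    unfolding Ck.simps(2)[of "Suc k"] by blast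
  with Suc.IH show ?case unfolding Ck.simps(2)[of k S \<phi>] by blast
qed

lemma Ck_zero: "Ck k S (\<lambda>t. 0)"
  by (induction k) (auto intro!: exI[of _ "\<lambda>t. 0"])

lemma Ck_add: "Ck k S \<phi> \<Longrightarrow> Ck k S \<psi> \<Longrightarrow> Ck k S (\<lambda>t. \<phi> t + \<psi> t)"
proof (induction k arbitrary: \<phi> \<psi>)
  case (Suc k)
  then obtain \<phi>' \<psi>' where "\<forall>t\<in>S. (\<phi> has_vector_derivative \<phi>' t) (at t)" "Ck k S \<phi>'"
    "\<forall>t\<in>S. (\<psi> has_vector_derivative \<psi>' t) (at t)" "Ck k S \<psi>'" by auto
  then show ?case using Suc.IH
    by (auto intro!: exI[of _ "\<lambda>t. \<phi>' t + \<psi>' t"] has_vector_derivative_add)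
qed (auto intro: continuous_intros)

lemma Ck_sum: "finite B \<Longrightarrow> (\<And>b. b \<in> B \<Longrightarrow> Ck k S (\<phi> b)) \<Longrightarrow> Ck k S (\<lambda>t. \<Sum>b\<in>B. \<phi> b t)"
  by (induction B rule: finite_induct) (auto intro: Ck_add Ck_zero)

lemma Ck_inner: "Ck k S \<phi> \<Longrightarrow> Ck k S (\<lambda>t. \<phi> t \<bullet> b)"
proof (induction k arbitrary: \<phi>)
  case (Suc k)
  then obtain \<phi>' where "\<forall>t\<in>S. (\<phi> has_vector_derivative \<phi>' t) (at t)" "Ck k S \<phi>'" by auto
  then show ?case using Suc.IH
    by (auto intro!: exI[of _ "\<lambda>t. \<phi>' t \<bullet> b"] bounded_linear.has_vector_derivative[OF bounded_linear_inner_left])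
qed (auto intro: continuous_intros)

lemma Ck_scaleR: "Ck k S a \<Longrightarrow> Ck k S \<phi> \<Longrightarrow> Ck k S (\<lambda>t. a t *\<^sub>R \<phi> t)"
proof (induction k arbitrary: a \<phi>)
  case (Suc k)
  then obtain a' \<phi>' where *: "\<forall>t\<in>S. (a has_vector_derivative a' t) (at t)" "Ck k S a'"
    "\<forall>t\<in>S. (\<phi> has_vector_derivative \<phi>' t) (at t)" "Ck k S \<phi>'" by auto
  have "\<forall>t\<in>S. ((\<lambda>t. a t *\<^sub>R \<phi> t) has_vector_derivative (a t *\<^sub>R \<phi>' t + a' t *\<^sub>R \<phi> t)) (at t)"
    using * by (auto intro!: has_vector_derivative_scaleR simp: has_real_derivative_iff_has_vector_derivative)
  moreover have "Ck k S (\<lambda>t. a t *\<^sub>R \<phi>' t + a' t *\<^sub>R \<phi> t)"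
    by (intro Ck_add Suc.IH * Ck_Suc_imp[OF Suc.prems(1)] Ck_Suc_imp[OF Suc.prems(2)])
  ultimately show ?case by auto
qed (auto intro: continuous_intros)

text \<open>Bootstrapping: the derivative of \<open>F (t, q t)\<close> is built from
  \<open>v\<close> and derivatives of \<open>F\<close> along \<open>q\<close>, and the derivative of
  \<open>v\<close> is \<open>f (t, q t)\<close>. Quantifying over all \<open>F\<close> and carrying
  \<open>v\<close> along makes the induction close.\<close>

lemma Ck_along_solution:
  fixes f :: "real \<times> 'a::euclidean_space \<Rightarrow> 'a"
  assumes f: "smooth_fun f"
    and q: "\<And>t. t \<in> S \<Longrightarrow> (q has_vector_derivative v t) (at t)"
    and v: "\<And>t. t \<in> S \<Longrightarrow> (v has_vector_derivative f (t, q t)) (at t)"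
  shows "(\<forall>F :: real \<times> 'a \<Rightarrow> 'a. smooth_fun F \<longrightarrow> Ck k S (\<lambda>t. F (t, q t))) \<and> Ck k S v"
proof (induction k)
  case 0
  have "continuous_on S q"
    by (rule has_vector_derivative_imp_continuous_on[of S q v]) (use q in blast)
  moreover have "continuous_on S v"
    by (rule has_vector_derivative_imp_continuous_on[of S v "\<lambda>t. f (t, q t)"]) (use v in blast)
  moreover from calculation have "continuous_on S (\<lambda>t. F (t, q t))" if "smooth_fun F" for F :: "real \<times> 'a \<Rightarrow> 'a"
    by (intro continuous_on_compose2[OF smooth_fun_continuous_on[OF that, of UNIV]] continuous_intros) auto
  ultimately show ?case by auto
next
  case (Suc k)
  have "Ck (Suc k) S v" 
    by (rule Ck_SucI[OF v]) (use Suc f in auto)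
  moreover have "Ck (Suc k) S (\<lambda>t. F (t, q t))" if F: "smooth_fun F" for F :: "real \<times> 'a \<Rightarrow> 'a"
  proof -
    have "((\<lambda>t. F (t, q t)) has_vector_derivative
        frechet_derivative F (at (t, q t)) (1, 0) + (\<Sum>b\<in>Basis. (v t \<bullet> b) *\<^sub>R space_deriv F b (t, q t))) (at t)"
      if "t \<in> S" for t
    proof -
      have "((\<lambda>t. (t, q t)) has_vector_derivative (1, v t)) (at t)"
        using q[OF that] by (intro has_vector_derivative_Pair) (auto intro: has_vector_derivative_id)
      then have "((\<lambda>t. F (t, q t)) has_derivative (\<lambda>x. frechet_derivative F (at (t, q t)) (x *\<^sub>R (1, v t)))) (at t)"
        unfolding has_vector_derivative_def
        by (rule has_derivative_compose[OF _ smooth_fun_has_derivative[OF F]])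
      moreover have "frechet_derivative F (at (t, q t)) (x *\<^sub>R (1, v t)) = x *\<^sub>R frechet_derivative F (at (t, q t)) (1, v t)" for x
        using linear_frechet_derivative[OF smooth_fun_differentiable[OF F]] by (simp only: linear_cmul)
      ultimately show ?thesis
        unfolding has_vector_derivative_def by (simp only: frechet_Basis_sum[OF F, of _ 1 "v t"] scaleR_one)
    qed
    moreover have "Ck k S (\<lambda>t. frechet_derivative F (at (t, q t)) (1, 0) + (\<Sum>b\<in>Basis. (v t \<bullet> b) *\<^sub>R space_deriv F b (t, q t)))"
      using Suc smooth_fun_frechet[OF F] smooth_space_deriv[OF F]
      by (intro Ck_add Ck_sum Ck_scaleR Ck_inner) auto
    ultimately show ?thesis by (rule Ck_SucI)
  qed
  ultimately show ?case by blast
qed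

text \<open>The expansion of the derivative is integrated term by term. The coefficients are left
  existential because the cancellations come from the moments of the kernel.\<close>

lemma Ck_taylor:
  fixes \<phi> :: "real \<Rightarrow> 'b::real_normed_vector"
  assumes "Ck k (ball t0 \<delta>) \<phi>" "h0 < \<delta>"
  shows "\<exists>c K. \<forall>s. \<bar>s\<bar> \<le> h0 \<longrightarrow> norm (\<phi> (t0 + s) - (\<Sum>i<k. s ^ i *\<^sub>R c i)) \<le> K * \<bar>s\<bar> ^ k"
  using assms(1)
proof (induction k arbitrary: \<phi>)
  case 0
  have "continuous_on (cball t0 h0) \<phi>"
    by (rule continuous_on_subset[OF 0[simplified]]) (use assms(2) in auto)
  then obtain M where "\<And>z. z \<in> cball t0 h0 \<Longrightarrow> norm (\<phi> z) \<le> M"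
    using compact_bound[OF compact_cball] by metis
  then show ?case by (auto intro!: exI[of _ M] simp: dist_norm)
next
  case (Suc k)
  then obtain \<phi>' where d: "\<And>t. t \<in> ball t0 \<delta> \<Longrightarrow> (\<phi> has_vector_derivative \<phi>' t) (at t)" and "Ck k (ball t0 \<delta>) \<phi>'"
    unfolding Ck.simps by blast
  with Suc.IH obtain c K where K: "\<And>s. \<bar>s\<bar> \<le> h0 \<Longrightarrow> norm (\<phi>' (t0 + s) - (\<Sum>i<k. s ^ i *\<^sub>R c i)) \<le> K * \<bar>s\<bar> ^ k"
    by blast
  \<comment> \<open>The coefficients of the antiderivative of the Taylor polynomial of \<phi>', with
    constant term \<phi> t0.\<close>
  define c' where "c' i = (case i of 0 \<Rightarrow> \<phi> t0 | Suc j \<Rightarrow> c j /\<^sub>R real (Suc j))" for i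
  have c': "(\<Sum>i<Suc k. s ^ i *\<^sub>R c' i) = \<phi> t0 + (\<Sum>i<k. s ^ Suc i *\<^sub>R (c i /\<^sub>R real (Suc i)))" for s
    unfolding sum.lessThan_Suc_shift by (simp add: c'_def)
  \<comment> \<open>The remainder vanishes at 0 and its derivative is the remainder of \<phi>', so
    the mean value inequality gains one power of s.\<close>
  define \<psi> where "\<psi> s = \<phi> (t0 + s) - (\<phi> t0 + (\<Sum>i<k. s ^ Suc i *\<^sub>R (c i /\<^sub>R real (Suc i))))" for s
  have "norm (\<psi> s) \<le> \<bar>K\<bar> * \<bar>s\<bar> ^ Suc k" if s: "\<bar>s\<bar> \<le> h0" for s
  proof -
    have "norm (\<psi> s - \<psi> 0) \<le> (\<bar>K\<bar> * \<bar>s\<bar> ^ k) * norm (s - 0)"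
    proof (rule differentiable_bound)
      show "convex (closed_segment 0 s)" "s \<in> closed_segment 0 s" "0 \<in> closed_segment 0 s" by auto
      fix u assume "u \<in> closed_segment 0 s"
      then have us: "\<bar>u\<bar> \<le> \<bar>s\<bar>" using segment_bound(1)[of u 0 s] by simp
      have 1: "((\<lambda>s. \<phi> (t0 + s)) has_vector_derivative \<phi>' (t0 + u)) (at u)"
      proof -
        have "t0 + u \<in> ball t0 \<delta>" using us s assms(2) by (simp add: dist_norm)
        from vector_diff_chain_at[of "\<lambda>s. t0 + s" 1 u \<phi>, OF _ d[OF this]] show ?thesis
          by (simp add: o_def has_vector_derivative_def bounded_linear_imp_has_derivative has_derivative_add_const add.commute[of t0])
      qed
      have 2: "((\<lambda>s. s ^ Suc i *\<^sub>R (c i /\<^sub>R real (Suc i))) has_vector_derivative u ^ i *\<^sub>R c i) (at u)" for i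
      proof -
        have "((\<lambda>s. s ^ Suc i) has_real_derivative real (Suc i) * u ^ i) (at u)"
          by (auto intro!: derivative_eq_intros simp del: power_Suc of_nat_Suc)
        then have "((\<lambda>s. s ^ Suc i *\<^sub>R (c i /\<^sub>R real (Suc i))) has_vector_derivative
            u ^ Suc i *\<^sub>R 0 + (real (Suc i) * u ^ i) *\<^sub>R (c i /\<^sub>R real (Suc i))) (at u)"
          by (intro has_vector_derivative_scaleR has_vector_derivative_const)
        moreover have "(real (Suc i) * u ^ i) *\<^sub>R (c i /\<^sub>R real (Suc i)) = u ^ i *\<^sub>R c i"
          by (simp add: field_simps del: of_nat_Suc)
        ultimately show ?thesis by (simp only: scaleR_zero_right add_0)
      qed
      have "(\<psi> has_vector_derivative \<phi>' (t0 + u) - (0 + (\<Sum>i<k. u ^ i *\<^sub>R c i))) (at u)"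
        unfolding \<psi>_def
        by (intro has_vector_derivative_diff has_vector_derivative_add has_vector_derivative_const has_vector_derivative_sum 1 2)
      then show "(\<psi> has_derivative (\<lambda>x. x *\<^sub>R (\<phi>' (t0 + u) - (\<Sum>i<k. u ^ i *\<^sub>R c i)))) (at u within closed_segment 0 s)"
        by (auto simp: has_vector_derivative_def intro: has_derivative_at_withinI)
      have "norm (\<phi>' (t0 + u) - (\<Sum>i<k. u ^ i *\<^sub>R c i)) \<le> K * \<bar>u\<bar> ^ k"
        using us s by (intro K) auto
      also have "\<dots> \<le> \<bar>K\<bar> * \<bar>s\<bar> ^ k"
        using us by (intro mult_mono power_mono) auto
      finally show "onorm (\<lambda>x. x *\<^sub>R (\<phi>' (t0 + u) - (\<Sum>i<k. u ^ i *\<^sub>R c i))) \<le> \<bar>K\<bar> * \<bar>s\<bar> ^ k"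
        by (intro onorm_bound) (auto simp: mult.commute intro: mult_left_mono)
    qed
    then show ?thesis by (simp add: \<psi>_def mult.assoc mult.commute[of "\<bar>s\<bar>"])
  qed
  then show ?case unfolding \<psi>_def c'[symmetric] by blast
qed

section \<open>Moments of the defect of a symmetric kernel\<close>

lemma has_integral_reflect_unit:
  fixes f :: "real \<Rightarrow> 'b::real_normed_vector"
  assumes "(f has_integral i) {0..1}"
  shows "((\<lambda>x. f (1 - x)) has_integral i) {0..1}"
proof -
  have "(\<lambda>x::real. 1 - x) ` {0..1} = {0..1}"
    by (auto simp: image_iff intro!: bexI[of _ "1 - _"])
  with has_integral_affinity[of f i 0 1 "-1" 1] assms show ?thesis by simp
qed

lemma integral_reflect_unit:
  fixes f :: "real \<Rightarrow> 'b::banach"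
  assumes "continuous_on {0..1} f"
  shows "integral {0..1} (\<lambda>x. f (1 - x)) = integral {0..1} f"
  using has_integral_reflect_unit[OF integrable_integral[OF integrable_continuous_real[OF assms]]]
  by (rule integral_unique)

text \<open>Taylor's formula with integral remainder. Truncating the kernel at \<sigma> = \<tau>
  extends the integral to the whole unit interval, where it is comparable with the integral of the
  method.\<close>

lemma taylor_kernel_integral:
  fixes y :: "real \<Rightarrow> 'b::banach"
  assumes "\<tau> \<in> {0..1}"
    and y: "\<And>s. s \<in> {0..1} \<Longrightarrow> (y has_vector_derivative y1 s) (at s)"
    and y1: "\<And>s. s \<in> {0..1} \<Longrightarrow> (y1 has_vector_derivative y2 s) (at s)"
  shows "((\<lambda>\<sigma>. max 0 (\<tau> - \<sigma>) *\<^sub>R y2 \<sigma>) has_integral (y \<tau> - y 0 - \<tau> *\<^sub>R y1 0)) {0..1}"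
proof -
  \<comment> \<open>Integration by parts: (\<tau> - s) y1(s) + y(s) is an antiderivative of (\<tau>
    - s) y2(s).\<close>
  have "((\<lambda>\<sigma>. (\<tau> - \<sigma>) *\<^sub>R y2 \<sigma>) has_integral ((\<tau> - \<tau>) *\<^sub>R y1 \<tau> + y \<tau>) - ((\<tau> - 0) *\<^sub>R y1 0 + y 0)) {0..\<tau>}"
  proof (rule fundamental_theorem_of_calculus)
    fix s assume "s \<in> {0..\<tau>}"
    then have s: "s \<in> {0..1}" using assms(1) by auto
    have "((\<lambda>s. \<tau> - s) has_real_derivative -1) (at s)"
      by (auto intro!: derivative_eq_intros)
    then have "((\<lambda>s. (\<tau> - s) *\<^sub>R y1 s + y s) has_vector_derivative ((\<tau> - s) *\<^sub>R y2 s + (-1) *\<^sub>R y1 s) + y1 s) (at s)"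
      by (intro has_vector_derivative_add has_vector_derivative_scaleR y y1 s)
    then show "((\<lambda>s. (\<tau> - s) *\<^sub>R y1 s + y s) has_vector_derivative (\<tau> - s) *\<^sub>R y2 s) (at s within {0..\<tau>})"
      by (auto intro: has_vector_derivative_at_within)
  qed (use assms(1) in auto)
  then have "((\<lambda>\<sigma>. (\<tau> - \<sigma>) *\<^sub>R y2 \<sigma>) has_integral (y \<tau> - y 0 - \<tau> *\<^sub>R y1 0)) {0..\<tau>}"
    by (simp add: algebra_simps)
  then have "((\<lambda>\<sigma>. max 0 (\<tau> - \<sigma>) *\<^sub>R y2 \<sigma>) has_integral (y \<tau> - y 0 - \<tau> *\<^sub>R y1 0)) {0..\<tau>}"
    by (rule has_integral_eq[rotated]) auto
  moreover have "((\<lambda>\<sigma>. max 0 (\<tau> - \<sigma>) *\<^sub>R y2 \<sigma>) has_integral 0) {\<tau>..1}"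
    by (rule has_integral_is_0) auto
  ultimately show ?thesis
    using has_integral_combine[of 0 \<tau> 1] assms(1) by fastforce
qed

text \<open>Apply Taylor's formula to s^(k+2) / ((k+1)(k+2)), which vanishes at 0 together with its
  first derivative.\<close>

lemma taylor_kernel_power:
  assumes "\<tau> \<in> {0..1}"
  shows "((\<lambda>\<sigma>. max 0 (\<tau> - \<sigma>) * \<sigma> ^ k) has_integral \<tau> ^ (k + 2) / (real (k + 1) * real (k + 2))) {0..1}"
proof -
  have 1: "((\<lambda>s. s ^ (k + 2) / (real (k + 1) * real (k + 2))) has_vector_derivative s ^ (k + 1) / real (k + 1)) (at s)" for s :: real
    unfolding has_real_derivative_iff_has_vector_derivative[symmetric]
    by (rule derivative_eq_intros refl | simp add: field_simps del: of_nat_Suc of_nat_add power_Suc)+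
  have 2: "((\<lambda>s. s ^ (k + 1) / real (k + 1)) has_vector_derivative s ^ k) (at s)" for s :: real
    unfolding has_real_derivative_iff_has_vector_derivative[symmetric]
    by (rule derivative_eq_intros refl | simp add: field_simps del: of_nat_Suc of_nat_add power_Suc)+
  from taylor_kernel_integral[OF assms 1 2] show ?thesis by simp
qed

lemma continuous_on_unit_param_integral:
  fixes g :: "real \<Rightarrow> real \<Rightarrow> 'b::banach"
  assumes "continuous_on (S \<times> {0..1}) (\<lambda>(\<tau>, \<sigma>). g \<tau> \<sigma>)"
  shows "continuous_on S (\<lambda>\<tau>. integral {0..1} (g \<tau>))"
  using integral_continuous_on_param[of S 0 1 g] assms by simp

text \<open>Abstracts from the series: from here on the kernel is known through continuity and
  reflection, and its coefficients enter as conditions on \<open>row\<close> and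
  \<open>moment\<close>.\<close>

locale symmetric_kernel =
  fixes A :: "real \<Rightarrow> real \<Rightarrow> real"
  assumes continuous_A: "continuous_on ({0..1} \<times> {0..1}) (\<lambda>(\<tau>, \<sigma>). A \<tau> \<sigma>)"
    and A_reflect: "\<And>\<tau> \<sigma>. \<tau> \<in> {0..1} \<Longrightarrow> \<sigma> \<in> {0..1} \<Longrightarrow> A (1 - \<tau>) \<sigma> = A \<tau> (1 - \<sigma>) + 1 - \<sigma> - \<tau>"
begin

lemmas continuous_A_comp = continuous_on_unit_square_comp[OF continuous_A]

text \<open>Deviation from the kernel max 0 (\<tau> - \<sigma>) that reproduces the exact solution.\<close>
definition defect :: "real \<Rightarrow> real \<Rightarrow> real" where
  "defect \<tau> \<sigma> = A \<tau> \<sigma> - max 0 (\<tau> - \<sigma>)"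

text \<open>The residual of the stage condition \<integral> A(\<tau>, \<sigma>) \<sigma>^k d\<sigma>
  = \<tau>^(k+2) / ((k+1)(k+2)), the continuous-stage analogue of the usual simplifying
  assumptions.\<close>

definition row :: "nat \<Rightarrow> real \<Rightarrow> real" where
  "row k \<tau> = integral {0..1} (\<lambda>\<sigma>. defect \<tau> \<sigma> * \<sigma> ^ k)"

lemma continuous_defect_comp:
  assumes "continuous_on S f" "continuous_on S g" "f ` S \<subseteq> {0..1}" "g ` S \<subseteq> {0..1}"
  shows "continuous_on S (\<lambda>x. defect (f x) (g x))"
  unfolding defect_def by (intro continuous_intros continuous_A_comp assms)

lemma continuous_defect: "continuous_on ({0..1} \<times> {0..1}) (\<lambda>(\<tau>, \<sigma>). defect \<tau> \<sigma>)"
  unfolding split_def by (intro continuous_defect_comp continuous_intros) auto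

lemma continuous_row: "continuous_on {0..1} (row k)"
  unfolding row_def[abs_def] split_def
  by (intro continuous_on_unit_param_integral, unfold split_def)
     (intro continuous_defect_comp continuous_intros, auto)

lemma row_has_integral:
  assumes "\<tau> \<in> {0..1}"
  shows "((\<lambda>\<sigma>. defect \<tau> \<sigma> * \<sigma> ^ k) has_integral row k \<tau>) {0..1}"
  unfolding row_def
  by (intro integrable_integral integrable_continuous_real continuous_intros continuous_defect_comp)
     (use assms in auto)

lemma A_power_has_integral:
  assumes "\<tau> \<in> {0..1}"
  shows "((\<lambda>\<sigma>. A \<tau> \<sigma> * \<sigma> ^ k) has_integral row k \<tau> + \<tau> ^ (k + 2) / (real (k + 1) * real (k + 2))) {0..1}"
  using has_integral_add[OF row_has_integral[OF assms, of k] taylor_kernel_power[OF assms, of k]]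
  by (simp add: defect_def algebra_simps)

text \<open>Reflecting both variables adds \<sigma> - \<tau> to \<open>A\<close>, and also to the
  Taylor kernel, because max 0 x - max 0 (-x) = x.\<close>

lemma defect_reflect:
  assumes "\<tau> \<in> {0..1}" "\<sigma> \<in> {0..1}"
  shows "defect (1 - \<tau>) (1 - \<sigma>) = defect \<tau> \<sigma>"
  using A_reflect[of \<tau> "1 - \<sigma>"] assms by (auto simp: defect_def max_def)

text \<open>Invariance of the defect moves the reflection from \<tau> to the monomial. Expanding (1
  - \<sigma>)^k then expresses a reflected row through the rows of index at most k.\<close>

lemma row_reflect:
  assumes "\<tau> \<in> {0..1}"
  shows "((\<lambda>\<sigma>. defect \<tau> \<sigma> * (1 - \<sigma>) ^ k) has_integral row k (1 - \<tau>)) {0..1}"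
proof -
  have "((\<lambda>\<sigma>. defect (1 - \<tau>) (1 - \<sigma>) * (1 - \<sigma>) ^ k) has_integral row k (1 - \<tau>)) {0..1}"
    by (rule has_integral_reflect_unit[OF row_has_integral]) (use assms in auto)
  then show ?thesis
    by (subst (asm) has_integral_cong[where g = "\<lambda>\<sigma>. defect \<tau> \<sigma> * (1 - \<sigma>) ^ k"]) (use assms defect_reflect in auto)
qed

lemma row_0_reflect:
  assumes "\<tau> \<in> {0..1}"
  shows "row 0 (1 - \<tau>) = row 0 \<tau>"
proof -
  have "((\<lambda>\<sigma>. defect \<tau> \<sigma> * \<sigma> ^ 0) has_integral row 0 (1 - \<tau>)) {0..1}"
    using row_reflect[OF assms, of 0] by simp
  then show ?thesis by (rule has_integral_unique[OF _ row_has_integral[OF assms]])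
qed

lemma row_1_reflect:
  assumes "\<tau> \<in> {0..1}"
  shows "row (Suc 0) (1 - \<tau>) = row 0 \<tau> - row (Suc 0) \<tau>"
proof -
  have "((\<lambda>\<sigma>. defect \<tau> \<sigma> * \<sigma> ^ 0 - defect \<tau> \<sigma> * \<sigma> ^ Suc 0) has_integral row (Suc 0) (1 - \<tau>)) {0..1}"
    using row_reflect[OF assms, of "Suc 0"] by (simp add: right_diff_distrib)
  then show ?thesis
    by (rule has_integral_unique[OF _ has_integral_diff[OF row_has_integral[OF assms] row_has_integral[OF assms]]])
qed

lemma row_2_reflect: "\<tau> \<in> {0..1} \<Longrightarrow> row 2 (1 - \<tau>) = row 0 \<tau> - 2 * row 1 \<tau> + row 2 \<tau>"
proof -
  assume t: "\<tau> \<in> {0..1}"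
  have "((\<lambda>\<sigma>. defect \<tau> \<sigma> * \<sigma> ^ 0 - 2 * (defect \<tau> \<sigma> * \<sigma> ^ 1) + defect \<tau> \<sigma> * \<sigma> ^ 2) has_integral
      row 0 \<tau> - 2 * row 1 \<tau> + row 2 \<tau>) {0..1}"
    by (intro has_integral_add has_integral_diff has_integral_mult_right row_has_integral t)
  moreover have "(\<lambda>\<sigma>. defect \<tau> \<sigma> * \<sigma> ^ 0 - 2 * (defect \<tau> \<sigma> * \<sigma> ^ 1) + defect \<tau> \<sigma> * \<sigma> ^ 2) = (\<lambda>\<sigma>. defect \<tau> \<sigma> * (1 - \<sigma>) ^ 2)"
    by (auto simp: power2_eq_square algebra_simps)
  ultimately show ?thesis using has_integral_unique[OF row_reflect[OF t, of 2]] by metis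
qed

lemma row_3_reflect: "\<tau> \<in> {0..1} \<Longrightarrow> row 3 (1 - \<tau>) = row 0 \<tau> - 3 * row 1 \<tau> + 3 * row 2 \<tau> - row 3 \<tau>"
proof -
  assume t: "\<tau> \<in> {0..1}"
  have "((\<lambda>\<sigma>. defect \<tau> \<sigma> * \<sigma> ^ 0 - 3 * (defect \<tau> \<sigma> * \<sigma> ^ 1) + 3 * (defect \<tau> \<sigma> * \<sigma> ^ 2) - defect \<tau> \<sigma> * \<sigma> ^ 3) has_integral
      row 0 \<tau> - 3 * row 1 \<tau> + 3 * row 2 \<tau> - row 3 \<tau>) {0..1}"
    by (intro has_integral_add has_integral_diff has_integral_mult_right row_has_integral t)
  moreover have "(\<lambda>\<sigma>. defect \<tau> \<sigma> * \<sigma> ^ 0 - 3 * (defect \<tau> \<sigma> * \<sigma> ^ 1) + 3 * (defect \<tau> \<sigma> * \<sigma> ^ 2) - defect \<tau> \<sigma> * \<sigma> ^ 3)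
      = (\<lambda>\<sigma>. defect \<tau> \<sigma> * (1 - \<sigma>) ^ 3)"
    by (auto simp: power2_eq_square power3_eq_cube algebra_simps)
  ultimately show ?thesis using has_integral_unique[OF row_reflect[OF t, of 3]] by metis
qed

text \<open>These double moments are the order conditions: \<open>moment i k\<close> is the weight
  of a term of order h^(i + k + 2) in the integrated force error.\<close>

definition moment :: "nat \<Rightarrow> nat \<Rightarrow> real" where
  "moment i k = integral {0..1} (\<lambda>\<tau>. \<tau> ^ i * row k \<tau>)"

lemma moment_has_integral: "((\<lambda>\<tau>. \<tau> ^ i * row k \<tau>) has_integral moment i k) {0..1}"
  unfolding moment_def
  by (intro integrable_integral integrable_continuous_real continuous_intros continuous_row)

lemma moment_reflect: "((\<lambda>\<tau>. (1 - \<tau>) ^ i * row k (1 - \<tau>)) has_integral moment i k) {0..1}"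
  by (rule has_integral_reflect_unit[OF moment_has_integral])

text \<open>Reflecting \<tau> and expanding both factors gives linear relations among moments. When
  i + k is odd the moment reappears with coefficient -1, so it is determined by lower ones.\<close>

lemma moment_eqI:
  assumes "(\<phi> has_integral c) {0..1}" "\<And>\<tau>. \<tau> \<in> {0..1} \<Longrightarrow> \<phi> \<tau> = (1 - \<tau>) ^ i * row k (1 - \<tau>)"
  shows "moment i k = c"
proof -
  have "((\<lambda>\<tau>. (1 - \<tau>) ^ i * row k (1 - \<tau>)) has_integral c) {0..1}"
    by (subst has_integral_cong[where g = \<phi>]) (use assms in auto)
  then show ?thesis by (rule has_integral_unique[OF moment_reflect])
qed

lemma moment_0_1: "moment 0 1 = moment 0 0 - moment 0 1"
  by (rule moment_eqI[OF has_integral_diff[OF moment_has_integral moment_has_integral]])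
     (simp add: row_1_reflect)

lemma moment_1_0: "moment 1 0 = moment 0 0 - moment 1 0"
  by (rule moment_eqI[OF has_integral_diff[OF moment_has_integral moment_has_integral]])
     (simp add: row_0_reflect algebra_simps)

lemma moments_order_4:
  assumes "moment 0 0 = 0"
  shows "moment 0 1 = 0" "moment 1 0 = 0"
  using moment_0_1 moment_1_0 assms by auto

text \<open>The number 1/6 is the mean of \<tau>^2 / 2, the double integral of the Taylor
  kernel.\<close>

lemma moment_0_0_zero:
  assumes "integral {0..1} (\<lambda>\<tau>. integral {0..1} (\<lambda>\<sigma>. A \<tau> \<sigma> * shLeg 0 \<sigma>) * shLeg 0 \<tau>) = 1/6"
  shows "moment 0 0 = 0"
proof -
  have "integral {0..1} (\<lambda>\<sigma>. A \<tau> \<sigma> * shLeg 0 \<sigma>) * shLeg 0 \<tau> = \<tau> ^ 0 * row 0 \<tau> + \<tau>^2 / 2" if "\<tau> \<in> {0..1}" for \<tau>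
    using integral_unique[OF A_power_has_integral[OF that, of 0]] by (simp add: shLeg_0 power2_eq_square)
  then have "integral {0..1} (\<lambda>\<tau>. integral {0..1} (\<lambda>\<sigma>. A \<tau> \<sigma> * shLeg 0 \<sigma>) * shLeg 0 \<tau>)
      = integral {0..1} (\<lambda>\<tau>. \<tau> ^ 0 * row 0 \<tau> + \<tau>^2 / 2)"
    by (rule integral_cong)
  also have "\<dots> = moment 0 0 + 1/6"
  proof (intro integral_unique has_integral_add moment_has_integral)
    have "(\<lambda>\<tau>::real. \<tau>^2 / 2) integrable_on {0..1}"
      by (intro integrable_continuous_real continuous_intros) auto
    then show "((\<lambda>\<tau>::real. \<tau>^2 / 2) has_integral 1/6) {0..1}"
      using integral_quartic[of 0 0 "1/2" 0 0] by (simp add: has_integral_iff)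
  qed
  finally show ?thesis using assms by simp
qed

lemma row_0_zero:
  assumes "\<tau> \<in> {0..1}" "integral {0..1} (A \<tau>) = \<tau>^2 / 2"
  shows "row 0 \<tau> = 0"
  using integral_unique[OF A_power_has_integral[OF assms(1), of 0]] assms(2) by (simp add: power2_eq_square)

section \<open>Moments under the stage condition \<open>row 0 \<tau> = 0\<close>\<close>

context
  assumes row_0: "\<And>\<tau>. \<tau> \<in> {0..1} \<Longrightarrow> row 0 \<tau> = 0"
begin

lemma moment_i_0: "moment i 0 = 0"
  unfolding moment_def using integral_cong[of "{0..1}" "\<lambda>\<tau>. \<tau> ^ i * row 0 \<tau>" "\<lambda>_. 0"] row_0 by simp

lemma moment_0_1_zero: "moment 0 1 = 0"
  by (rule moments_order_4(1)[OF moment_i_0])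

text \<open>The (0, 2) Legendre coefficient of the Taylor kernel is sqrt 5 * (1/10 - 1/4 + 1/6) =
  sqrt 5 / 60, so the hypothesis makes that of the defect vanish. With row 0 and
  \<open>moment 0 1\<close> gone, only \<open>moment 0 2\<close> is left in it.\<close>

lemma moment_0_2_zero:
  assumes "integral {0..1} (\<lambda>\<tau>. integral {0..1} (\<lambda>\<sigma>. A \<tau> \<sigma> * shLeg 2 \<sigma>) * shLeg 0 \<tau>) = sqrt 5 / 60"
  shows "moment 0 2 = 0"
proof -
  have "integral {0..1} (\<lambda>\<sigma>. A \<tau> \<sigma> * shLeg 2 \<sigma>) * shLeg 0 \<tau> =
     sqrt 5 * (6 * (\<tau> ^ 0 * row 2 \<tau>) - 6 * (\<tau> ^ 0 * row 1 \<tau>) + (\<tau>^4 / 2 - \<tau>^3 + \<tau>^2 / 2))" if t: "\<tau> \<in> {0..1}" for \<tau>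
  proof -
    have "((\<lambda>\<sigma>. sqrt 5 * (6 * (A \<tau> \<sigma> * \<sigma> ^ 2) - 6 * (A \<tau> \<sigma> * \<sigma> ^ 1) + A \<tau> \<sigma> * \<sigma> ^ 0)) has_integral
      sqrt 5 * (6 * (row 2 \<tau> + \<tau> ^ (2 + 2) / (real (2 + 1) * real (2 + 2))) - 6 * (row 1 \<tau> + \<tau> ^ (1 + 2) / (real (1 + 1) * real (1 + 2)))
        + (row 0 \<tau> + \<tau> ^ (0 + 2) / (real (0 + 1) * real (0 + 2))))) {0..1}"
      by (intro has_integral_add has_integral_diff has_integral_mult_right A_power_has_integral t)
    moreover have "(\<lambda>\<sigma>. sqrt 5 * (6 * (A \<tau> \<sigma> * \<sigma> ^ 2) - 6 * (A \<tau> \<sigma> * \<sigma> ^ 1) + A \<tau> \<sigma> * \<sigma> ^ 0)) = (\<lambda>\<sigma>. A \<tau> \<sigma> * shLeg 2 \<sigma>)"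
      by (auto simp: shLeg_2 algebra_simps)
    ultimately show ?thesis using row_0[OF t]
      by (simp add: has_integral_iff shLeg_0 eval_nat_numeral algebra_simps)
  qed
  then have "integral {0..1} (\<lambda>\<tau>. integral {0..1} (\<lambda>\<sigma>. A \<tau> \<sigma> * shLeg 2 \<sigma>) * shLeg 0 \<tau>)
      = integral {0..1} (\<lambda>\<tau>. sqrt 5 * (6 * (\<tau> ^ 0 * row 2 \<tau>) - 6 * (\<tau> ^ 0 * row 1 \<tau>) + (\<tau>^4 / 2 - \<tau>^3 + \<tau>^2 / 2)))"
    by (rule integral_cong)
  also have "\<dots> = sqrt 5 * (6 * moment 0 2 - 6 * moment 0 1 + 1/60)"
  proof (intro integral_unique has_integral_mult_right has_integral_add has_integral_diff moment_has_integral)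
    have "(\<lambda>\<tau>::real. \<tau>^4 / 2 - \<tau>^3 + \<tau>^2 / 2) integrable_on {0..1}"
      by (intro integrable_continuous_real continuous_intros) auto
    then show "((\<lambda>\<tau>::real. \<tau>^4 / 2 - \<tau>^3 + \<tau>^2 / 2) has_integral 1/60) {0..1}"
      using integral_quartic[of 0 0 "1/2" "-1" "1/2"] by (simp add: has_integral_iff algebra_simps)
  qed
  finally show ?thesis using assms moment_0_1_zero by (simp add: field_simps)
qed

text \<open>Here the Taylor kernel contributes 3 * (2/15 - 1/3 + 1/6) = -1/10, and the defect
  contributes 12 times \<open>moment 1 1\<close>.\<close>

lemma moment_1_1_zero:
  assumes "integral {0..1} (\<lambda>\<tau>. integral {0..1} (\<lambda>\<sigma>. A \<tau> \<sigma> * shLeg 1 \<sigma>) * shLeg 1 \<tau>) = - 1/10"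
  shows "moment 1 1 = 0"
proof -
  have "integral {0..1} (\<lambda>\<sigma>. A \<tau> \<sigma> * shLeg 1 \<sigma>) * shLeg 1 \<tau> =
     3 * (4 * (\<tau> ^ 1 * row 1 \<tau>) - 2 * (\<tau> ^ 0 * row 1 \<tau>) + (2 * \<tau>^4 / 3 - 4 * \<tau>^3 / 3 + \<tau>^2 / 2))" if t: "\<tau> \<in> {0..1}" for \<tau>
  proof -
    have "((\<lambda>\<sigma>. sqrt 3 * (2 * (A \<tau> \<sigma> * \<sigma> ^ 1) - A \<tau> \<sigma> * \<sigma> ^ 0)) has_integral
      sqrt 3 * (2 * (row 1 \<tau> + \<tau> ^ (1 + 2) / (real (1 + 1) * real (1 + 2)))
        - (row 0 \<tau> + \<tau> ^ (0 + 2) / (real (0 + 1) * real (0 + 2))))) {0..1}"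
      by (intro has_integral_diff has_integral_mult_right A_power_has_integral t)
    moreover have "(\<lambda>\<sigma>. sqrt 3 * (2 * (A \<tau> \<sigma> * \<sigma> ^ 1) - A \<tau> \<sigma> * \<sigma> ^ 0)) = (\<lambda>\<sigma>. A \<tau> \<sigma> * shLeg 1 \<sigma>)"
      by (auto simp: shLeg_1 algebra_simps)
    ultimately have *: "integral {0..1} (\<lambda>\<sigma>. A \<tau> \<sigma> * shLeg 1 \<sigma>) = sqrt 3 * (2 * row 1 \<tau> + \<tau>^3 / 3 - \<tau>^2 / 2)"
      using row_0[OF t] by (simp add: has_integral_iff power2_eq_square power3_eq_cube algebra_simps)
    have "shLeg 1 \<tau> = sqrt 3 * (2 * \<tau> - 1)" by (simp add: shLeg_1)
    with * have "integral {0..1} (\<lambda>\<sigma>. A \<tau> \<sigma> * shLeg 1 \<sigma>) * shLeg 1 \<tau>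
        = (sqrt 3 * sqrt 3) * ((2 * row 1 \<tau> + \<tau>^3 / 3 - \<tau>^2 / 2) * (2 * \<tau> - 1))"
      by (simp only: mult_ac)
    then show ?thesis
      by (simp add: field_simps eval_nat_numeral)
  qed
  then have "integral {0..1} (\<lambda>\<tau>. integral {0..1} (\<lambda>\<sigma>. A \<tau> \<sigma> * shLeg 1 \<sigma>) * shLeg 1 \<tau>)
      = integral {0..1} (\<lambda>\<tau>. 3 * (4 * (\<tau> ^ 1 * row 1 \<tau>) - 2 * (\<tau> ^ 0 * row 1 \<tau>) + (2 * \<tau>^4 / 3 - 4 * \<tau>^3 / 3 + \<tau>^2 / 2)))"
    by (rule integral_cong)
  also have "\<dots> = 3 * (4 * moment 1 1 - 2 * moment 0 1 + (- 1/30))"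
  proof (intro integral_unique has_integral_mult_right has_integral_add has_integral_diff moment_has_integral)
    have "(\<lambda>\<tau>::real. 2 * \<tau>^4 / 3 - 4 * \<tau>^3 / 3 + \<tau>^2 / 2) integrable_on {0..1}"
      by (intro integrable_continuous_real continuous_intros) auto
    then show "((\<lambda>\<tau>::real. 2 * \<tau>^4 / 3 - 4 * \<tau>^3 / 3 + \<tau>^2 / 2) has_integral - 1/30) {0..1}"
      using integral_quartic[of 0 0 "1/2" "-4/3" "2/3"] by (simp add: has_integral_iff algebra_simps)
  qed
  finally show ?thesis using assms moment_0_1_zero by simp
qed

text \<open>An odd moment in terms of even ones and \<open>moment 0 1\<close>; the leading 0 stands
  for the \<open>moment 0 0\<close> term of the cubic expansion.\<close>

lemma moment_0_3: "moment 0 3 = 0 - 3 * moment 0 1 + 3 * moment 0 2 - moment 0 3"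
  by (rule moment_eqI[OF has_integral_diff[OF has_integral_add[OF has_integral_diff[OF has_integral_0
      has_integral_mult_right[OF moment_has_integral]] has_integral_mult_right[OF moment_has_integral]] moment_has_integral]])
     (simp add: row_3_reflect row_0)

lemma moment_1_2: "moment 1 2 = moment 0 2 - 2 * moment 0 1 - moment 1 2 + 2 * moment 1 1"
  by (rule moment_eqI[OF has_integral_add[OF has_integral_diff[OF has_integral_diff[OF moment_has_integral
      has_integral_mult_right[OF moment_has_integral]] moment_has_integral] has_integral_mult_right[OF moment_has_integral]]])
     (simp add: row_2_reflect row_0 algebra_simps)

lemma moment_2_1: "moment 2 1 = 2 * moment 1 1 - moment 0 1 - moment 2 1"
  by (rule moment_eqI[OF has_integral_diff[OF has_integral_diff[OF
      has_integral_mult_right[OF moment_has_integral] moment_has_integral] moment_has_integral]])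
     (simp add: row_1_reflect row_0 power2_eq_square algebra_simps)

lemma moments_order_6:
  assumes "moment 0 2 = 0" "moment 1 1 = 0"
  shows "moment 0 3 = 0" "moment 1 2 = 0" "moment 2 1 = 0"
  using moment_0_3 moment_1_2 moment_2_1 assms moment_0_1_zero by auto

text \<open>The double integral changes sign under reflecting both variables, since
  \<open>A (1 - \<tau>) (1 - \<sigma>) = A \<tau> \<sigma> + \<sigma> - \<tau>\<close> and \<open>row 1\<close> is antisymmetric.\<close>
lemma iterated_row_integral:
  assumes "moment 1 1 = 0"
  shows "integral {0..1} (\<lambda>\<tau>. integral {0..1} (\<lambda>\<sigma>. A \<tau> \<sigma> * row 1 \<sigma>)) = 0"
proof -
  define R where "R \<tau> = integral {0..1} (\<lambda>\<sigma>. A \<tau> \<sigma> * row 1 \<sigma>)" for \<tau>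
  have cR: "continuous_on {0..1} R"
    unfolding R_def[abs_def]
    by (intro continuous_on_unit_param_integral, unfold split_def)
       (intro continuous_A_comp continuous_intros continuous_on_compose2[OF continuous_row], auto)
  have "R (1 - \<tau>) = - R \<tau>" if t: "\<tau> \<in> {0..1}" for \<tau>
  proof -
    have i: "(\<lambda>\<sigma>. A s \<sigma> * row 1 \<sigma>) integrable_on {0..1}" if "s \<in> {0..1}" for s
      by (intro integrable_continuous_real continuous_A_comp continuous_intros continuous_row)
         (use that in auto)
    have a: "((\<lambda>\<sigma>. A (1 - \<tau>) (1 - \<sigma>) * row 1 (1 - \<sigma>)) has_integral R (1 - \<tau>)) {0..1}"
      unfolding R_def by (rule has_integral_reflect_unit[OF integrable_integral[OF i]]) (use t in auto)
    \<comment> \<open>The correction \<sigma> - \<tau> of the reflected kernel produces just these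
      two moments, both zero.\<close>
    have b: "((\<lambda>\<sigma>. \<tau> * (\<sigma> ^ 0 * row 1 \<sigma>) - \<sigma> ^ 1 * row 1 \<sigma> - A \<tau> \<sigma> * row 1 \<sigma>) has_integral
        \<tau> * moment 0 1 - moment 1 1 - R \<tau>) {0..1}"
      unfolding R_def by (intro has_integral_diff has_integral_mult_right moment_has_integral integrable_integral i t)
    have c: "A (1 - \<tau>) (1 - \<sigma>) * row 1 (1 - \<sigma>) = \<tau> * (\<sigma> ^ 0 * row 1 \<sigma>) - \<sigma> ^ 1 * row 1 \<sigma> - A \<tau> \<sigma> * row 1 \<sigma>"
      if "\<sigma> \<in> {0..1}" for \<sigma>
    proof -
      have 1: "A (1 - \<tau>) (1 - \<sigma>) = A \<tau> \<sigma> + \<sigma> - \<tau>"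
        using A_reflect[OF t, of "1 - \<sigma>"] that by simp
      have 2: "row 1 (1 - \<sigma>) = - row 1 \<sigma>"
        using row_1_reflect[OF that] row_0[OF that] by simp
      show ?thesis unfolding 1 2 by (simp add: algebra_simps)
    qed
    show ?thesis
      using has_integral_unique[OF has_integral_eq[OF c a] b] assms moment_0_1_zero by simp
  qed
  then have "integral {0..1} (\<lambda>\<tau>. R (1 - \<tau>)) = integral {0..1} (\<lambda>\<tau>. - R \<tau>)"
    by (rule integral_cong)
  with integral_reflect_unit[OF cR] have "integral {0..1} R = 0" by simp
  then show ?thesis unfolding R_def[abs_def] .
qed

end

end

section \<open>Local error expansion\<close>

text \<open>With the partial derivatives of \<open>f\<close> as \<open>w\<close>, this is the
  derivative of \<open>f\<close> in direction \<open>c\<close>. As a bilinear expression it lets two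
  expansions in \<open>h\<close> be multiplied out term by term.\<close>

definition contract :: "'a::euclidean_space \<Rightarrow> ('a \<Rightarrow> 'b::real_normed_vector) \<Rightarrow> 'b" where
  "contract c w = (\<Sum>b\<in>Basis. (c \<bullet> b) *\<^sub>R w b)"

lemma contract_add_left: "contract (c + c') w = contract c w + contract c' w"
  by (simp add: contract_def inner_add_left scaleR_add_left sum.distrib)

lemma contract_diff_left: "contract (c - c') w = contract c w - contract c' w"
  by (simp add: contract_def inner_diff_left scaleR_diff_left sum_subtractf)

lemma contract_scaleR_left: "contract (r *\<^sub>R c) w = r *\<^sub>R contract c w"
  by (simp add: contract_def scaleR_sum_right)

lemma contract_add_right: "contract c (\<lambda>b. w b + w' b) = contract c w + contract c w'"
  by (simp add: contract_def scaleR_add_right sum.distrib)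

lemma contract_diff_right: "contract c (\<lambda>b. w b - w' b) = contract c w - contract c w'"
  by (simp add: contract_def scaleR_diff_right sum_subtractf)

lemma contract_scaleR_right: "contract c (\<lambda>b. r *\<^sub>R w b) = r *\<^sub>R contract c w"
  by (simp add: contract_def scaleR_sum_right mult.commute)

lemmas contract_bilinear = contract_add_left contract_scaleR_left contract_add_right contract_scaleR_right

text \<open>The window \<open>h0\<close> is so small that the exact solution stays in the unit ball
  around \<open>q t0\<close>. The stages are confined to that ball too, so one compact convex set
  serves all estimates on \<open>f\<close>. The bound h0 \<le> 1 makes higher powers of h
  smaller.\<close>

locale rkn_problem = symmetric_kernel A for A :: "real \<Rightarrow> real \<Rightarrow> real" +
  fixes f :: "real \<times> 'a::euclidean_space \<Rightarrow> 'a" and t0 :: real and q v :: "real \<Rightarrow> 'a" and \<delta> h0 :: real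
  assumes f: "smooth_fun f"
    and h0: "0 < h0" "h0 \<le> 1" "h0 < \<delta>"
    and q_deriv: "\<And>t. t \<in> ball t0 \<delta> \<Longrightarrow> (q has_vector_derivative v t) (at t)"
    and v_deriv: "\<And>t. t \<in> ball t0 \<delta> \<Longrightarrow> (v has_vector_derivative f (t, q t)) (at t)"
    and near: "\<And>s. \<bar>s\<bar> \<le> h0 \<Longrightarrow> dist (q (t0 + s)) (q t0) \<le> 1"
begin

definition force :: "real \<Rightarrow> 'a" where
  "force s = f (t0 + s, q (t0 + s))"

definition force_deriv :: "'a \<Rightarrow> real \<Rightarrow> 'a" where
  "force_deriv b s = space_deriv f b (t0 + s, q (t0 + s))"

definition admissible :: "real \<Rightarrow> (real \<Rightarrow> 'a) \<Rightarrow> bool" where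
  "admissible h Q \<longleftrightarrow> \<bar>h\<bar> \<le> h0 \<and> continuous_on {0..1} Q \<and> (\<forall>\<tau>\<in>{0..1}. dist (Q \<tau>) (q t0) \<le> 1) \<and>
     (\<forall>\<tau>\<in>{0..1}. Q \<tau> = q t0 + (h * \<tau>) *\<^sub>R v t0 +
        h^2 *\<^sub>R integral {0..1} (\<lambda>\<sigma>. A \<tau> \<sigma> *\<^sub>R f (t0 + \<sigma> * h, Q \<sigma>)))"

definition err :: "real \<Rightarrow> (real \<Rightarrow> 'a) \<Rightarrow> real \<Rightarrow> 'a" where
  "err h Q \<tau> = Q \<tau> - q (t0 + \<tau> * h)"

definition force_err :: "real \<Rightarrow> (real \<Rightarrow> 'a) \<Rightarrow> real \<Rightarrow> 'a" where
  "force_err h Q \<tau> = f (t0 + \<tau> * h, Q \<tau>) - force (\<tau> * h)"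

text \<open>Uniform over \<tau> and over all stage functions confined to the unit ball, since the
  order statement concerns every such stage function.\<close>

definition bigO :: "nat \<Rightarrow> (real \<Rightarrow> (real \<Rightarrow> 'a) \<Rightarrow> real \<Rightarrow> 'b::real_normed_vector) \<Rightarrow> bool" where
  "bigO n X \<longleftrightarrow> (\<exists>K\<ge>0. \<forall>h Q \<tau>. admissible h Q \<longrightarrow> \<tau> \<in> {0..1} \<longrightarrow> norm (X h Q \<tau>) \<le> K * \<bar>h\<bar> ^ n)"

section \<open>Calculus of uniform orders in \<open>h\<close>\<close>

lemma bigOI: "(\<And>h Q \<tau>. admissible h Q \<Longrightarrow> \<tau> \<in> {0..1} \<Longrightarrow> norm (X h Q \<tau>) \<le> K * \<bar>h\<bar> ^ n) \<Longrightarrow> K \<ge> 0 \<Longrightarrow> bigO n X"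
  unfolding bigO_def by blast

lemma bigOE:
  assumes "bigO n X"
  obtains K where "K \<ge> 0" "\<And>h Q \<tau>. admissible h Q \<Longrightarrow> \<tau> \<in> {0..1} \<Longrightarrow> norm (X h Q \<tau>) \<le> K * \<bar>h\<bar> ^ n"
  using assms unfolding bigO_def by blast

lemma admissible_h: "admissible h Q \<Longrightarrow> \<bar>h\<bar> \<le> h0" "admissible h Q \<Longrightarrow> \<bar>h\<bar> \<le> 1"
  using h0 by (auto simp: admissible_def)

lemma node_range: "\<bar>h\<bar> \<le> h0 \<Longrightarrow> \<tau> \<in> {0..1} \<Longrightarrow> \<bar>\<tau> * h\<bar> \<le> h0"
  using h0 mult_mono[of "\<bar>\<tau>\<bar>" 1 "\<bar>h\<bar>" h0] by (auto simp: abs_mult)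

lemma node_ball: "\<bar>h\<bar> \<le> h0 \<Longrightarrow> \<tau> \<in> {0..1} \<Longrightarrow> t0 + \<tau> * h \<in> ball t0 \<delta>"
  using node_range[of h \<tau>] h0 by (auto simp: dist_norm)

lemma bigO_add:
  assumes "bigO n X" "bigO n Y"
  shows "bigO n (\<lambda>h Q \<tau>. X h Q \<tau> + Y h Q \<tau>)"
proof -
  obtain K where K: "K \<ge> 0" "\<And>h Q \<tau>. admissible h Q \<Longrightarrow> \<tau> \<in> {0..1} \<Longrightarrow> norm (X h Q \<tau>) \<le> K * \<bar>h\<bar> ^ n"
    using assms(1) by (rule bigOE) (rule that)
  obtain L where L: "L \<ge> 0" "\<And>h Q \<tau>. admissible h Q \<Longrightarrow> \<tau> \<in> {0..1} \<Longrightarrow> norm (Y h Q \<tau>) \<le> L * \<bar>h\<bar> ^ n"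
    using assms(2) by (rule bigOE) (rule that)
  show ?thesis
  proof (rule bigOI)
    fix h Q \<tau> assume "admissible h Q" "\<tau> \<in> {0..1::real}"
    then show "norm (X h Q \<tau> + Y h Q \<tau>) \<le> (K + L) * \<bar>h\<bar> ^ n"
      using norm_triangle_mono[OF K(2) L(2)] by (simp add: algebra_simps)
  qed (use K L in simp)
qed

lemma bigO_scaleR:
  assumes "bigO m a" "bigO n X"
  shows "bigO (m + n) (\<lambda>h Q \<tau>. (a h Q \<tau> :: real) *\<^sub>R X h Q \<tau>)"
proof -
  obtain K where K: "K \<ge> 0" "\<And>h Q \<tau>. admissible h Q \<Longrightarrow> \<tau> \<in> {0..1} \<Longrightarrow> norm (a h Q \<tau>) \<le> K * \<bar>h\<bar> ^ m"
    using assms(1) by (rule bigOE) (rule that)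
  obtain L where L: "L \<ge> 0" "\<And>h Q \<tau>. admissible h Q \<Longrightarrow> \<tau> \<in> {0..1} \<Longrightarrow> norm (X h Q \<tau>) \<le> L * \<bar>h\<bar> ^ n"
    using assms(2) by (rule bigOE) (rule that)
  show ?thesis
  proof (rule bigOI)
    fix h Q \<tau> assume "admissible h Q" "\<tau> \<in> {0..1::real}"
    then have "norm (a h Q \<tau>) * norm (X h Q \<tau>) \<le> (K * \<bar>h\<bar> ^ m) * (L * \<bar>h\<bar> ^ n)"
      by (intro mult_mono K L mult_nonneg_nonneg) (auto intro: K(1))
    then show "norm (a h Q \<tau> *\<^sub>R X h Q \<tau>) \<le> (K * L) * \<bar>h\<bar> ^ (m + n)"
      by (simp add: power_add mult_ac)
  qed (use K L in simp)
qed

lemma bigO_mono: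
  assumes "bigO n X" "m \<le> n"
  shows "bigO m X"
proof -
  obtain K where K: "K \<ge> 0" "\<And>h Q \<tau>. admissible h Q \<Longrightarrow> \<tau> \<in> {0..1} \<Longrightarrow> norm (X h Q \<tau>) \<le> K * \<bar>h\<bar> ^ n"
    using assms(1) by (rule bigOE) (rule that)
  show ?thesis
  proof (rule bigOI)
    fix h Q \<tau> assume *: "admissible h Q" "\<tau> \<in> {0..1::real}"
    have "norm (X h Q \<tau>) \<le> K * \<bar>h\<bar> ^ n" by (rule K(2)[OF *])
    also have "\<dots> \<le> K * \<bar>h\<bar> ^ m"
      using admissible_h[OF *(1)] assms(2) by (intro mult_left_mono K(1) power_decreasing) auto
    finally show "norm (X h Q \<tau>) \<le> K * \<bar>h\<bar> ^ m" .
  qed (rule K(1))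
qed

lemma bigO_cong:
  assumes "bigO n X" "\<And>h Q \<tau>. admissible h Q \<Longrightarrow> \<tau> \<in> {0..1} \<Longrightarrow> Y h Q \<tau> = X h Q \<tau>"
  shows "bigO n Y"
proof -
  obtain K where K: "K \<ge> 0" "\<And>h Q \<tau>. admissible h Q \<Longrightarrow> \<tau> \<in> {0..1} \<Longrightarrow> norm (X h Q \<tau>) \<le> K * \<bar>h\<bar> ^ n"
    using assms(1) by (rule bigOE) (rule that)
  show ?thesis by (rule bigOI[of _ K]) (simp_all only: assms(2) K)
qed

lemma bigO_zero: "bigO n (\<lambda>h Q \<tau>. 0)"
  by (rule bigOI[of _ 0]) auto

lemma bigO_sum: "finite B \<Longrightarrow> (\<And>b. b \<in> B \<Longrightarrow> bigO n (X b)) \<Longrightarrow> bigO n (\<lambda>h Q \<tau>. \<Sum>b\<in>B. X b h Q \<tau>)"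
  by (induction B rule: finite_induct) (auto intro: bigO_add bigO_zero)

lemma bigO_inner:
  assumes "bigO n X" "b \<in> Basis"
  shows "bigO n (\<lambda>h Q \<tau>. X h Q \<tau> \<bullet> b)"
proof -
  obtain K where K: "K \<ge> 0" "\<And>h Q \<tau>. admissible h Q \<Longrightarrow> \<tau> \<in> {0..1} \<Longrightarrow> norm (X h Q \<tau>) \<le> K * \<bar>h\<bar> ^ n"
    using assms(1) by (rule bigOE) (rule that)
  show ?thesis
    by (rule bigOI[of _ K]) (use order_trans[OF Basis_le_norm[OF assms(2)] K(2)] K(1) in auto)
qed

lemma bigO_contract:
  assumes "bigO m X" "\<And>b. b \<in> Basis \<Longrightarrow> bigO n (Y b)"
  shows "bigO (m + n) (\<lambda>h Q \<tau>. contract (X h Q \<tau>) (\<lambda>b. Y b h Q \<tau>))"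
  unfolding contract_def by (intro bigO_sum bigO_scaleR bigO_inner assms) auto

lemma bigO_power: "bigO n (\<lambda>h Q \<tau>. h ^ n)"
  by (rule bigOI[of _ 1]) (auto simp: power_abs)

lemma bigO_continuous:
  assumes "continuous_on {0..1} c"
  shows "bigO 0 (\<lambda>h Q. c)"
proof -
  obtain M where "M \<ge> 0" "\<And>z. z \<in> {0..1} \<Longrightarrow> norm (c z) \<le> M"
    using compact_bound[OF _ assms] by auto
  then show ?thesis by (intro bigOI[of _ M]) auto
qed

lemma bigO_term:
  assumes "p \<le> n" "continuous_on {0..1} m"
  shows "bigO p (\<lambda>h Q \<tau>. (h ^ n * m \<tau>) *\<^sub>R c)"
proof -
  have "bigO (n + 0) (\<lambda>h Q \<tau>. h ^ n *\<^sub>R (m \<tau> *\<^sub>R c))"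
    by (intro bigO_scaleR bigO_power bigO_continuous continuous_intros assms)
  then show ?thesis using bigO_mono[OF _ assms(1)] by simp
qed

lemma continuous_q: "continuous_on (ball t0 \<delta>) q"
  by (rule has_vector_derivative_imp_continuous_on[of _ _ v]) (use q_deriv in blast)

lemma continuous_q_node: "\<bar>h\<bar> \<le> h0 \<Longrightarrow> continuous_on {0..1} (\<lambda>\<tau>. q (t0 + \<tau> * h))"
  by (rule continuous_on_compose2[OF continuous_q]) (auto intro!: continuous_intros dest: node_ball)

lemma continuous_smooth_node:
  fixes F :: "real \<times> 'a \<Rightarrow> 'b::real_normed_vector"
  assumes "smooth_fun F" "continuous_on {0..1} Q"
  shows "continuous_on {0..1} (\<lambda>\<tau>. F (t0 + \<tau> * h, Q \<tau>))"
  by (rule continuous_on_compose2[OF smooth_fun_continuous_on[OF assms(1), of UNIV]])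
     (auto intro!: continuous_intros assms(2))

lemma continuous_force: "\<bar>h\<bar> \<le> h0 \<Longrightarrow> continuous_on {0..1} (\<lambda>\<tau>. force (\<tau> * h))"
  unfolding force_def by (intro continuous_smooth_node f continuous_q_node)

lemma continuous_force_err: "admissible h Q \<Longrightarrow> continuous_on {0..1} (force_err h Q)"
  unfolding force_err_def[abs_def]
  by (intro continuous_intros continuous_smooth_node f continuous_force) (auto simp: admissible_def)

lemma continuous_A_row: "\<tau> \<in> {0..1} \<Longrightarrow> continuous_on {0..1} (A \<tau>)"
  using continuous_A_comp[of "{0..1}" "\<lambda>_. \<tau>" "\<lambda>\<sigma>. \<sigma>"] by (simp add: image_subset_iff)

lemma continuous_defect_row: "\<tau> \<in> {0..1} \<Longrightarrow> continuous_on {0..1} (defect \<tau>)"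
  using continuous_defect_comp[of "{0..1}" "\<lambda>_. \<tau>" "\<lambda>\<sigma>. \<sigma>"] by (simp add: image_subset_iff)

lemma defect_bound: obtains M where "M \<ge> 0" "\<And>\<tau> \<sigma>. \<tau> \<in> {0..1} \<Longrightarrow> \<sigma> \<in> {0..1} \<Longrightarrow> \<bar>defect \<tau> \<sigma>\<bar> \<le> M"
proof -
  obtain M where M: "M \<ge> 0" "\<And>z. z \<in> {0..1} \<times> {0..1} \<Longrightarrow> norm (case z of (\<tau>, \<sigma>) \<Rightarrow> defect \<tau> \<sigma>) \<le> M"
    by (rule compact_bound[OF compact_Times[OF compact_Icc compact_Icc] continuous_defect]) (rule that)
  show ?thesis
  proof (rule that)
    show "\<bar>defect \<tau> \<sigma>\<bar> \<le> M" if "\<tau> \<in> {0..1}" "\<sigma> \<in> {0..1}" for \<tau> \<sigma>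
      using M(2)[of "(\<tau>, \<sigma>)"] that by simp
  qed (rule M(1))
qed

lemma A_bound: obtains M where "M \<ge> 0" "\<And>\<tau> \<sigma>. \<tau> \<in> {0..1} \<Longrightarrow> \<sigma> \<in> {0..1} \<Longrightarrow> \<bar>A \<tau> \<sigma>\<bar> \<le> M"
proof -
  obtain M where M: "M \<ge> 0" "\<And>z. z \<in> {0..1} \<times> {0..1} \<Longrightarrow> norm (case z of (\<tau>, \<sigma>) \<Rightarrow> A \<tau> \<sigma>) \<le> M"
    by (rule compact_bound[OF compact_Times[OF compact_Icc compact_Icc] continuous_A]) (rule that)
  show ?thesis
  proof (rule that)
    show "\<bar>A \<tau> \<sigma>\<bar> \<le> M" if "\<tau> \<in> {0..1}" "\<sigma> \<in> {0..1}" for \<tau> \<sigma>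
      using M(2)[of "(\<tau>, \<sigma>)"] that by simp
  qed (rule M(1))
qed

text \<open>A bounded kernel preserves orders, so feeding an error back through the stage equation
  gains the two powers of its prefactor h^2.\<close>

lemma bigO_A_integral:
  fixes X :: "real \<Rightarrow> (real \<Rightarrow> 'a) \<Rightarrow> real \<Rightarrow> 'b::banach"
  assumes "bigO n X" "\<And>h Q. admissible h Q \<Longrightarrow> continuous_on {0..1} (X h Q)"
  shows "bigO n (\<lambda>h Q \<tau>. integral {0..1} (\<lambda>\<sigma>. A \<tau> \<sigma> *\<^sub>R X h Q \<sigma>))"
proof -
  obtain K where K: "K \<ge> 0" "\<And>h Q \<tau>. admissible h Q \<Longrightarrow> \<tau> \<in> {0..1} \<Longrightarrow> norm (X h Q \<tau>) \<le> K * \<bar>h\<bar> ^ n"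
    using assms(1) by (rule bigOE) (rule that)
  obtain M where M: "M \<ge> 0" "\<And>\<tau> \<sigma>. \<tau> \<in> {0..1} \<Longrightarrow> \<sigma> \<in> {0..1} \<Longrightarrow> \<bar>A \<tau> \<sigma>\<bar> \<le> M"
    by (rule A_bound) (rule that)
  show ?thesis
  proof (rule bigOI)
    fix h Q \<tau> assume *: "admissible h Q" "\<tau> \<in> {0..1::real}"
    have "norm (integral {0..1} (\<lambda>\<sigma>. A \<tau> \<sigma> *\<^sub>R X h Q \<sigma>)) \<le> (M * (K * \<bar>h\<bar> ^ n)) * (1 - 0)"
    proof (rule integral_bound)
      fix \<sigma> :: real assume "\<sigma> \<in> {0..1}"
      then show "norm (A \<tau> \<sigma> *\<^sub>R X h Q \<sigma>) \<le> M * (K * \<bar>h\<bar> ^ n)"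
        unfolding norm_scaleR using * M(1) by (intro mult_mono M K) auto
    qed (auto intro!: continuous_intros continuous_A_row assms(2) *)
    then show "norm (integral {0..1} (\<lambda>\<sigma>. A \<tau> \<sigma> *\<^sub>R X h Q \<sigma>)) \<le> (M * K) * \<bar>h\<bar> ^ n"
      by (simp add: mult.assoc)
  qed (use K M in simp)
qed

section \<open>The exact solution on the unit interval and the error equation\<close>

lemma q_node_deriv:
  assumes "\<bar>h\<bar> \<le> h0" "s \<in> {0..1}"
  shows "((\<lambda>s. q (t0 + s * h)) has_vector_derivative h *\<^sub>R v (t0 + s * h)) (at s)"
    and "((\<lambda>s. v (t0 + s * h)) has_vector_derivative h *\<^sub>R force (s * h)) (at s)"
proof -
  have d: "((\<lambda>s. t0 + s * h) has_vector_derivative h) (at s)"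
    unfolding has_real_derivative_iff_has_vector_derivative[symmetric]
    by (auto intro!: derivative_eq_intros)
  show "((\<lambda>s. q (t0 + s * h)) has_vector_derivative h *\<^sub>R v (t0 + s * h)) (at s)"
    using vector_diff_chain_at[OF d q_deriv[OF node_ball[OF assms]]] by (simp add: o_def)
  show "((\<lambda>s. v (t0 + s * h)) has_vector_derivative h *\<^sub>R force (s * h)) (at s)"
    using vector_diff_chain_at[OF d v_deriv[OF node_ball[OF assms]]] by (simp add: o_def force_def)
qed

lemma q_exact:
  assumes "\<bar>h\<bar> \<le> h0" "\<tau> \<in> {0..1}"
  shows "q (t0 + \<tau> * h) = q t0 + (h * \<tau>) *\<^sub>R v t0 + h^2 *\<^sub>R integral {0..1} (\<lambda>\<sigma>. max 0 (\<tau> - \<sigma>) *\<^sub>R force (\<sigma> * h))"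
proof -
  have d: "((\<lambda>s. h *\<^sub>R v (t0 + s * h)) has_vector_derivative h *\<^sub>R (h *\<^sub>R force (s * h))) (at s)" if "s \<in> {0..1}" for s
    by (rule bounded_linear.has_vector_derivative[OF bounded_linear_scaleR_right q_node_deriv(2)[OF assms(1) that]])
  from taylor_kernel_integral[OF assms(2) q_node_deriv(1)[OF assms(1)] d]
  have 1: "((\<lambda>\<sigma>. max 0 (\<tau> - \<sigma>) *\<^sub>R h *\<^sub>R h *\<^sub>R force (\<sigma> * h)) has_integral q (t0 + \<tau> * h) - q t0 - \<tau> *\<^sub>R h *\<^sub>R v t0) {0..1}"
    by simp
  have 2: "((\<lambda>\<sigma>. h^2 *\<^sub>R (max 0 (\<tau> - \<sigma>) *\<^sub>R force (\<sigma> * h))) has_integral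
     h^2 *\<^sub>R integral {0..1} (\<lambda>\<sigma>. max 0 (\<tau> - \<sigma>) *\<^sub>R force (\<sigma> * h))) {0..1}"
    by (intro has_integral_cmul integrable_integral integrable_continuous_real continuous_intros continuous_force assms)
  have 3: "(\<lambda>\<sigma>. max 0 (\<tau> - \<sigma>) *\<^sub>R h *\<^sub>R h *\<^sub>R force (\<sigma> * h)) = (\<lambda>\<sigma>. h^2 *\<^sub>R (max 0 (\<tau> - \<sigma>) *\<^sub>R force (\<sigma> * h)))"
    by (auto simp: power2_eq_square mult_ac)
  have "q (t0 + \<tau> * h) - q t0 - \<tau> *\<^sub>R h *\<^sub>R v t0 = h^2 *\<^sub>R integral {0..1} (\<lambda>\<sigma>. max 0 (\<tau> - \<sigma>) *\<^sub>R force (\<sigma> * h))"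
    by (rule has_integral_unique[OF 1[unfolded 3] 2])
  moreover have "x = y + z + w" if "x - y - z = w" for x y z w :: 'a
    using that by auto
  ultimately show ?thesis by (simp only: scaleR_scaleR mult.commute[of \<tau> h])
qed

lemma v_exact:
  assumes "\<bar>h\<bar> \<le> h0"
  shows "v (t0 + h) = v t0 + h *\<^sub>R integral {0..1} (\<lambda>\<sigma>. force (\<sigma> * h))"
proof -
  have 1: "((\<lambda>\<sigma>. h *\<^sub>R force (\<sigma> * h)) has_integral v (t0 + 1 * h) - v (t0 + 0 * h)) {0..1}"
    by (rule fundamental_theorem_of_calculus[of 0 1 "\<lambda>s. v (t0 + s * h)"])
       (simp, rule has_vector_derivative_at_within[OF q_node_deriv(2)[OF assms]])
  have 2: "((\<lambda>\<sigma>. h *\<^sub>R force (\<sigma> * h)) has_integral h *\<^sub>R integral {0..1} (\<lambda>\<sigma>. force (\<sigma> * h))) {0..1}"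
    by (intro has_integral_cmul integrable_integral integrable_continuous_real continuous_force assms)
  show ?thesis using has_integral_unique[OF 1 2] by (simp add: diff_eq_eq add.commute)
qed

lemma err_eq:
  assumes "admissible h Q" "\<tau> \<in> {0..1}"
  shows "err h Q \<tau> = h^2 *\<^sub>R integral {0..1} (\<lambda>\<sigma>. A \<tau> \<sigma> *\<^sub>R force_err h Q \<sigma>)
     + h^2 *\<^sub>R integral {0..1} (\<lambda>\<sigma>. defect \<tau> \<sigma> *\<^sub>R force (\<sigma> * h))"
proof -
  have h: "\<bar>h\<bar> \<le> h0" using assms(1) by (simp add: admissible_def)
  have Q: "Q \<tau> = q t0 + (h * \<tau>) *\<^sub>R v t0 + h^2 *\<^sub>R integral {0..1} (\<lambda>\<sigma>. A \<tau> \<sigma> *\<^sub>R f (t0 + \<sigma> * h, Q \<sigma>))"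
    using assms by (simp add: admissible_def)
  have i: "(\<lambda>\<sigma>. A \<tau> \<sigma> *\<^sub>R force_err h Q \<sigma>) integrable_on {0..1}" "(\<lambda>\<sigma>. defect \<tau> \<sigma> *\<^sub>R force (\<sigma> * h)) integrable_on {0..1}"
    "(\<lambda>\<sigma>. max 0 (\<tau> - \<sigma>) *\<^sub>R force (\<sigma> * h)) integrable_on {0..1}"
    by (intro integrable_continuous_real continuous_intros continuous_A_row continuous_defect_row continuous_force
        continuous_force_err assms h)+
  \<comment> \<open>The kernel is split into defect and Taylor kernel only on the exact force; the
    force error keeps the full kernel.\<close>
  have "(\<lambda>\<sigma>. A \<tau> \<sigma> *\<^sub>R f (t0 + \<sigma> * h, Q \<sigma>)) = (\<lambda>\<sigma>. A \<tau> \<sigma> *\<^sub>R force_err h Q \<sigma> + defect \<tau> \<sigma> *\<^sub>R force (\<sigma> * h)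
      + max 0 (\<tau> - \<sigma>) *\<^sub>R force (\<sigma> * h))"
    by (auto simp: force_err_def defect_def algebra_simps)
  then have "integral {0..1} (\<lambda>\<sigma>. A \<tau> \<sigma> *\<^sub>R f (t0 + \<sigma> * h, Q \<sigma>)) = integral {0..1} (\<lambda>\<sigma>. A \<tau> \<sigma> *\<^sub>R force_err h Q \<sigma>)
    + integral {0..1} (\<lambda>\<sigma>. defect \<tau> \<sigma> *\<^sub>R force (\<sigma> * h)) + integral {0..1} (\<lambda>\<sigma>. max 0 (\<tau> - \<sigma>) *\<^sub>R force (\<sigma> * h))"
    by (simp add: integral_add integrable_add i)
  then show ?thesis
    unfolding err_def Q q_exact[OF h assms(2)] by (simp add: scaleR_add_right)
qed

lemma force_taylor: "\<exists>c K. \<forall>s. \<bar>s\<bar> \<le> h0 \<longrightarrow> norm (force s - (\<Sum>i<k. s ^ i *\<^sub>R c i)) \<le> K * \<bar>s\<bar> ^ k"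
proof -
  have "Ck k (ball t0 \<delta>) (\<lambda>t. f (t, q t))"
    using Ck_along_solution[of f "ball t0 \<delta>" q v k] f q_deriv v_deriv by auto
  from Ck_taylor[OF this h0(3)] show ?thesis unfolding force_def by simp
qed

lemma force_deriv_taylor: "\<exists>c K. \<forall>s. \<bar>s\<bar> \<le> h0 \<longrightarrow> norm (force_deriv b s - (\<Sum>i<k. s ^ i *\<^sub>R c i)) \<le> K * \<bar>s\<bar> ^ k"
proof -
  have "Ck k (ball t0 \<delta>) (\<lambda>t. space_deriv f b (t, q t))"
    using Ck_along_solution[of f "ball t0 \<delta>" q v k] f q_deriv v_deriv smooth_space_deriv[OF f] by auto
  from Ck_taylor[OF this h0(3)] show ?thesis unfolding force_deriv_def by simp
qed

lemma bigO_node_taylor: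
  assumes "\<And>s. \<bar>s\<bar> \<le> h0 \<Longrightarrow> norm (\<phi> s - P s) \<le> K * \<bar>s\<bar> ^ k"
  shows "bigO k (\<lambda>h Q \<tau>. \<phi> (\<tau> * h) - P (\<tau> * h))"
proof (rule bigOI)
  fix h Q \<tau> assume *: "admissible h Q" "\<tau> \<in> {0..1::real}"
  have "norm (\<phi> (\<tau> * h) - P (\<tau> * h)) \<le> K * \<bar>\<tau> * h\<bar> ^ k"
    by (rule assms[OF node_range[OF admissible_h(1)[OF *(1)] *(2)]])
  also have "\<dots> \<le> \<bar>K\<bar> * \<bar>h\<bar> ^ k"
    using *(2) by (intro mult_mono power_mono) (auto simp: abs_mult intro: mult_left_le_one_le)
  finally show "norm (\<phi> (\<tau> * h) - P (\<tau> * h)) \<le> \<bar>K\<bar> * \<bar>h\<bar> ^ k" .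
qed simp

lemma force_deriv_expansion: "\<exists>c. \<forall>b. bigO k (\<lambda>h Q \<tau>. force_deriv b (\<tau> * h) - (\<Sum>i<k. (\<tau> * h) ^ i *\<^sub>R c b i))"
proof -
  have "\<exists>c. bigO k (\<lambda>h Q \<tau>. force_deriv b (\<tau> * h) - (\<Sum>i<k. (\<tau> * h) ^ i *\<^sub>R c i))" for b
  proof -
    obtain c K where c: "\<And>s. \<bar>s\<bar> \<le> h0 \<Longrightarrow> norm (force_deriv b s - (\<Sum>i<k. s ^ i *\<^sub>R c i)) \<le> K * \<bar>s\<bar> ^ k"
      using force_deriv_taylor[of b k] by blast
    show ?thesis
      by (rule exI[of _ c], rule bigO_node_taylor[of "force_deriv b" "\<lambda>s. \<Sum>i<k. s ^ i *\<^sub>R c i", OF c])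
  qed
  then show ?thesis by (rule choice[OF allI])
qed

text \<open>Integrating the Taylor polynomial of the force against the defect turns its monomials
  into the functions \<open>row i\<close>. The feedback term stays implicit and is resolved later by
  iteration.\<close>

lemma err_expansion:
  "\<exists>c. bigO (k + 2) (\<lambda>h Q \<tau>. err h Q \<tau> - (h^2 *\<^sub>R integral {0..1} (\<lambda>\<sigma>. A \<tau> \<sigma> *\<^sub>R force_err h Q \<sigma>)
     + (\<Sum>i<k. (h ^ (i + 2) * row i \<tau>) *\<^sub>R c i)))"
proof -
  obtain c K where c: "\<And>s. \<bar>s\<bar> \<le> h0 \<Longrightarrow> norm (force s - (\<Sum>i<k. s ^ i *\<^sub>R c i)) \<le> K * \<bar>s\<bar> ^ k"
    using force_taylor[of k] by blast
  have "bigO k (\<lambda>h Q \<tau>. force (\<tau> * h) - (\<Sum>i<k. (\<tau> * h) ^ i *\<^sub>R c i))"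
    by (rule bigO_node_taylor[of force "\<lambda>s. \<Sum>i<k. s ^ i *\<^sub>R c i", OF c])
  then obtain L where L: "L \<ge> 0" "\<And>h Q \<tau>. admissible h Q \<Longrightarrow> \<tau> \<in> {0..1} \<Longrightarrow>
      norm (force (\<tau> * h) - (\<Sum>i<k. (\<tau> * h) ^ i *\<^sub>R c i)) \<le> L * \<bar>h\<bar> ^ k"
    by (rule bigOE) (rule that)
  obtain M where M: "M \<ge> 0" "\<And>\<tau> \<sigma>. \<tau> \<in> {0..1} \<Longrightarrow> \<sigma> \<in> {0..1} \<Longrightarrow> \<bar>defect \<tau> \<sigma>\<bar> \<le> M"
    by (rule defect_bound) (rule that)
  have "bigO (k + 2) (\<lambda>h Q \<tau>. err h Q \<tau> - (h^2 *\<^sub>R integral {0..1} (\<lambda>\<sigma>. A \<tau> \<sigma> *\<^sub>R force_err h Q \<sigma>)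
     + (\<Sum>i<k. (h ^ (i + 2) * row i \<tau>) *\<^sub>R c i)))"
  proof (rule bigOI)
    fix h Q \<tau> assume *: "admissible h Q" "\<tau> \<in> {0..1::real}"
    have h: "\<bar>h\<bar> \<le> h0" using * by (simp add: admissible_def)
    let ?R = "\<lambda>\<sigma>. force (\<sigma> * h) - (\<Sum>i<k. (\<sigma> * h) ^ i *\<^sub>R c i)"
    have cR: "continuous_on {0..1} (\<lambda>\<sigma>. defect \<tau> \<sigma> *\<^sub>R ?R \<sigma>)"
      by (intro continuous_intros continuous_defect_row continuous_force * h)
    have "((\<lambda>\<sigma>. \<Sum>i<k. (h ^ i * (defect \<tau> \<sigma> * \<sigma> ^ i)) *\<^sub>R c i) has_integral (\<Sum>i<k. (h ^ i * row i \<tau>) *\<^sub>R c i)) {0..1}"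
      by (intro has_integral_sum has_integral_scaleR_left has_integral_mult_right row_has_integral *) auto
    then have "((\<lambda>\<sigma>. defect \<tau> \<sigma> *\<^sub>R ?R \<sigma> + (\<Sum>i<k. (h ^ i * (defect \<tau> \<sigma> * \<sigma> ^ i)) *\<^sub>R c i)) has_integral
       integral {0..1} (\<lambda>\<sigma>. defect \<tau> \<sigma> *\<^sub>R ?R \<sigma>) + (\<Sum>i<k. (h ^ i * row i \<tau>) *\<^sub>R c i)) {0..1}"
      by (intro has_integral_add integrable_integral integrable_continuous_real cR)
    moreover have "defect \<tau> \<sigma> *\<^sub>R ?R \<sigma> + (\<Sum>i<k. (h ^ i * (defect \<tau> \<sigma> * \<sigma> ^ i)) *\<^sub>R c i) = defect \<tau> \<sigma> *\<^sub>R force (\<sigma> * h)" for \<sigma>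
      by (simp add: scaleR_diff_right scaleR_sum_right power_mult_distrib mult_ac)
    ultimately have "integral {0..1} (\<lambda>\<sigma>. defect \<tau> \<sigma> *\<^sub>R force (\<sigma> * h))
        = integral {0..1} (\<lambda>\<sigma>. defect \<tau> \<sigma> *\<^sub>R ?R \<sigma>) + (\<Sum>i<k. (h ^ i * row i \<tau>) *\<^sub>R c i)"
      by (simp add: has_integral_iff)
    moreover have "h^2 *\<^sub>R (\<Sum>i<k. (h ^ i * row i \<tau>) *\<^sub>R c i) = (\<Sum>i<k. (h ^ (i + 2) * row i \<tau>) *\<^sub>R c i)"
      by (simp add: scaleR_sum_right power_add power2_eq_square mult_ac)
    ultimately have "err h Q \<tau> - (h^2 *\<^sub>R integral {0..1} (\<lambda>\<sigma>. A \<tau> \<sigma> *\<^sub>R force_err h Q \<sigma>)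
        + (\<Sum>i<k. (h ^ (i + 2) * row i \<tau>) *\<^sub>R c i)) = h^2 *\<^sub>R integral {0..1} (\<lambda>\<sigma>. defect \<tau> \<sigma> *\<^sub>R ?R \<sigma>)"
      unfolding err_eq[OF *] by (simp add: scaleR_add_right)
    moreover have "norm (integral {0..1} (\<lambda>\<sigma>. defect \<tau> \<sigma> *\<^sub>R ?R \<sigma>)) \<le> (M * (L * \<bar>h\<bar> ^ k)) * (1 - 0)"
    proof (rule integral_bound[OF _ cR])
      fix \<sigma> :: real assume "\<sigma> \<in> {0..1}"
      then show "norm (defect \<tau> \<sigma> *\<^sub>R ?R \<sigma>) \<le> M * (L * \<bar>h\<bar> ^ k)"
        unfolding norm_scaleR using * M(1) by (intro mult_mono M L) auto
    qed simp
    then have "\<bar>h\<bar> ^ 2 * norm (integral {0..1} (\<lambda>\<sigma>. defect \<tau> \<sigma> *\<^sub>R ?R \<sigma>)) \<le> \<bar>h\<bar> ^ 2 * ((M * (L * \<bar>h\<bar> ^ k)) * (1 - 0))"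
      by (rule mult_left_mono) simp
    then have "\<bar>h\<bar> ^ 2 * norm (integral {0..1} (\<lambda>\<sigma>. defect \<tau> \<sigma> *\<^sub>R ?R \<sigma>)) \<le> (M * L) * \<bar>h\<bar> ^ (k + 2)"
      by (simp only: power_add mult_ac diff_zero mult_1_left)
    ultimately show "norm (err h Q \<tau> - (h^2 *\<^sub>R integral {0..1} (\<lambda>\<sigma>. A \<tau> \<sigma> *\<^sub>R force_err h Q \<sigma>)
        + (\<Sum>i<k. (h ^ (i + 2) * row i \<tau>) *\<^sub>R c i))) \<le> (M * L) * \<bar>h\<bar> ^ (k + 2)"
      by (simp only: norm_scaleR power_abs abs_power2)
  qed (use L M in simp)
  then show ?thesis by blast
qed

section \<open>Linearizing the force along the exact solution\<close>

lemma stage_domain: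
  assumes "admissible h Q" "\<tau> \<in> {0..1}"
  shows "t0 + \<tau> * h \<in> cball t0 h0" "Q \<tau> \<in> cball (q t0) 1" "q (t0 + \<tau> * h) \<in> cball (q t0) 1"
proof -
  have h: "\<bar>\<tau> * h\<bar> \<le> h0" by (rule node_range[OF admissible_h(1)[OF assms(1)] assms(2)])
  then show "t0 + \<tau> * h \<in> cball t0 h0" by (simp add: dist_norm)
  show "q (t0 + \<tau> * h) \<in> cball (q t0) 1" using near[OF h] by (simp add: dist_commute)
  have "dist (Q \<tau>) (q t0) \<le> 1" using assms unfolding admissible_def by blast
  then show "Q \<tau> \<in> cball (q t0) 1" by (simp add: dist_commute)
qed

lemma force_err_bigO:
  assumes "bigO n err"
  shows "bigO n force_err"
proof -
  obtain K where K: "K \<ge> 0" "\<And>h Q \<tau>. admissible h Q \<Longrightarrow> \<tau> \<in> {0..1} \<Longrightarrow> norm (err h Q \<tau>) \<le> K * \<bar>h\<bar> ^ n"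
    using assms by (rule bigOE) (rule that)
  obtain L where L: "L \<ge> 0" "\<forall>t\<in>cball t0 h0. \<forall>x\<in>cball (q t0) 1. \<forall>y\<in>cball (q t0) 1. norm (f (t, x) - f (t, y)) \<le> L * norm (x - y)"
    using smooth_lipschitz[OF f compact_cball[of t0 h0] compact_cball[of "q t0" 1] convex_cball] by blast
  show ?thesis
  proof (rule bigOI)
    fix h Q \<tau> assume *: "admissible h Q" "\<tau> \<in> {0..1::real}"
    have "norm (force_err h Q \<tau>) \<le> L * norm (err h Q \<tau>)"
      unfolding force_err_def force_def err_def by (rule L(2)[rule_format, OF stage_domain[OF *]])
    also have "\<dots> \<le> L * (K * \<bar>h\<bar> ^ n)" by (intro mult_left_mono K * L)
    finally show "norm (force_err h Q \<tau>) \<le> (L * K) * \<bar>h\<bar> ^ n" by (simp add: mult.assoc)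
  qed (use K L in simp)
qed

lemma force_err_linearization:
  assumes "bigO n err"
  shows "bigO (2 * n) (\<lambda>h Q \<tau>. force_err h Q \<tau> - contract (err h Q \<tau>) (\<lambda>b. force_deriv b (\<tau> * h)))"
proof -
  obtain K where K: "K \<ge> 0" "\<And>h Q \<tau>. admissible h Q \<Longrightarrow> \<tau> \<in> {0..1} \<Longrightarrow> norm (err h Q \<tau>) \<le> K * \<bar>h\<bar> ^ n"
    using assms by (rule bigOE) (rule that)
  obtain L where L: "L \<ge> 0" "\<forall>t\<in>cball t0 h0. \<forall>x\<in>cball (q t0) 1. \<forall>y\<in>cball (q t0) 1.
      norm (f (t, x) - f (t, y) - (\<Sum>b\<in>Basis. ((x - y) \<bullet> b) *\<^sub>R space_deriv f b (t, y))) \<le> L * norm (x - y) ^ 2"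
    using smooth_quadratic_remainder[OF f compact_cball[of t0 h0] compact_cball[of "q t0" 1] convex_cball] by blast
  show ?thesis
  proof (rule bigOI)
    fix h Q \<tau> assume *: "admissible h Q" "\<tau> \<in> {0..1::real}"
    have "norm (force_err h Q \<tau> - contract (err h Q \<tau>) (\<lambda>b. force_deriv b (\<tau> * h))) \<le> L * norm (err h Q \<tau>) ^ 2"
      unfolding force_err_def force_def err_def contract_def force_deriv_def by (rule L(2)[rule_format, OF stage_domain[OF *]])
    also have "\<dots> \<le> L * (K * \<bar>h\<bar> ^ n) ^ 2" by (intro mult_left_mono power_mono K * L) auto
    finally show "norm (force_err h Q \<tau> - contract (err h Q \<tau>) (\<lambda>b. force_deriv b (\<tau> * h))) \<le> (L * K^2) * \<bar>h\<bar> ^ (2 * n)"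
      by (simp add: power_mult_distrib mult.assoc power_mult mult.commute[of 2 n])
  qed (use K L in simp)
qed

text \<open>Replaces both factors of the linearized force error by truncated expansions. The three
  losses are the quadratic remainder (order 2n), the truncation of \<open>err\<close> (order p) and
  the truncation of the derivative times \<open>X\<close> (order n + k).\<close>

lemma force_err_product:
  assumes "bigO n err" "bigO p (\<lambda>h Q \<tau>. err h Q \<tau> - X h Q \<tau>)" "bigO n X"
    and "\<And>b. bigO k (\<lambda>h Q \<tau>. force_deriv b (\<tau> * h) - Y b h Q \<tau>)" "p \<le> n + k" "p \<le> 2 * n"
  shows "bigO p (\<lambda>h Q \<tau>. force_err h Q \<tau> - contract (X h Q \<tau>) (\<lambda>b. Y b h Q \<tau>))"
proof -
  \<comment> \<open>An expansion with no terms is boundedness.\<close>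
  have d: "bigO 0 (\<lambda>h Q \<tau>. force_deriv b (\<tau> * h))" for b
    using force_deriv_expansion[of 0] by simp
  have 1: "bigO p (\<lambda>h Q \<tau>. force_err h Q \<tau> - contract (err h Q \<tau>) (\<lambda>b. force_deriv b (\<tau> * h)))"
    by (rule bigO_mono[OF force_err_linearization[OF assms(1)] assms(6)])
  have 2: "bigO (p + 0) (\<lambda>h Q \<tau>. contract (err h Q \<tau> - X h Q \<tau>) (\<lambda>b. force_deriv b (\<tau> * h)))"
    by (rule bigO_contract[OF assms(2) d])
  have 3: "bigO p (\<lambda>h Q \<tau>. contract (X h Q \<tau>) (\<lambda>b. force_deriv b (\<tau> * h) - Y b h Q \<tau>))"
    by (rule bigO_mono[OF bigO_contract[OF assms(3,4)] assms(5)])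
  from bigO_add[OF bigO_add[OF 1 2[simplified]] 3] show ?thesis
    by (rule bigO_cong) (simp add: contract_diff_left contract_diff_right)
qed

text \<open>Start of the iteration: numerical and exact stages share a ball of radius 1, so their
  distance is at most 2. The stage equation then gains h^2.\<close>

lemma err_bigO_2: "bigO 2 err"
proof -
  have "bigO 0 err"
  proof (rule bigOI)
    show "norm (err h Q \<tau>) \<le> 2 * \<bar>h\<bar> ^ 0" if "admissible h Q" "\<tau> \<in> {0..1}" for h Q \<tau>
      using dist_triangle2[of "Q \<tau>" "q (t0 + \<tau> * h)" "q t0"] stage_domain[OF that]
      by (simp add: err_def dist_norm norm_minus_commute)
  qed simp
  from bigO_A_integral[OF force_err_bigO[OF this] continuous_force_err]
  have "bigO (2 + 0) (\<lambda>h Q \<tau>. h^2 *\<^sub>R integral {0..1} (\<lambda>\<sigma>. A \<tau> \<sigma> *\<^sub>R force_err h Q \<sigma>))"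
    by (rule bigO_scaleR[OF bigO_power])
  moreover have "bigO 2 (\<lambda>h Q \<tau>. err h Q \<tau> - h^2 *\<^sub>R integral {0..1} (\<lambda>\<sigma>. A \<tau> \<sigma> *\<^sub>R force_err h Q \<sigma>))"
    using err_expansion[of 0] by (simp add: numeral_2_eq_2)
  ultimately show ?thesis
    using bigO_add[of 2 "\<lambda>h Q \<tau>. h^2 *\<^sub>R integral {0..1} (\<lambda>\<sigma>. A \<tau> \<sigma> *\<^sub>R force_err h Q \<sigma>)"
      "\<lambda>h Q \<tau>. err h Q \<tau> - h^2 *\<^sub>R integral {0..1} (\<lambda>\<sigma>. A \<tau> \<sigma> *\<^sub>R force_err h Q \<sigma>)"] by simp
qed

lemma err_step:
  assumes "bigO n err"
  shows "bigO (n + 2) (\<lambda>h Q \<tau>. h^2 *\<^sub>R integral {0..1} (\<lambda>\<sigma>. A \<tau> \<sigma> *\<^sub>R force_err h Q \<sigma>))"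
  using bigO_scaleR[OF bigO_power bigO_A_integral[OF force_err_bigO[OF assms] continuous_force_err], of 2]
  by (simp add: add.commute)

end

text \<open>Every term of an expansion is a real function times a fixed vector, so its weighted
  integral vanishes as soon as a real moment does.\<close>

lemma has_integral_weighted_term:
  fixes c :: "'b::real_normed_vector"
  assumes "((\<lambda>\<tau>. w \<tau> * m \<tau> :: real) has_integral 0) S"
  shows "((\<lambda>\<tau>. w \<tau> *\<^sub>R ((x * m \<tau>) *\<^sub>R c)) has_integral 0) S"
  using has_integral_scaleR_left[OF has_integral_mult_right[OF assms, of x], of c]
  by (simp add: mult_ac)

lemma has_integral_weighted_add:
  fixes F G :: "real \<Rightarrow> 'b::real_normed_vector"
  assumes "((\<lambda>\<tau>. w \<tau> *\<^sub>R F \<tau>) has_integral 0) S" "((\<lambda>\<tau>. w \<tau> *\<^sub>R G \<tau>) has_integral 0) S"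
  shows "((\<lambda>\<tau>. w \<tau> *\<^sub>R (F \<tau> + G \<tau>)) has_integral 0) S"
  using has_integral_add[OF assms] by (simp add: scaleR_add_right)

section \<open>Orders 2, 4 and 6 from vanishing moments\<close>

context rkn_problem
begin

text \<open>The explicit part \<open>T\<close> integrates to zero against the weight, so only the
  remainder contributes.\<close>

lemma weighted_integral_bound:
  assumes R: "bigO p (\<lambda>h Q \<tau>. force_err h Q \<tau> - T h \<tau>)"
    and T: "\<And>h. continuous_on {0..1} (T h)" "\<And>h. ((\<lambda>\<tau>. w \<tau> *\<^sub>R T h \<tau>) has_integral 0) {0..1}"
    and w: "continuous_on {0..1} w" "\<And>\<tau>. \<tau> \<in> {0..1} \<Longrightarrow> \<bar>w \<tau>\<bar> \<le> 1"
  shows "\<exists>K. \<forall>h Q. admissible h Q \<longrightarrow> norm (integral {0..1} (\<lambda>\<tau>. w \<tau> *\<^sub>R force_err h Q \<tau>)) \<le> K * \<bar>h\<bar> ^ p"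
proof -
  obtain K where K: "K \<ge> 0" "\<And>h Q \<tau>. admissible h Q \<Longrightarrow> \<tau> \<in> {0..1} \<Longrightarrow> norm (force_err h Q \<tau> - T h \<tau>) \<le> K * \<bar>h\<bar> ^ p"
    using R by (rule bigOE) (rule that)
  have "norm (integral {0..1} (\<lambda>\<tau>. w \<tau> *\<^sub>R force_err h Q \<tau>)) \<le> K * \<bar>h\<bar> ^ p" if a: "admissible h Q" for h Q
  proof -
    have c: "continuous_on {0..1} (\<lambda>\<tau>. w \<tau> *\<^sub>R (force_err h Q \<tau> - T h \<tau>))"
      by (intro continuous_on_scaleR continuous_on_diff continuous_force_err a w T)
    from has_integral_add[OF integrable_integral[OF integrable_continuous_real[OF c]] T(2)[of h]]
    have "((\<lambda>\<tau>. w \<tau> *\<^sub>R force_err h Q \<tau>) has_integral integral {0..1} (\<lambda>\<tau>. w \<tau> *\<^sub>R (force_err h Q \<tau> - T h \<tau>))) {0..1}"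
      by (simp flip: scaleR_add_right)
    then have "integral {0..1} (\<lambda>\<tau>. w \<tau> *\<^sub>R force_err h Q \<tau>) = integral {0..1} (\<lambda>\<tau>. w \<tau> *\<^sub>R (force_err h Q \<tau> - T h \<tau>))"
      by (rule integral_unique)
    also have "norm \<dots> \<le> (1 * (K * \<bar>h\<bar> ^ p)) * (1 - 0)"
    proof (rule integral_bound[OF _ c])
      fix \<tau> :: real assume "\<tau> \<in> {0..1}"
      then show "norm (w \<tau> *\<^sub>R (force_err h Q \<tau> - T h \<tau>)) \<le> 1 * (K * \<bar>h\<bar> ^ p)"
        unfolding norm_scaleR using a by (intro mult_mono w K) auto
    qed simp
    finally show ?thesis by simp
  qed
  then show ?thesis by blast
qed

text \<open>The error of q' carries a prefactor h and that of q a prefactor h^2, which turns the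
  exponents p and p - 1 into p + 1 for both. The factor 1 keeps the two integrals in one weighted
  form.\<close>

definition convergent_order :: "nat \<Rightarrow> bool" where
  "convergent_order p \<longleftrightarrow>
    (\<exists>K. \<forall>h Q. admissible h Q \<longrightarrow> norm (integral {0..1} (\<lambda>\<tau>. 1 *\<^sub>R force_err h Q \<tau>)) \<le> K * \<bar>h\<bar> ^ p) \<and>
    (\<exists>K. \<forall>h Q. admissible h Q \<longrightarrow> norm (integral {0..1} (\<lambda>\<tau>. (1 - \<tau>) *\<^sub>R force_err h Q \<tau>)) \<le> K * \<bar>h\<bar> ^ (p - 1))"

lemma convergent_orderI:
  assumes "bigO p (\<lambda>h Q \<tau>. force_err h Q \<tau> - T h \<tau>)" "bigO (p - 1) (\<lambda>h Q \<tau>. force_err h Q \<tau> - T' h \<tau>)"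
    and "\<And>h. continuous_on {0..1} (T h)" "\<And>h. ((\<lambda>\<tau>. 1 *\<^sub>R T h \<tau>) has_integral 0) {0..1}"
    and "\<And>h. continuous_on {0..1} (T' h)" "\<And>h. ((\<lambda>\<tau>. (1 - \<tau>) *\<^sub>R T' h \<tau>) has_integral 0) {0..1}"
  shows "convergent_order p"
  unfolding convergent_order_def
  by (intro conjI weighted_integral_bound[OF assms(1) assms(3,4)] weighted_integral_bound[OF assms(2) assms(5,6)])
     (auto intro!: continuous_intros)

lemma convergent_order_2: "convergent_order 2"
proof (rule convergent_orderI)
  have f2: "bigO 2 (\<lambda>h Q \<tau>. force_err h Q \<tau> - 0)"
    using force_err_bigO[OF err_bigO_2] by simp
  show "bigO 2 (\<lambda>h Q \<tau>. force_err h Q \<tau> - (\<lambda>h \<tau>. 0) h \<tau>)" using f2 by simp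
  show "bigO (2 - 1) (\<lambda>h Q \<tau>. force_err h Q \<tau> - (\<lambda>h \<tau>. 0) h \<tau>)" using bigO_mono[OF f2, of 1] by simp
qed simp_all

text \<open>The feedback term is already O(h^4), so below that order \<open>err\<close> consists of
  its row 0 and row 1 terms. Multiplied by the derivative, they leave the weights row 0, row 1 and
  \<tau> row 0, whose integrals vanish.\<close>

lemma convergent_order_4:
  assumes m: "moment 0 0 = 0"
  shows "convergent_order 4"
proof -
  obtain c where c: "bigO (2 + 2) (\<lambda>h Q \<tau>. err h Q \<tau> - (h^2 *\<^sub>R integral {0..1} (\<lambda>\<sigma>. A \<tau> \<sigma> *\<^sub>R force_err h Q \<sigma>)
     + (\<Sum>i<2. (h ^ (i + 2) * row i \<tau>) *\<^sub>R c i)))"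
    using err_expansion[of 2] by blast
  obtain d where d: "\<And>b. bigO 2 (\<lambda>h Q \<tau>. force_deriv b (\<tau> * h) - (\<Sum>i<2. (\<tau> * h) ^ i *\<^sub>R d b i))"
    using force_deriv_expansion[of 2] by blast
  define X where "X h \<tau> = (h^2 * row 0 \<tau>) *\<^sub>R c 0 + (h^3 * row 1 \<tau>) *\<^sub>R c 1" for h \<tau>
  define Y where "Y b h \<tau> = d b 0 + (\<tau> * h) *\<^sub>R d b 1" for b h \<tau>
  have s2: "(\<Sum>i<2. F i) = F 0 + F 1" for F :: "nat \<Rightarrow> 'a"
    by (simp add: eval_nat_numeral)
  have eX: "bigO 4 (\<lambda>h Q \<tau>. err h Q \<tau> - X h \<tau>)"
  proof (rule bigO_cong)
    show "bigO 4 (\<lambda>h Q \<tau>. err h Q \<tau> - (h^2 *\<^sub>R integral {0..1} (\<lambda>\<sigma>. A \<tau> \<sigma> *\<^sub>R force_err h Q \<sigma>)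
     + (\<Sum>i<2. (h ^ (i + 2) * row i \<tau>) *\<^sub>R c i)) + h^2 *\<^sub>R integral {0..1} (\<lambda>\<sigma>. A \<tau> \<sigma> *\<^sub>R force_err h Q \<sigma>))"
      using bigO_add[OF c err_step[OF err_bigO_2]] by simp
  qed (simp add: X_def s2 eval_nat_numeral)
  have bX: "bigO 2 (\<lambda>h Q \<tau>. X h \<tau>)"
    unfolding X_def by (intro bigO_add bigO_term continuous_row) auto
  have bY: "bigO 2 (\<lambda>h Q \<tau>. force_deriv b (\<tau> * h) - Y b h \<tau>)" for b
    using d[of b] by (simp add: Y_def numeral_2_eq_2)
  have P: "bigO 4 (\<lambda>h Q \<tau>. force_err h Q \<tau> - contract (X h \<tau>) (\<lambda>b. Y b h \<tau>))"
    by (rule force_err_product[OF err_bigO_2 eX bX bY]) auto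
  \<comment> \<open>\<open>a i j\<close> is the coefficient of \<tau>^j \<open>row i\<close> at
    order h^(i + j + 2); \<open>T\<close> collects the terms of order below 4.\<close>
  define a where "a i j = contract (c i) (\<lambda>b. d b j)" for i j
  define T where "T h \<tau> = (h^2 * row 0 \<tau>) *\<^sub>R a 0 0 + (h^3 * row 1 \<tau>) *\<^sub>R a 1 0 + (h^3 * (\<tau> * row 0 \<tau>)) *\<^sub>R a 0 1" for h \<tau>
  have XY: "contract (X h \<tau>) (\<lambda>b. Y b h \<tau>) = T h \<tau> + (h^4 * (\<tau> * row 1 \<tau>)) *\<^sub>R a 1 1" for h \<tau>
    by (simp add: X_def Y_def T_def a_def contract_bilinear scaleR_add_right eval_nat_numeral mult_ac add_ac)
  have b4: "bigO 4 (\<lambda>h Q \<tau>. (h^4 * (\<tau> * row 1 \<tau>)) *\<^sub>R a 1 1)"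
    by (intro bigO_term continuous_intros continuous_row) auto
  have R4: "bigO 4 (\<lambda>h Q \<tau>. force_err h Q \<tau> - T h \<tau>)"
    using bigO_add[OF P b4] by (simp add: XY)
  have b3: "bigO 3 (\<lambda>h Q \<tau>. (h^3 * row 1 \<tau>) *\<^sub>R a 1 0 + (h^3 * (\<tau> * row 0 \<tau>)) *\<^sub>R a 0 1)"
    by (intro bigO_add bigO_term continuous_intros continuous_row) auto
  have R3: "bigO 3 (\<lambda>h Q \<tau>. force_err h Q \<tau> - (h^2 * row 0 \<tau>) *\<^sub>R a 0 0)"
    using bigO_add[OF bigO_mono[OF R4, of 3] b3] by (simp add: T_def add.assoc)
  have i0: "((\<lambda>\<tau>. \<tau> ^ 0 * row 0 \<tau>) has_integral 0) {0..1}" "((\<lambda>\<tau>. \<tau> ^ 0 * row 1 \<tau>) has_integral 0) {0..1}"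
    "((\<lambda>\<tau>. \<tau> ^ 1 * row 0 \<tau>) has_integral 0) {0..1}"
    using moment_has_integral[of 0 0] moment_has_integral[of 0 1] moment_has_integral[of 1 0] m moments_order_4[OF m]
    by simp_all
  show ?thesis
  proof (rule convergent_orderI)
    show "bigO 4 (\<lambda>h Q \<tau>. force_err h Q \<tau> - T h \<tau>)" by (rule R4)
    show "bigO (4 - 1) (\<lambda>h Q \<tau>. force_err h Q \<tau> - (h^2 * row 0 \<tau>) *\<^sub>R a 0 0)" using R3 by simp
    show "continuous_on {0..1} (T h)" for h
      unfolding T_def[abs_def] by (intro continuous_intros continuous_row)
    show "continuous_on {0..1} (\<lambda>\<tau>. (h^2 * row 0 \<tau>) *\<^sub>R a 0 0)" for h
      by (intro continuous_intros continuous_row)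
    show "((\<lambda>\<tau>. 1 *\<^sub>R T h \<tau>) has_integral 0) {0..1}" for h
      unfolding T_def by (intro has_integral_weighted_add has_integral_weighted_term) (use i0 in simp_all)
    \<comment> \<open>The weighted integral is \<open>moment 0 0\<close> minus
      \<open>moment 1 0\<close>.\<close>
    show "((\<lambda>\<tau>. (1 - \<tau>) *\<^sub>R ((h^2 * row 0 \<tau>) *\<^sub>R a 0 0)) has_integral 0) {0..1}" for h
      by (intro has_integral_weighted_term) (use has_integral_diff[OF i0(1,3)] in \<open>simp add: algebra_simps\<close>)
  qed
qed

text \<open>The stage condition removes the h^2 term of \<open>err\<close>, so its square is O(h^6)
  and linearization still suffices. The feedback term \<open>W\<close> is then of order h^5, and its
  leading part has to be computed by iterating the error equation.\<close>

lemma convergent_order_6: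
  assumes row_0: "\<And>\<tau>. \<tau> \<in> {0..1} \<Longrightarrow> row 0 \<tau> = 0" and m02: "moment 0 2 = 0" and m11: "moment 1 1 = 0"
  shows "convergent_order 6"
proof -
  obtain c where c: "bigO (4 + 2) (\<lambda>h Q \<tau>. err h Q \<tau> - (h^2 *\<^sub>R integral {0..1} (\<lambda>\<sigma>. A \<tau> \<sigma> *\<^sub>R force_err h Q \<sigma>)
     + (\<Sum>i<4. (h ^ (i + 2) * row i \<tau>) *\<^sub>R c i)))"
    using err_expansion[of 4] by blast
  obtain d where d: "\<And>b. bigO 3 (\<lambda>h Q \<tau>. force_deriv b (\<tau> * h) - (\<Sum>i<3. (\<tau> * h) ^ i *\<^sub>R d b i))"
    using force_deriv_expansion[of 3] by blast
  obtain d1 where d1: "\<And>b. bigO 1 (\<lambda>h Q \<tau>. force_deriv b (\<tau> * h) - (\<Sum>i<1. (\<tau> * h) ^ i *\<^sub>R d1 b i))"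
    using force_deriv_expansion[of 1] by blast
  define a where "a i j = contract (c i) (\<lambda>b. d b j)" for i j
  define a1 where "a1 = contract (c 1) (\<lambda>b. d1 b 0)"
  define W where "W h Q \<tau> = h^2 *\<^sub>R integral {0..1} (\<lambda>\<sigma>. A \<tau> \<sigma> *\<^sub>R force_err h Q \<sigma>)" for h Q \<tau>
  define R where "R \<tau> = integral {0..1} (\<lambda>\<sigma>. A \<tau> \<sigma> * row 1 \<sigma>)" for \<tau>
  have cR: "continuous_on {0..1} R"
    unfolding R_def[abs_def]
    by (intro continuous_on_unit_param_integral, unfold split_def)
       (intro continuous_A_comp continuous_intros continuous_on_compose2[OF continuous_row], auto)
  let ?t1 = "\<lambda>h \<tau>. (h^3 * row 1 \<tau>) *\<^sub>R c 1" and ?t2 = "\<lambda>h \<tau>. (h^4 * row 2 \<tau>) *\<^sub>R c 2"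
    and ?t3 = "\<lambda>h \<tau>. (h^5 * row 3 \<tau>) *\<^sub>R c 3"
  have s4: "(\<Sum>i<4. F i) = F 0 + F 1 + F 2 + F 3" for F :: "nat \<Rightarrow> 'a"
    by (simp add: eval_nat_numeral)
  have e6: "bigO 6 (\<lambda>h Q \<tau>. err h Q \<tau> - (W h Q \<tau> + (?t1 h \<tau> + ?t2 h \<tau> + ?t3 h \<tau>)))"
  proof (rule bigO_cong)
    show "bigO 6 (\<lambda>h Q \<tau>. err h Q \<tau> - (h^2 *\<^sub>R integral {0..1} (\<lambda>\<sigma>. A \<tau> \<sigma> *\<^sub>R force_err h Q \<sigma>)
     + (\<Sum>i<4. (h ^ (i + 2) * row i \<tau>) *\<^sub>R c i)))" using c by simp
  qed (simp add: s4 row_0 W_def eval_nat_numeral)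
  have t1: "bigO 3 (\<lambda>h Q. ?t1 h)" and t2: "bigO 4 (\<lambda>h Q. ?t2 h)" and t3: "bigO 5 (\<lambda>h Q. ?t3 h)"
    by (intro bigO_term continuous_row order_refl)+
  have W4: "bigO 4 W"
    using err_step[OF err_bigO_2] by (simp add: W_def[abs_def])
  \<comment> \<open>\<open>W\<close> is O(h^4) by the crude bound on \<open>err\<close>, so the row
    1 term of order h^3 dominates. Fed back, this improves \<open>W\<close> to O(h^5).\<close>
  have e3: "bigO 3 err"
  proof (rule bigO_cong)
    show "bigO 3 (\<lambda>h Q \<tau>. (err h Q \<tau> - (W h Q \<tau> + (?t1 h \<tau> + ?t2 h \<tau> + ?t3 h \<tau>))) + (W h Q \<tau> + (?t1 h \<tau> + ?t2 h \<tau> + ?t3 h \<tau>)))"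
      by (intro bigO_add bigO_mono[OF e6] bigO_mono[OF W4] bigO_mono[OF t1] bigO_mono[OF t2] bigO_mono[OF t3]) simp_all
  qed simp
  have W5: "bigO 5 W"
    using err_step[OF e3] by (simp add: W_def[abs_def])
  have e4: "bigO 4 (\<lambda>h Q \<tau>. err h Q \<tau> - ?t1 h \<tau>)"
  proof (rule bigO_cong)
    show "bigO 4 (\<lambda>h Q \<tau>. (err h Q \<tau> - (W h Q \<tau> + (?t1 h \<tau> + ?t2 h \<tau> + ?t3 h \<tau>))) + (W h Q \<tau> + (?t2 h \<tau> + ?t3 h \<tau>)))"
      by (intro bigO_add bigO_mono[OF e6] bigO_mono[OF W5] bigO_mono[OF t2] bigO_mono[OF t3]) simp_all
  qed simp
  \<comment> \<open>With \<open>err\<close> known up to O(h^4), one term of the derivative expansion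
    gives the leading part of the force error.\<close>
  have "bigO 4 (\<lambda>h Q \<tau>. force_err h Q \<tau> - contract (?t1 h \<tau>) (\<lambda>b. d1 b 0))"
    by (rule force_err_product[OF e3 e4 t1, where k = 1]) (use d1 in simp_all)
  then have f4: "bigO 4 (\<lambda>h Q \<tau>. force_err h Q \<tau> - (h^3 * row 1 \<tau>) *\<^sub>R a1)"
    by (simp only: contract_scaleR_left a1_def)
  \<comment> \<open>Inserting that leading part into the feedback integral isolates h^5
    \<open>R\<close>, the one contribution that is not a moment.\<close>
  have W6: "bigO 6 (\<lambda>h Q \<tau>. W h Q \<tau> - (h^5 * R \<tau>) *\<^sub>R a1)"
  proof (rule bigO_cong)
    have "bigO (2 + 4) (\<lambda>h Q \<tau>. h^2 *\<^sub>R integral {0..1} (\<lambda>\<sigma>. A \<tau> \<sigma> *\<^sub>R (force_err h Q \<sigma> - (h^3 * row 1 \<sigma>) *\<^sub>R a1)))"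
      by (intro bigO_scaleR bigO_power bigO_A_integral f4 continuous_intros continuous_force_err continuous_row)
    then show "bigO 6 (\<lambda>h Q \<tau>. h^2 *\<^sub>R integral {0..1} (\<lambda>\<sigma>. A \<tau> \<sigma> *\<^sub>R (force_err h Q \<sigma> - (h^3 * row 1 \<sigma>) *\<^sub>R a1)))"
      by simp
    fix h Q \<tau> assume *: "admissible h Q" and t: "\<tau> \<in> {0..1::real}"
    have "((\<lambda>\<sigma>. A \<tau> \<sigma> *\<^sub>R force_err h Q \<sigma> - (h^3 * (A \<tau> \<sigma> * row 1 \<sigma>)) *\<^sub>R a1) has_integral
      integral {0..1} (\<lambda>\<sigma>. A \<tau> \<sigma> *\<^sub>R force_err h Q \<sigma>) - (h^3 * R \<tau>) *\<^sub>R a1) {0..1}"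
      unfolding R_def
      by (intro has_integral_diff has_integral_scaleR_left has_integral_mult_right integrable_integral
          integrable_continuous_real continuous_intros continuous_A_row[OF t] continuous_force_err * continuous_row)
    moreover have "(\<lambda>\<sigma>. A \<tau> \<sigma> *\<^sub>R force_err h Q \<sigma> - (h^3 * (A \<tau> \<sigma> * row 1 \<sigma>)) *\<^sub>R a1)
      = (\<lambda>\<sigma>. A \<tau> \<sigma> *\<^sub>R (force_err h Q \<sigma> - (h^3 * row 1 \<sigma>) *\<^sub>R a1))"
      by (simp add: scaleR_diff_right mult_ac)
    ultimately have "integral {0..1} (\<lambda>\<sigma>. A \<tau> \<sigma> *\<^sub>R (force_err h Q \<sigma> - (h^3 * row 1 \<sigma>) *\<^sub>R a1))
      = integral {0..1} (\<lambda>\<sigma>. A \<tau> \<sigma> *\<^sub>R force_err h Q \<sigma>) - (h^3 * R \<tau>) *\<^sub>R a1"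
      by (simp only: integral_unique)
    moreover have "h^5 * R \<tau> = h^2 * (h^3 * R \<tau>)" by (simp add: eval_nat_numeral)
    ultimately show "W h Q \<tau> - (h^5 * R \<tau>) *\<^sub>R a1
      = h^2 *\<^sub>R integral {0..1} (\<lambda>\<sigma>. A \<tau> \<sigma> *\<^sub>R (force_err h Q \<sigma> - (h^3 * row 1 \<sigma>) *\<^sub>R a1))"
      by (simp only: W_def scaleR_diff_right scaleR_scaleR)
  qed
  define X where "X h \<tau> = ?t1 h \<tau> + ?t2 h \<tau> + ?t3 h \<tau> + (h^5 * R \<tau>) *\<^sub>R a1" for h \<tau>
  define Y where "Y b h \<tau> = d b 0 + (\<tau> * h) *\<^sub>R d b 1 + (\<tau> * h)^2 *\<^sub>R d b 2" for b h \<tau>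
  have eX: "bigO 6 (\<lambda>h Q \<tau>. err h Q \<tau> - X h \<tau>)"
    using bigO_add[OF e6 W6] by (rule bigO_cong) (simp add: X_def)
  have bX: "bigO 3 (\<lambda>h Q \<tau>. X h \<tau>)"
    unfolding X_def by (intro bigO_add bigO_term continuous_row cR) auto
  have bY: "bigO 3 (\<lambda>h Q \<tau>. force_deriv b (\<tau> * h) - Y b h \<tau>)" for b
    using d[of b] by (simp add: Y_def eval_nat_numeral)
  have P: "bigO 6 (\<lambda>h Q \<tau>. force_err h Q \<tau> - contract (X h \<tau>) (\<lambda>b. Y b h \<tau>))"
    by (rule force_err_product[OF e3 eX bX bY]) auto
  define a2 where "a2 j = contract a1 (\<lambda>b. d b j)" for j
  \<comment> \<open>\<open>T'\<close> holds orders 3 and 4, \<open>T''\<close> order 5, and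
    \<open>Z\<close> the negligible orders 6 and 7. The condition with weight 1 needs
    \<open>T' + T''\<close>; the one with weight 1 - \<tau> needs \<open>T'\<close> alone.\<close>
  define T' where "T' h \<tau> = (h^3 * row 1 \<tau>) *\<^sub>R a 1 0 + (h^4 * row 2 \<tau>) *\<^sub>R a 2 0 + (h^4 * (\<tau> * row 1 \<tau>)) *\<^sub>R a 1 1" for h \<tau>
  define T'' where "T'' h \<tau> = (h^5 * row 3 \<tau>) *\<^sub>R a 3 0 + (h^5 * R \<tau>) *\<^sub>R a2 0
    + (h^5 * (\<tau> * row 2 \<tau>)) *\<^sub>R a 2 1 + (h^5 * (\<tau>^2 * row 1 \<tau>)) *\<^sub>R a 1 2" for h \<tau>
  define Z where "Z h \<tau> = (h^6 * (\<tau> * row 3 \<tau>)) *\<^sub>R a 3 1 + (h^6 * (\<tau> * R \<tau>)) *\<^sub>R a2 1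
    + (h^6 * (\<tau>^2 * row 2 \<tau>)) *\<^sub>R a 2 2 + (h^7 * (\<tau>^2 * row 3 \<tau>)) *\<^sub>R a 3 2 + (h^7 * (\<tau>^2 * R \<tau>)) *\<^sub>R a2 2" for h \<tau>
  have XY: "contract (X h \<tau>) (\<lambda>b. Y b h \<tau>) = T' h \<tau> + T'' h \<tau> + Z h \<tau>" for h \<tau>
    by (simp add: X_def Y_def T'_def T''_def Z_def a_def a2_def contract_bilinear scaleR_add_right eval_nat_numeral mult_ac add_ac)
  have bZ: "bigO 6 (\<lambda>h Q \<tau>. Z h \<tau>)"
    unfolding Z_def by (intro bigO_add bigO_term continuous_intros continuous_row cR) auto
  have R6: "bigO 6 (\<lambda>h Q \<tau>. force_err h Q \<tau> - (T' h \<tau> + T'' h \<tau>))"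
    using bigO_add[OF P bZ] by (simp add: XY)
  have b5: "bigO 5 (\<lambda>h Q \<tau>. T'' h \<tau>)"
    unfolding T''_def by (intro bigO_add bigO_term continuous_intros continuous_row cR) auto
  have R5: "bigO 5 (\<lambda>h Q \<tau>. force_err h Q \<tau> - T' h \<tau>)"
    using bigO_add[OF bigO_mono[OF R6, of 5] b5] by simp
  have i0: "((\<lambda>\<tau>. row (Suc 0) \<tau>) has_integral 0) {0..1}" "((\<lambda>\<tau>. row 2 \<tau>) has_integral 0) {0..1}"
    "((\<lambda>\<tau>. row 3 \<tau>) has_integral 0) {0..1}" "((\<lambda>\<tau>. \<tau> * row (Suc 0) \<tau>) has_integral 0) {0..1}"
    "((\<lambda>\<tau>. \<tau> * row 2 \<tau>) has_integral 0) {0..1}" "((\<lambda>\<tau>. \<tau>^2 * row (Suc 0) \<tau>) has_integral 0) {0..1}"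
    using moment_has_integral[of 0 1] moment_has_integral[of 0 2] moment_has_integral[of 0 3] moment_has_integral[of 1 1]
      moment_has_integral[of 1 2] moment_has_integral[of 2 1] m02 m11 moments_order_6[OF row_0 m02 m11]
      moment_0_1_zero[OF row_0]
    by simp_all
  have iR: "(R has_integral 0) {0..1}"
    using iterated_row_integral[OF row_0 m11] integrable_continuous_real[OF cR]
    by (simp add: has_integral_iff R_def[abs_def])
  show ?thesis
  proof (rule convergent_orderI)
    show "bigO 6 (\<lambda>h Q \<tau>. force_err h Q \<tau> - (T' h \<tau> + T'' h \<tau>))" by (rule R6)
    show "bigO (6 - 1) (\<lambda>h Q \<tau>. force_err h Q \<tau> - T' h \<tau>)" using R5 by simp
    show "continuous_on {0..1} (\<lambda>\<tau>. T' h \<tau> + T'' h \<tau>)" for h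
      unfolding T'_def T''_def by (intro continuous_intros continuous_row cR)
    show "continuous_on {0..1} (T' h)" for h
      unfolding T'_def[abs_def] by (intro continuous_intros continuous_row)
    show "((\<lambda>\<tau>. 1 *\<^sub>R (T' h \<tau> + T'' h \<tau>)) has_integral 0) {0..1}" for h
      unfolding T'_def T''_def
      by (intro has_integral_weighted_add has_integral_weighted_term) (use i0 iR in simp_all)
    \<comment> \<open>The weight raises degrees by one and asks for \<open>moment 0 1\<close> -
      \<open>moment 1 1\<close>, \<open>moment 0 2\<close> - \<open>moment 1 2\<close> and
      \<open>moment 1 1\<close> - \<open>moment 2 1\<close>.\<close>
    show "((\<lambda>\<tau>. (1 - \<tau>) *\<^sub>R T' h \<tau>) has_integral 0) {0..1}" for h
      unfolding T'_def
      by (intro has_integral_weighted_add has_integral_weighted_term)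
         (use has_integral_diff[OF i0(1,4)] has_integral_diff[OF i0(2,5)] has_integral_diff[OF i0(4,6)]
          in \<open>simp_all add: algebra_simps power2_eq_square\<close>)
  qed
qed

end

context rkn_problem
begin

section \<open>Existence of stages and the order of the method\<close>

text \<open>The fixed point is sought among bounded continuous functions on the whole line. This
  retraction extends the stage map beyond the unit interval without altering it there.\<close>

definition unit_clamp :: "real \<Rightarrow> real" where
  "unit_clamp \<tau> = max 0 (min 1 \<tau>)"

lemma unit_clamp: "unit_clamp \<tau> \<in> {0..1}" "\<tau> \<in> {0..1} \<Longrightarrow> unit_clamp \<tau> = \<tau>"
  by (auto simp: unit_clamp_def)

lemma continuous_unit_clamp: "continuous_on S unit_clamp"
  unfolding unit_clamp_def[abs_def] by (intro continuous_intros)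

text \<open>Banach's fixed point theorem on the bounded continuous functions with values in the unit
  ball around \<open>q t0\<close>, a closed and hence complete set.\<close>

lemma admissible_exists:
  "\<exists>h1>0. \<forall>h. \<bar>h\<bar> < h1 \<longrightarrow> (\<exists>Q. admissible h Q)"
proof -
  obtain M where M: "M \<ge> 0" "\<And>\<tau> \<sigma>. \<tau> \<in> {0..1} \<Longrightarrow> \<sigma> \<in> {0..1} \<Longrightarrow> \<bar>A \<tau> \<sigma>\<bar> \<le> M"
    by (rule A_bound) (rule that)
  obtain B where B: "B \<ge> 0" "\<And>z. z \<in> cball t0 h0 \<times> cball (q t0) 1 \<Longrightarrow> norm (f z) \<le> B"
    using compact_bound[OF compact_Times[OF compact_cball compact_cball] smooth_fun_continuous_on[OF f]] by blast
  obtain L where L: "L \<ge> 0" "\<forall>t\<in>cball t0 h0. \<forall>x\<in>cball (q t0) 1. \<forall>y\<in>cball (q t0) 1. norm (f (t, x) - f (t, y)) \<le> L * norm (x - y)"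
    using smooth_lipschitz[OF f compact_cball[of t0 h0] compact_cball[of "q t0" 1] convex_cball] by blast
  \<comment> \<open>With \<bar>h\<bar> C \<le> 1, the terms \<open>norm (v t0) + M * B\<close> keep
    the stages in the unit ball, \<open>M * L\<close> yields the contraction factor 1/2 thanks to
    the leading 2, and the 1 makes \<open>C\<close> positive.\<close>
  define C where "C = 2 * (norm (v t0) + M * B + M * L + 1)"
  have C: "C > 0" using M B L by (simp add: C_def add_nonneg_pos)
  define h1 where "h1 = min h0 (1 / C)"
  have h1: "h1 > 0" using h0 C by (simp add: h1_def)
  have "\<exists>Q. admissible h Q" if "\<bar>h\<bar> < h1" for h
  proof -
    have h: "\<bar>h\<bar> \<le> h0" "\<bar>h\<bar> \<le> 1" "\<bar>h\<bar> * C \<le> 1"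
      using that h0 C by (auto simp: h1_def field_simps)
    \<comment> \<open>Trading h^2 for \<bar>h\<bar> lets one linear smallness condition control
      every term.\<close>
    have h2: "h^2 \<le> \<bar>h\<bar>"
      using mult_right_mono[OF h(2), of "\<bar>h\<bar>"] by (simp add: power2_eq_square flip: abs_mult)
    define G where "G \<phi> \<tau> = q t0 + (h * \<tau>) *\<^sub>R v t0 + h^2 *\<^sub>R integral {0..1} (\<lambda>\<sigma>. A \<tau> \<sigma> *\<^sub>R f (t0 + \<sigma> * h, \<phi> \<sigma>))" for \<phi> \<tau>
    define S where "S = PiC UNIV (\<lambda>_::real. cball (q t0) 1)"
    have S_iff: "\<phi> \<in> S \<longleftrightarrow> (\<forall>x. apply_bcontfun \<phi> x \<in> cball (q t0) 1)" for \<phi>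
      by (auto simp: S_def mem_PiC_iff)
    have node: "t0 + \<sigma> * h \<in> cball t0 h0" if "\<sigma> \<in> {0..1}" for \<sigma>
      using node_range[OF h(1) that] by (simp add: dist_norm)
    have cint: "continuous_on {0..1} (\<lambda>\<sigma>. A \<tau> \<sigma> *\<^sub>R f (t0 + \<sigma> * h, apply_bcontfun \<phi> \<sigma>))" if "\<tau> \<in> {0..1}" for \<phi> \<tau>
      by (intro continuous_intros continuous_A_row that continuous_smooth_node f) simp
    have cG: "continuous_on {0..1} (G (apply_bcontfun \<phi>))" for \<phi>
    proof -
      have "continuous_on ({0..1} \<times> {0..1}) (\<lambda>x. A (fst x) (snd x) *\<^sub>R f (t0 + snd x * h, apply_bcontfun \<phi> (snd x)))"
        by (intro continuous_on_scaleR continuous_A_comp continuous_on_compose2[OF smooth_fun_continuous_on[OF f, of UNIV]]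
          continuous_on_compose2[OF continuous_on_apply_bcontfun[of UNIV]] continuous_intros) auto
      then show ?thesis
        unfolding G_def[abs_def]
        by (intro continuous_intros continuous_on_unit_param_integral) (simp add: split_def)
    qed
    have bG: "norm (G (apply_bcontfun \<phi>) \<tau> - q t0) \<le> 1" if "\<phi> \<in> S" and t: "\<tau> \<in> {0..1}" for \<phi> \<tau>
    proof -
      have "norm (integral {0..1} (\<lambda>\<sigma>. A \<tau> \<sigma> *\<^sub>R f (t0 + \<sigma> * h, apply_bcontfun \<phi> \<sigma>))) \<le> (M * B) * (1 - 0)"
      proof (rule integral_bound[OF _ cint[OF t]])
        fix \<sigma> :: real assume s: "\<sigma> \<in> {0..1}"
        have "norm (f (t0 + \<sigma> * h, apply_bcontfun \<phi> \<sigma>)) \<le> B"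
          by (rule B(2)) (use node[OF s] that(1) in \<open>simp add: S_iff\<close>)
        then show "norm (A \<tau> \<sigma> *\<^sub>R f (t0 + \<sigma> * h, apply_bcontfun \<phi> \<sigma>)) \<le> M * B"
          unfolding norm_scaleR using M(1) M(2)[OF t s] by (intro mult_mono) auto
      qed simp
      then have "norm (h^2 *\<^sub>R integral {0..1} (\<lambda>\<sigma>. A \<tau> \<sigma> *\<^sub>R f (t0 + \<sigma> * h, apply_bcontfun \<phi> \<sigma>))) \<le> \<bar>h\<bar> * (M * B)"
        unfolding norm_scaleR using h2 by (intro mult_mono) auto
      moreover have "norm ((h * \<tau>) *\<^sub>R v t0) \<le> \<bar>h\<bar> * norm (v t0)"
        using t by (auto simp: abs_mult intro!: mult_right_mono mult_left_le)
      ultimately have "norm (G (apply_bcontfun \<phi>) \<tau> - q t0) \<le> \<bar>h\<bar> * norm (v t0) + \<bar>h\<bar> * (M * B)"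
        unfolding G_def by (simp add: norm_triangle_mono)
      also have "\<dots> \<le> \<bar>h\<bar> * C"
        unfolding distrib_left[symmetric] C_def using M(1) B(1) L(1) by (intro mult_left_mono) auto
      finally show ?thesis using h(3) by simp
    qed
    define \<Psi> where "\<Psi> \<phi> = Bcontfun (\<lambda>x. G (apply_bcontfun \<phi>) (unit_clamp x))" for \<phi>
    have \<Psi>: "apply_bcontfun (\<Psi> \<phi>) x = G (apply_bcontfun \<phi>) (unit_clamp x)" if "\<phi> \<in> S" for \<phi> x
    proof -
      have "(\<lambda>x. G (apply_bcontfun \<phi>) (unit_clamp x)) \<in> bcontfun"
      proof (rule bcontfun_normI)
        show "continuous_on UNIV (\<lambda>x. G (apply_bcontfun \<phi>) (unit_clamp x))"
          by (rule continuous_on_compose2[OF cG continuous_unit_clamp]) (use unit_clamp(1) in auto)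
        show "norm (G (apply_bcontfun \<phi>) (unit_clamp x)) \<le> norm (q t0) + 1" for x
          using norm_triangle_mono[OF order_refl bG[OF that unit_clamp(1)], of "q t0"] by simp
      qed
      then show ?thesis by (simp add: \<Psi>_def Bcontfun_inverse)
    qed
    have "\<exists>!\<phi>\<in>S. \<Psi> \<phi> = \<phi>"
    proof (rule Banach_fix[where c = "1/2"])
      show "complete S" unfolding S_def by (simp add: complete_eq_closed closed_PiC)
      have "const_bcontfun (q t0) \<in> S" by (simp add: S_iff const_bcontfun.rep_eq)
      then show "S \<noteq> {}" by auto
      show "\<Psi> ` S \<subseteq> S"
      proof (rule image_subsetI)
        fix \<phi> assume "\<phi> \<in> S"
        then show "\<Psi> \<phi> \<in> S" unfolding S_iff[of "\<Psi> \<phi>"]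
          using bG[OF _ unit_clamp(1)] by (simp add: \<Psi> dist_norm norm_minus_commute)
      qed
      fix \<phi> \<psi> assume \<phi>: "\<phi> \<in> S" and \<psi>: "\<psi> \<in> S"
      show "dist (\<Psi> \<phi>) (\<Psi> \<psi>) \<le> 1/2 * dist \<phi> \<psi>"
      proof (rule dist_bound)
        fix x :: real
        let ?\<tau> = "unit_clamp x"
        have t: "?\<tau> \<in> {0..1}" by (rule unit_clamp(1))
        have "norm (integral {0..1} (\<lambda>\<sigma>. A ?\<tau> \<sigma> *\<^sub>R f (t0 + \<sigma> * h, apply_bcontfun \<phi> \<sigma>) - A ?\<tau> \<sigma> *\<^sub>R f (t0 + \<sigma> * h, apply_bcontfun \<psi> \<sigma>)))
          \<le> (M * (L * dist \<phi> \<psi>)) * (1 - 0)"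
        proof (rule integral_bound[OF _ continuous_on_diff[OF cint[OF t] cint[OF t]]])
          fix \<sigma> :: real assume s: "\<sigma> \<in> {0..1}"
          have "norm (f (t0 + \<sigma> * h, apply_bcontfun \<phi> \<sigma>) - f (t0 + \<sigma> * h, apply_bcontfun \<psi> \<sigma>))
              \<le> L * norm (apply_bcontfun \<phi> \<sigma> - apply_bcontfun \<psi> \<sigma>)"
            by (rule L(2)[rule_format, OF node[OF s]]) (use \<phi> \<psi> in \<open>simp_all add: S_iff\<close>)
          also have "\<dots> \<le> L * dist \<phi> \<psi>"
            using dist_bounded[of \<phi> \<sigma> \<psi>] L(1) by (intro mult_left_mono) (simp_all add: dist_norm)
          finally show "norm (A ?\<tau> \<sigma> *\<^sub>R f (t0 + \<sigma> * h, apply_bcontfun \<phi> \<sigma>) - A ?\<tau> \<sigma> *\<^sub>R f (t0 + \<sigma> * h, apply_bcontfun \<psi> \<sigma>))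
              \<le> M * (L * dist \<phi> \<psi>)"
            unfolding scaleR_diff_right[symmetric] norm_scaleR using M(1) M(2)[OF t s] by (intro mult_mono) auto
        qed simp
        then have "norm (h^2 *\<^sub>R integral {0..1} (\<lambda>\<sigma>. A ?\<tau> \<sigma> *\<^sub>R f (t0 + \<sigma> * h, apply_bcontfun \<phi> \<sigma>) - A ?\<tau> \<sigma> *\<^sub>R f (t0 + \<sigma> * h, apply_bcontfun \<psi> \<sigma>)))
          \<le> \<bar>h\<bar> * (M * (L * dist \<phi> \<psi>))"
          unfolding norm_scaleR using h2 by (intro mult_mono) auto
        also have "h^2 *\<^sub>R integral {0..1} (\<lambda>\<sigma>. A ?\<tau> \<sigma> *\<^sub>R f (t0 + \<sigma> * h, apply_bcontfun \<phi> \<sigma>) - A ?\<tau> \<sigma> *\<^sub>R f (t0 + \<sigma> * h, apply_bcontfun \<psi> \<sigma>))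
          = G (apply_bcontfun \<phi>) ?\<tau> - G (apply_bcontfun \<psi>) ?\<tau>"
          by (simp add: G_def integral_diff integrable_continuous_real cint[OF t] scaleR_diff_right)
        also have "\<bar>h\<bar> * (M * (L * dist \<phi> \<psi>)) \<le> 1/2 * dist \<phi> \<psi>"
        proof -
          have "\<bar>h\<bar> * (M * L) \<le> \<bar>h\<bar> * (C / 2)"
            using M(1) B(1) by (intro mult_left_mono) (auto simp: C_def)
          then have "\<bar>h\<bar> * (M * L) \<le> 1/2" using h(3) by simp
          from mult_right_mono[OF this, of "dist \<phi> \<psi>"] show ?thesis by (simp add: mult.assoc)
        qed
        finally show "dist (apply_bcontfun (\<Psi> \<phi>) x) (apply_bcontfun (\<Psi> \<psi>) x) \<le> 1/2 * dist \<phi> \<psi>"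
          by (simp add: \<Psi>[OF \<phi>] \<Psi>[OF \<psi>] dist_norm)
      qed
    qed simp_all
    then obtain \<phi> where \<phi>: "\<phi> \<in> S" "\<Psi> \<phi> = \<phi>" by blast
    \<comment> \<open>On the unit interval the clamp is the identity, so the fixed point solves the
      stage equation there.\<close>
    have e: "apply_bcontfun \<phi> \<tau> = G (apply_bcontfun \<phi>) \<tau>" if "\<tau> \<in> {0..1}" for \<tau>
      using \<Psi>[OF \<phi>(1), of \<tau>] \<phi>(2) unit_clamp(2)[OF that] by simp
    have dd: "dist (apply_bcontfun \<phi> \<tau>) (q t0) \<le> 1" for \<tau>
      using \<phi>(1) by (simp add: S_iff dist_commute)
    have "admissible h (apply_bcontfun \<phi>)"
      unfolding admissible_def
      by (intro conjI ballI h(1) continuous_on_apply_bcontfun dd) (rule e[unfolded G_def])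
    then show ?thesis by blast
  qed
  with h1 show ?thesis by blast
qed

lemma order_bound:
  assumes "convergent_order p" "p \<ge> 1"
  shows "\<exists>r>0. \<exists>h0>0. \<exists>K. \<forall>h. \<bar>h\<bar> < h0 \<longrightarrow>
    (\<exists>Q q1 p1. csRKN_sol A (\<lambda>\<tau>. 1 - \<tau>) (\<lambda>\<tau>. 1) (\<lambda>\<tau>. \<tau>) f t0 (q t0) (v t0) h Q q1 p1 \<and> (\<forall>\<tau>\<in>{0..1}. dist (Q \<tau>) (q t0) \<le> r)) \<and>
    (\<forall>Q q1 p1. csRKN_sol A (\<lambda>\<tau>. 1 - \<tau>) (\<lambda>\<tau>. 1) (\<lambda>\<tau>. \<tau>) f t0 (q t0) (v t0) h Q q1 p1 \<and> (\<forall>\<tau>\<in>{0..1}. dist (Q \<tau>) (q t0) \<le> r) \<longrightarrow>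
      norm (q (t0 + h) - q1) \<le> K * \<bar>h\<bar> ^ (p + 1) \<and> norm (v (t0 + h) - p1) \<le> K * \<bar>h\<bar> ^ (p + 1))"
proof -
  obtain K1 where K1: "\<And>h Q. admissible h Q \<Longrightarrow> norm (integral {0..1} (\<lambda>\<tau>. 1 *\<^sub>R force_err h Q \<tau>)) \<le> K1 * \<bar>h\<bar> ^ p"
    using assms(1) unfolding convergent_order_def by blast
  obtain K2 where K2: "\<And>h Q. admissible h Q \<Longrightarrow> norm (integral {0..1} (\<lambda>\<tau>. (1 - \<tau>) *\<^sub>R force_err h Q \<tau>)) \<le> K2 * \<bar>h\<bar> ^ (p - 1)"
    using assms(1) unfolding convergent_order_def by blast
  obtain h1 where h1: "h1 > 0" "\<And>h. \<bar>h\<bar> < h1 \<Longrightarrow> \<exists>Q. admissible h Q"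
    using admissible_exists by blast
  define K where "K = max K1 K2"
  have est: "norm (q (t0 + h) - q1) \<le> K * \<bar>h\<bar> ^ (p + 1) \<and> norm (v (t0 + h) - p1) \<le> K * \<bar>h\<bar> ^ (p + 1)"
    if h: "\<bar>h\<bar> \<le> h0" and sol: "csRKN_sol A (\<lambda>\<tau>. 1 - \<tau>) (\<lambda>\<tau>. 1) (\<lambda>\<tau>. \<tau>) f t0 (q t0) (v t0) h Q q1 p1"
      and near: "\<forall>\<tau>\<in>{0..1}. dist (Q \<tau>) (q t0) \<le> 1" for h Q q1 p1
  proof -
    have a: "admissible h Q"
      using sol h near unfolding csRKN_sol_def admissible_def by blast
    have cQ: "continuous_on {0..1} Q" using a by (simp add: admissible_def)
    have cf: "continuous_on {0..1} (\<lambda>\<tau>. f (t0 + \<tau> * h, Q \<tau>))"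
      by (rule continuous_smooth_node[OF f cQ])
    have w: "integral {0..1} (\<lambda>\<tau>. w \<tau> *\<^sub>R force (\<tau> * h)) - integral {0..1} (\<lambda>\<tau>. w \<tau> *\<^sub>R f (t0 + \<tau> * h, Q \<tau>))
        = - integral {0..1} (\<lambda>\<tau>. w \<tau> *\<^sub>R force_err h Q \<tau>)" if cw: "continuous_on {0..1} w" for w
    proof -
      have "integral {0..1} (\<lambda>\<tau>. w \<tau> *\<^sub>R force_err h Q \<tau>)
         = integral {0..1} (\<lambda>\<tau>. w \<tau> *\<^sub>R f (t0 + \<tau> * h, Q \<tau>)) - integral {0..1} (\<lambda>\<tau>. w \<tau> *\<^sub>R force (\<tau> * h))"
        unfolding force_err_def scaleR_diff_right
        by (intro integral_diff integrable_continuous_real continuous_on_scaleR cw cf continuous_force h)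
      then show ?thesis by simp
    qed
    have "v (t0 + h) = v t0 + h *\<^sub>R integral {0..1} (\<lambda>\<tau>. 1 *\<^sub>R force (\<tau> * h))"
      using v_exact[OF h] by simp
    moreover have "p1 = v t0 + h *\<^sub>R integral {0..1} (\<lambda>\<tau>. 1 *\<^sub>R f (t0 + \<tau> * h, Q \<tau>))"
      using sol by (simp add: csRKN_sol_def)
    ultimately have "v (t0 + h) - p1 = h *\<^sub>R (- integral {0..1} (\<lambda>\<tau>. 1 *\<^sub>R force_err h Q \<tau>))"
      unfolding w[OF continuous_on_const, symmetric] scaleR_diff_right by simp
    then have "norm (v (t0 + h) - p1) = \<bar>h\<bar> * norm (integral {0..1} (\<lambda>\<tau>. 1 *\<^sub>R force_err h Q \<tau>))"
      by simp
    also have "\<dots> \<le> \<bar>h\<bar> * (K1 * \<bar>h\<bar> ^ p)" by (intro mult_left_mono K1 a) simp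
    also have "\<dots> = K1 * \<bar>h\<bar> ^ (p + 1)" by simp
    also have "\<dots> \<le> K * \<bar>h\<bar> ^ (p + 1)" by (intro mult_right_mono) (simp_all add: K_def)
    finally have 1: "norm (v (t0 + h) - p1) \<le> K * \<bar>h\<bar> ^ (p + 1)" .
    \<comment> \<open>The quadrature weight 1 - \<sigma> for q is the Taylor kernel at \<tau> =
      1.\<close>
    have "integral {0..1} (\<lambda>\<sigma>. max 0 (1 - \<sigma>) *\<^sub>R force (\<sigma> * h)) = integral {0..1} (\<lambda>\<sigma>. (1 - \<sigma>) *\<^sub>R force (\<sigma> * h))"
      by (rule integral_cong) auto
    then have "q (t0 + h) = q t0 + h *\<^sub>R v t0 + h^2 *\<^sub>R integral {0..1} (\<lambda>\<sigma>. (1 - \<sigma>) *\<^sub>R force (\<sigma> * h))"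
      using q_exact[OF h, of 1] by simp
    moreover have "q1 = q t0 + h *\<^sub>R v t0 + h^2 *\<^sub>R integral {0..1} (\<lambda>\<tau>. (1 - \<tau>) *\<^sub>R f (t0 + \<tau> * h, Q \<tau>))"
      using sol by (simp add: csRKN_sol_def)
    moreover have "continuous_on {0..1} (\<lambda>\<tau>::real. 1 - \<tau>)" by (intro continuous_intros)
    ultimately have "q (t0 + h) - q1 = h^2 *\<^sub>R (- integral {0..1} (\<lambda>\<tau>. (1 - \<tau>) *\<^sub>R force_err h Q \<tau>))"
      by (simp only: w[symmetric] scaleR_diff_right) simp
    then have "norm (q (t0 + h) - q1) = \<bar>h\<bar> ^ 2 * norm (integral {0..1} (\<lambda>\<tau>. (1 - \<tau>) *\<^sub>R force_err h Q \<tau>))"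
      by simp
    also have "\<dots> \<le> \<bar>h\<bar> ^ 2 * (K2 * \<bar>h\<bar> ^ (p - 1))" by (intro mult_left_mono K2 a) simp
    also have "\<dots> = K2 * \<bar>h\<bar> ^ (2 + (p - 1))" by (simp only: power_add mult_ac)
    \<comment> \<open>Natural subtraction: this is where p \<ge> 1 enters.\<close>
    also have "2 + (p - 1) = p + 1" using assms(2) by simp
    also have "K2 * \<bar>h\<bar> ^ (p + 1) \<le> K * \<bar>h\<bar> ^ (p + 1)" by (intro mult_right_mono) (simp_all add: K_def)
    finally show ?thesis using 1 by simp
  qed
  have ex: "\<exists>Q q1 p1. csRKN_sol A (\<lambda>\<tau>. 1 - \<tau>) (\<lambda>\<tau>. 1) (\<lambda>\<tau>. \<tau>) f t0 (q t0) (v t0) h Q q1 p1 \<and> (\<forall>\<tau>\<in>{0..1}. dist (Q \<tau>) (q t0) \<le> 1)"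
    if h: "\<bar>h\<bar> < h1" for h
  proof -
    obtain Q where "admissible h Q" using h1(2)[OF h] by blast
    then show ?thesis unfolding csRKN_sol_def admissible_def by blast
  qed
  show ?thesis
    by (rule exI[of _ 1], intro conjI zero_less_one, rule exI[of _ "min h0 h1"], intro conjI, use h0 h1 in simp,
        rule exI[of _ K], intro allI impI conjI, rule ex, simp, (rule est[THEN conjunct1] est[THEN conjunct2], simp, blast, blast)+)
qed

end

lemma csRKN_orderI:
  fixes A :: "real \<Rightarrow> real \<Rightarrow> real"
  assumes "symmetric_kernel A" "p \<ge> 1"
    and conv: "\<And>(f :: real \<times> 'a::euclidean_space \<Rightarrow> 'a) t0 q v \<delta> h0.
      rkn_problem A f t0 q v \<delta> h0 \<Longrightarrow> rkn_problem.convergent_order A f t0 q v h0 p"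
  shows "csRKN_order A (\<lambda>\<tau>. 1 - \<tau>) (\<lambda>\<tau>. 1) (\<lambda>\<tau>. \<tau>) p TYPE('a)"
  unfolding csRKN_order_def
proof (intro allI impI, elim conjE)
  fix f :: "real \<times> 'a \<Rightarrow> 'a" and t0 q0 p0 and q v :: "real \<Rightarrow> 'a" and \<delta> :: real
  assume f: "smooth_fun f" and \<delta>: "0 < \<delta>" and init: "q t0 = q0" "v t0 = p0"
    and ode: "\<forall>t\<in>ball t0 \<delta>. (q has_vector_derivative v t) (at t) \<and> (v has_vector_derivative f (t, q t)) (at t)"
  have "continuous (at t0) q"
    using ode \<delta> by (intro has_vector_derivative_continuous[of q "v t0"]) simp
  then obtain e where e: "e > 0" "\<And>s. dist s t0 < e \<Longrightarrow> dist (q s) (q t0) < 1"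
    unfolding continuous_at_eps_delta by (metis zero_less_one)
  \<comment> \<open>Halving makes the window strictly smaller than both the solution interval and
    the radius from continuity of \<open>q\<close>.\<close>
  define h0 where "h0 = min 1 (min (e / 2) (\<delta> / 2))"
  have "rkn_problem A f t0 q v \<delta> h0"
    unfolding rkn_problem_def rkn_problem_axioms_def
  proof (intro conjI allI impI assms(1) f)
    show "0 < h0" "h0 \<le> 1" "h0 < \<delta>" using e \<delta> by (auto simp: h0_def)
    show "(q has_vector_derivative v t) (at t)" "(v has_vector_derivative f (t, q t)) (at t)" if "t \<in> ball t0 \<delta>" for t
      using ode that by blast+
    show "dist (q (t0 + s)) (q t0) \<le> 1" if "\<bar>s\<bar> \<le> h0" for s
      using e(2)[of "t0 + s"] that e(1) by (simp add: h0_def dist_norm)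
  qed
  from rkn_problem.order_bound[OF this conv[OF this] assms(2)]
  show "\<exists>r>0. \<exists>h0>0. \<exists>K. \<forall>h. \<bar>h\<bar> < h0 \<longrightarrow>
      (\<exists>Q q1 p1. csRKN_sol A (\<lambda>\<tau>. 1 - \<tau>) (\<lambda>\<tau>. 1) (\<lambda>\<tau>. \<tau>) f t0 q0 p0 h Q q1 p1 \<and> (\<forall>\<tau>\<in>{0..1}. dist (Q \<tau>) q0 \<le> r)) \<and>
      (\<forall>Q q1 p1. csRKN_sol A (\<lambda>\<tau>. 1 - \<tau>) (\<lambda>\<tau>. 1) (\<lambda>\<tau>. \<tau>) f t0 q0 p0 h Q q1 p1 \<and> (\<forall>\<tau>\<in>{0..1}. dist (Q \<tau>) q0 \<le> r) \<longrightarrow>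
        norm (q (t0 + h) - q1) \<le> K * \<bar>h\<bar> ^ (p + 1) \<and> norm (v (t0 + h) - p1) \<le> K * \<bar>h\<bar> ^ (p + 1))"
    unfolding init .
qed

section \<open>Symmetry\<close>

context symmetric_kernel
begin

text \<open>The backward step uses the stages in reverse, \<open>Q (1 - \<tau>)\<close>.
  Re-expressing them from the endpoint data instead of the initial data requires the correction
  \<sigma> - \<tau> in the kernel, which is what reflection supplies.\<close>

lemma csRKN_step_reverse:
  fixes f :: "real \<times> 'a::euclidean_space \<Rightarrow> 'a"
  assumes f: "smooth_fun f" and step: "csRKN_step A (\<lambda>\<tau>. 1 - \<tau>) (\<lambda>\<tau>. 1) (\<lambda>\<tau>. \<tau>) f t0 q0 p0 h q1 p1"
  shows "csRKN_step A (\<lambda>\<tau>. 1 - \<tau>) (\<lambda>\<tau>. 1) (\<lambda>\<tau>. \<tau>) f (t0 + h) q1 p1 (- h) q0 p0"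
proof -
  obtain Q where sol: "csRKN_sol A (\<lambda>\<tau>. 1 - \<tau>) (\<lambda>\<tau>. 1) (\<lambda>\<tau>. \<tau>) f t0 q0 p0 h Q q1 p1"
    using step unfolding csRKN_step_def by blast
  define F where "F \<sigma> = f (t0 + \<sigma> * h, Q \<sigma>)" for \<sigma>
  define I where "I = integral {0..1} F"
  define J where "J = integral {0..1} (\<lambda>\<sigma>. (1 - \<sigma>) *\<^sub>R F \<sigma>)"
  define N where "N \<tau> = integral {0..1} (\<lambda>\<sigma>. A \<tau> \<sigma> *\<^sub>R F \<sigma>)" for \<tau>
  have cQ: "continuous_on {0..1} Q"
    and Q: "\<And>\<tau>. \<tau> \<in> {0..1} \<Longrightarrow> Q \<tau> = q0 + (h * \<tau>) *\<^sub>R p0 + h^2 *\<^sub>R N \<tau>"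
    and q1: "q1 = q0 + h *\<^sub>R p0 + h^2 *\<^sub>R J" and p1: "p1 = p0 + h *\<^sub>R I"
    using sol by (simp_all add: csRKN_sol_def N_def J_def I_def F_def[abs_def])
  have cF: "continuous_on {0..1} F"
    unfolding F_def[abs_def]
    by (rule continuous_on_compose2[OF smooth_fun_continuous_on[OF f, of UNIV]]) (auto intro!: continuous_intros cQ)
  \<comment> \<open>The nodes agree: t0 + h - \<sigma> h = t0 + (1 - \<sigma>) h, so the backward
    step sees the same force values.\<close>
  have F': "f (t0 + h + \<sigma> * - h, Q (1 - \<sigma>)) = F (1 - \<sigma>)" for \<sigma>
    by (simp add: F_def algebra_simps)
  have iF: "(F has_integral I) {0..1}" and iJ: "((\<lambda>\<sigma>. (1 - \<sigma>) *\<^sub>R F \<sigma>) has_integral J) {0..1}"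
    unfolding I_def J_def by (intro integrable_integral integrable_continuous_real continuous_intros cF)+
  have iN: "((\<lambda>\<sigma>. A \<tau> \<sigma> *\<^sub>R F \<sigma>) has_integral N \<tau>) {0..1}" if "\<tau> \<in> {0..1}" for \<tau>
    unfolding N_def
    by (intro integrable_integral integrable_continuous_real continuous_intros cF continuous_A_comp) (use that in auto)
  \<comment> \<open>\<open>J\<close> and \<open>I\<close> are the increments of \<open>q1\<close>
    and \<open>p1\<close>; they cancel those introduced by expanding around the endpoint.\<close>
  have N': "integral {0..1} (\<lambda>\<sigma>. A \<tau> \<sigma> *\<^sub>R F (1 - \<sigma>)) = N (1 - \<tau>) - J + \<tau> *\<^sub>R I" if t: "\<tau> \<in> {0..1}" for \<tau>
  proof -
    have "((\<lambda>\<sigma>. A (1 - \<tau>) \<sigma> *\<^sub>R F \<sigma> - (1 - \<sigma>) *\<^sub>R F \<sigma> + \<tau> *\<^sub>R F \<sigma>) has_integral N (1 - \<tau>) - J + \<tau> *\<^sub>R I) {0..1}"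
      using t by (intro has_integral_add has_integral_diff has_integral_cmul iF iJ iN) auto
    from has_integral_reflect_unit[OF this]
    have "((\<lambda>\<sigma>. A (1 - \<tau>) (1 - \<sigma>) *\<^sub>R F (1 - \<sigma>) - (1 - (1 - \<sigma>)) *\<^sub>R F (1 - \<sigma>) + \<tau> *\<^sub>R F (1 - \<sigma>))
      has_integral N (1 - \<tau>) - J + \<tau> *\<^sub>R I) {0..1}" .
    moreover have "A (1 - \<tau>) (1 - \<sigma>) *\<^sub>R F (1 - \<sigma>) - (1 - (1 - \<sigma>)) *\<^sub>R F (1 - \<sigma>) + \<tau> *\<^sub>R F (1 - \<sigma>)
        = A \<tau> \<sigma> *\<^sub>R F (1 - \<sigma>)" if "\<sigma> \<in> {0..1}" for \<sigma>
    proof -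
      have "A (1 - \<tau>) (1 - \<sigma>) = A \<tau> \<sigma> + \<sigma> - \<tau>"
        using A_reflect[OF t, of "1 - \<sigma>"] that by simp
      then show ?thesis by (simp add: scaleR_add_left scaleR_diff_left)
    qed
    ultimately have "((\<lambda>\<sigma>. A \<tau> \<sigma> *\<^sub>R F (1 - \<sigma>)) has_integral N (1 - \<tau>) - J + \<tau> *\<^sub>R I) {0..1}"
      by (rule has_integral_eq[rotated])
    then show ?thesis by (rule integral_unique)
  qed
  have J': "integral {0..1} (\<lambda>\<sigma>. (1 - \<sigma>) *\<^sub>R F (1 - \<sigma>)) = I - J"
  proof -
    have "((\<lambda>\<sigma>. F \<sigma> - (1 - \<sigma>) *\<^sub>R F \<sigma>) has_integral I - J) {0..1}"
      by (intro has_integral_diff iF iJ)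
    from has_integral_reflect_unit[OF this] show ?thesis
      by (simp add: has_integral_iff scaleR_diff_left)
  qed
  have I': "integral {0..1} (\<lambda>\<sigma>. F (1 - \<sigma>)) = I"
    using has_integral_reflect_unit[OF iF] by (rule integral_unique)
  have "csRKN_sol A (\<lambda>\<tau>. 1 - \<tau>) (\<lambda>\<tau>. 1) (\<lambda>\<tau>. \<tau>) f (t0 + h) q1 p1 (- h) (\<lambda>\<tau>. Q (1 - \<tau>)) q0 p0"
    unfolding csRKN_sol_def F' scaleR_one
  proof (intro conjI ballI)
    show "continuous_on {0..1} (\<lambda>\<tau>. Q (1 - \<tau>))"
      by (rule continuous_on_compose2[OF cQ]) (auto intro!: continuous_intros)
    show "q0 = q1 + (- h) *\<^sub>R p1 + (- h)^2 *\<^sub>R integral {0..1} (\<lambda>\<tau>. (1 - \<tau>) *\<^sub>R F (1 - \<tau>))"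
      unfolding J' q1 p1 by (simp add: scaleR_add_right scaleR_diff_right power2_eq_square)
    show "p0 = p1 + (- h) *\<^sub>R integral {0..1} (\<lambda>\<tau>. F (1 - \<tau>))"
      unfolding I' p1 by simp
    fix \<tau> :: real assume t: "\<tau> \<in> {0..1}"
    have t': "1 - \<tau> \<in> {0..1}" using t by auto
    show "Q (1 - \<tau>) = q1 + (- h * \<tau>) *\<^sub>R p1 + (- h)^2 *\<^sub>R integral {0..1} (\<lambda>\<sigma>. A \<tau> \<sigma> *\<^sub>R F (1 - \<sigma>))"
      unfolding N'[OF t] Q[OF t'] q1 p1
      by (simp add: scaleR_add_right scaleR_diff_right right_diff_distrib scaleR_diff_left power2_eq_square mult_ac)
  qed
  then show ?thesis unfolding csRKN_step_def by blast
qed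

lemma csRKN_symmetric:
  "csRKN_symmetric A (\<lambda>\<tau>. 1 - \<tau>) (\<lambda>\<tau>. 1) (\<lambda>\<tau>. \<tau>) TYPE('a::euclidean_space)"
  unfolding csRKN_symmetric_def
proof (intro allI impI iffI)
  fix f :: "real \<times> 'a \<Rightarrow> 'a" and t0 q0 p0 h q1 p1
  assume f: "smooth_fun f"
  show "csRKN_step A (\<lambda>\<tau>. 1 - \<tau>) (\<lambda>\<tau>. 1) (\<lambda>\<tau>. \<tau>) f (t0 + h) q1 p1 (- h) q0 p0"
    if "csRKN_step A (\<lambda>\<tau>. 1 - \<tau>) (\<lambda>\<tau>. 1) (\<lambda>\<tau>. \<tau>) f t0 q0 p0 h q1 p1"
    by (rule csRKN_step_reverse[OF f that])
  show "csRKN_step A (\<lambda>\<tau>. 1 - \<tau>) (\<lambda>\<tau>. 1) (\<lambda>\<tau>. \<tau>) f t0 q0 p0 h q1 p1"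
    if "csRKN_step A (\<lambda>\<tau>. 1 - \<tau>) (\<lambda>\<tau>. 1) (\<lambda>\<tau>. \<tau>) f (t0 + h) q1 p1 (- h) q0 p0"
    \<comment> \<open>Reversing the step of size -h from t0 + h leads back to step size h at
      t0.\<close>
    using csRKN_step_reverse[OF f that] by simp
qed

end

section \<open>From the Legendre coefficients to symmetry and order\<close>

theorem theorem3p4:
  fixes \<alpha> :: "nat \<Rightarrow> nat \<Rightarrow> real" and Ab :: "real \<Rightarrow> real \<Rightarrow> real"
  assumes "uniform_limit ({0..1} \<times> {0..1})
     (\<lambda>F (\<tau>, \<sigma>). \<alpha> 0 0 - (1 / (2 * sqrt 3)) / 2 * shLeg 1 \<sigma> + (1 / (2 * sqrt 3)) / 2 * shLeg 1 \<tau>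
         + (\<Sum>(i, j)\<in>F. \<alpha> i j * shLeg i \<tau> * shLeg j \<sigma>))
     (\<lambda>(\<tau>, \<sigma>). Ab \<tau> \<sigma>)
     (finite_subsets_at_top {(i, j). even (i + j) \<and> i + j > 1})"
  shows "(csRKN_symmetric Ab (\<lambda>\<tau>. 1 - \<tau>) (\<lambda>\<tau>. 1) (\<lambda>\<tau>. \<tau>) TYPE('a::euclidean_space) \<and>
          csRKN_order Ab (\<lambda>\<tau>. 1 - \<tau>) (\<lambda>\<tau>. 1) (\<lambda>\<tau>. \<tau>) 2 TYPE('a)) \<and>
         (\<alpha> 0 0 = 1/6 \<longrightarrow> csRKN_order Ab (\<lambda>\<tau>. 1 - \<tau>) (\<lambda>\<tau>. 1) (\<lambda>\<tau>. \<tau>) 4 TYPE('a)) \<and>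
         (\<alpha> 0 0 = 1/6 \<and> \<alpha> 1 1 = - 1/10 \<and> \<alpha> 2 0 = sqrt 5 / 60 \<and> \<alpha> 0 2 = sqrt 5 / 60 \<and>
          (\<forall>i. even i \<and> i > 2 \<longrightarrow> \<alpha> i 0 = 0) \<longrightarrow>
          csRKN_order Ab (\<lambda>\<tau>. 1 - \<tau>) (\<lambda>\<tau>. 1) (\<lambda>\<tau>. \<tau>) 6 TYPE('a))"
proof -
  interpret K: legendre_kernel \<alpha> Ab
    by (unfold legendre_kernel_def partial_kernel_def tail_indices_def) (rule assms)
  have S: "symmetric_kernel Ab"
    by (rule symmetric_kernel.intro[OF K.continuous_A K.A_reflect])
  interpret S: symmetric_kernel Ab by (rule S)
  have "csRKN_order Ab (\<lambda>\<tau>. 1 - \<tau>) (\<lambda>\<tau>. 1) (\<lambda>\<tau>. \<tau>) 2 TYPE('a)"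
    by (rule csRKN_orderI[OF S]) (simp_all add: rkn_problem.convergent_order_2)
  moreover have "csRKN_order Ab (\<lambda>\<tau>. 1 - \<tau>) (\<lambda>\<tau>. 1) (\<lambda>\<tau>. \<tau>) 4 TYPE('a)" if "\<alpha> 0 0 = 1/6"
  proof -
    have "S.moment 0 0 = 0"
      by (rule S.moment_0_0_zero) (use K.A_double_moment[of 0 0] that in simp)
    then show ?thesis
      by (intro csRKN_orderI[OF S]) (simp_all add: rkn_problem.convergent_order_4)
  qed
  moreover have "csRKN_order Ab (\<lambda>\<tau>. 1 - \<tau>) (\<lambda>\<tau>. 1) (\<lambda>\<tau>. \<tau>) 6 TYPE('a)"
    if \<alpha>: "\<alpha> 0 0 = 1/6" "\<alpha> 1 1 = - 1/10" "\<alpha> 2 0 = sqrt 5 / 60" "\<alpha> 0 2 = sqrt 5 / 60"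
      "\<forall>i. even i \<and> i > 2 \<longrightarrow> \<alpha> i 0 = 0"
  proof -
    \<comment> \<open>The coefficients \<alpha>(i, 0) act pointwise in \<tau> through the stage
      condition, whereas \<alpha>(0, 2) and \<alpha>(1, 1) each fix a single moment.\<close>
    have r0: "S.row 0 \<tau> = 0" if "\<tau> \<in> {0..1}" for \<tau>
      by (rule S.row_0_zero[OF that K.A_row_integral[OF \<alpha>(1,3) _ that]]) (use \<alpha>(5) in blast)
    have m02: "S.moment 0 2 = 0"
      by (rule S.moment_0_2_zero[OF r0]) (use K.A_double_moment[of 0 2] \<alpha>(4) in simp_all)
    have m11: "S.moment 1 1 = 0"
      by (rule S.moment_1_1_zero[OF r0]) (use K.A_double_moment[of 1 1] \<alpha>(2) in simp_all)
    show ?thesis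
    proof (rule csRKN_orderI[OF S])
      fix f :: "real \<times> 'a \<Rightarrow> 'a" and t0 q v \<delta> h0
      assume "rkn_problem Ab f t0 q v \<delta> h0"
      then show "rkn_problem.convergent_order Ab f t0 q v h0 6"
        by (rule rkn_problem.convergent_order_6[OF _ r0 m02 m11])
    qed simp
  qed
  ultimately show ?thesis using S.csRKN_symmetric by blast
qed

end
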